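(* Tree-like ${\mathrm{LNDT}}$ is polynomially equivalent to ${\mathrm{LDT}}$ over sequents of DT formulas: there is a polynomial-time procedure which, given a (dag-like) ${\mathrm{LDT}}$ proof of a sequent of DT formulas, outputs a tree-like ${\mathrm{LNDT}}$ proof of the same sequent, and a polynomial-time procedure which, given a tree-like ${\mathrm{LNDT}}$ proof of a sequent of DT formulas, outputs an ${\mathrm{LDT}}$ proof of the same sequent.
   Context: A literal is a propositional variable $x$ or its negation $\overline x$. DT formulas: every literal is a DT formula, and if $A,B$ are DT formulas and $p$ a literal then $(ApB)$ is a DT formula ("if $p$ is false then $A$, else $B$"). NDT (nondeterministic decision tree) formulas are defined by the same clauses plus: if $A,B$ are NDT formulas then $(A\lor B)$ is an NDT formula. Formula size = number of atomic occurrences; proof size = sum of sizes of its formulas. Sequents are $\Gamma\to\Delta$ with $\Gamma,\Delta$ finite multisets of formulas. ${\mathrm{LDT}}$: lines are sequents of DT formulas; initial sequents $p\to p$, $p,\overline p\to$, $\to p,\overline p$; rules contraction and weakening (left and right), cut (from $\Gamma\to\Delta,A$ and $A,\Gamma\to\Delta$ infer $\Gamma\to\Delta$), dec-l (from $A,\Gamma\to\Delta,p$ and $p,B,\Gamma\to\Delta$ infer $ApB,\Gamma\to\Delta$), dec-r (from $\Gamma\to\Delta,A,p$ and $p,\Gamma\to\Delta,B$ infer $\Gamma\to\Delta,ApB$). ${\mathrm{LNDT}}$: lines are sequents of NDT formulas, with the same initial sequents and rules as ${\mathrm{LDT}}$ plus $\lor$-l (from $A,\Gamma\to\Delta$ and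 $B,\Gamma\to\Delta$ infer $A\lor B,\Gamma\to\Delta$) and $\lor$-r (from $\Gamma\to\Delta,A,B$ infer $\Gamma\to\Delta,A\lor B$). Proofs are dag-like (sequences of sequents each an initial sequent or inferred from earlier ones) unless specified tree-like (each sequent used at most once as a premise). *)

theory Defs
  imports Complex_Main "HOL-Library.Multiset" "HOL-Computational_Algebra.Polynomial"
begin

section \<open>Formulas and sequents\<close>

datatype lit = Pos nat | Neg nat

fun compl :: "lit \<Rightarrow> lit" where
  "compl (Pos x) = Neg x"
| "compl (Neg x) = Pos x"

text \<open>\<^term>\<open>Dec A p B\<close> is the decision formula \<open>ApB\<close>: if \<open>p\<close> is false then \<open>A\<close>, else \<open>B\<close>.\<close>

datatype form = Lit lit | Dec form lit form | Or form form

text \<open>The type \<^typ>\<open>form\<close> is the type of NDT formulas; DT formulas are those without disjunction.\<close>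

fun is_DT :: "form \<Rightarrow> bool" where
  "is_DT (Lit p) = True"
| "is_DT (Dec A p B) = (is_DT A \<and> is_DT B)"
| "is_DT (Or A B) = False"

type_synonym sequent = "form multiset \<times> form multiset"

definition DT_sequent :: "sequent \<Rightarrow> bool" where
  "DT_sequent S \<longleftrightarrow> (\<forall>A. A \<in># fst S + snd S \<longrightarrow> is_DT A)"


section \<open>Inferences and proofs\<close>

text \<open>The first argument lists the premises in order; initial sequents have none.\<close>

inductive ldt_inf :: "sequent list \<Rightarrow> sequent \<Rightarrow> bool" where
  init_id: "ldt_inf [] ({#Lit p#}, {#Lit p#})"
| init_l: "ldt_inf [] ({#Lit p, Lit (compl p)#}, {#})"
| init_r: "ldt_inf [] ({#}, {#Lit p, Lit (compl p)#})"
| weak_l: "ldt_inf [(G, D)] (add_mset A G, D)"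
| weak_r: "ldt_inf [(G, D)] (G, add_mset A D)"
| contr_l: "ldt_inf [(add_mset A (add_mset A G), D)] (add_mset A G, D)"
| contr_r: "ldt_inf [(G, add_mset A (add_mset A D))] (G, add_mset A D)"
| cut: "ldt_inf [(G, add_mset A D), (add_mset A G, D)] (G, D)"
| dec_l: "ldt_inf [(add_mset A G, add_mset (Lit p) D), (add_mset (Lit p) (add_mset B G), D)]
            (add_mset (Dec A p B) G, D)"
| dec_r: "ldt_inf [(G, add_mset A (add_mset (Lit p) D)), (add_mset (Lit p) G, add_mset B D)]
            (G, add_mset (Dec A p B) D)"

inductive lndt_inf :: "sequent list \<Rightarrow> sequent \<Rightarrow> bool" where
  ldt: "ldt_inf Ps S \<Longrightarrow> lndt_inf Ps S"
| or_l: "lndt_inf [(add_mset A G, D), (add_mset B G, D)] (add_mset (Or A B) G, D)"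
| or_r: "lndt_inf [(G, add_mset A (add_mset B D))] (G, add_mset (Or A B) D)"

text \<open>
  A written proof is a sequence of lines. Each line consists of a sequent, written as two lists of
  formulas (whose order is irrelevant), and the positions (counted from 0) of the lines that serve
  as the premises of the inference yielding it.
\<close>

type_synonym line = "(form list \<times> form list) \<times> nat list"
type_synonym deriv = "line list"

definition line_seq :: "line \<Rightarrow> sequent" where
  "line_seq l = (mset (fst (fst l)), mset (snd (fst l)))"

definition line_prems :: "line \<Rightarrow> nat list" where
  "line_prems l = snd l"

definition derives :: "(sequent list \<Rightarrow> sequent \<Rightarrow> bool) \<Rightarrow> deriv \<Rightarrow> sequent \<Rightarrow> bool" where
  "derives R \<pi> S \<longleftrightarrow>
     (\<forall>i < length \<pi>. (\<forall>j \<in> set (line_prems (\<pi> ! i)). j < i) \<and>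
        R (map (\<lambda>j. line_seq (\<pi> ! j)) (line_prems (\<pi> ! i))) (line_seq (\<pi> ! i))) \<and>
     \<pi> \<noteq> [] \<and> line_seq (last \<pi>) = S"

definition tree_like :: "deriv \<Rightarrow> bool" where
  "tree_like \<pi> \<longleftrightarrow> distinct (concat (map line_prems \<pi>))"

definition LDT_proof :: "deriv \<Rightarrow> sequent \<Rightarrow> bool" where
  "LDT_proof \<pi> S \<longleftrightarrow> derives ldt_inf \<pi> S \<and> (\<forall>l \<in> set \<pi>. DT_sequent (line_seq l))"

definition tree_LNDT_proof :: "deriv \<Rightarrow> sequent \<Rightarrow> bool" where
  "tree_LNDT_proof \<pi> S \<longleftrightarrow> derives lndt_inf \<pi> S \<and> tree_like \<pi>"


section \<open>Polynomial-time procedures\<close>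

text \<open>
  The machine model is the WHILE language over binary trees of N. D. Jones (Computability and
  Complexity from a Programming Perspective), with tree equality as a primitive and with Jones' unit
  costs replaced by costs that charge for the full size of every value read or built. Hence
  in time \<open>t\<close> only trees of size at most \<open>t\<close> can be constructed, and the model is polynomially
  equivalent to Turing machines, for functions as well as for decision problems.
\<close>

datatype bt = Tip | Bin bt bt

fun hd_bt :: "bt \<Rightarrow> bt" where
  "hd_bt Tip = Tip"
| "hd_bt (Bin a b) = a"

fun tl_bt :: "bt \<Rightarrow> bt" where
  "tl_bt Tip = Tip"
| "tl_bt (Bin a b) = b"

definition true_bt :: bt where
  "true_bt = Bin Tip Tip"

datatype exp = Var nat | Nul | Cons exp exp | Hd exp | Tl exp | Eq exp exp

type_synonym store = "nat \<Rightarrow> bt"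

fun eval :: "exp \<Rightarrow> store \<Rightarrow> bt" where
  "eval (Var x) s = s x"
| "eval Nul s = Tip"
| "eval (Cons e f) s = Bin (eval e s) (eval f s)"
| "eval (Hd e) s = hd_bt (eval e s)"
| "eval (Tl e) s = tl_bt (eval e s)"
| "eval (Eq e f) s = (if eval e s = eval f s then true_bt else Tip)"

text \<open>\<^term>\<open>size (d :: bt)\<close> is the number of \<^const>\<open>Bin\<close> nodes of \<^term>\<open>d\<close>.\<close>

fun cost :: "exp \<Rightarrow> store \<Rightarrow> nat" where
  "cost (Var x) s = size (s x) + 1"
| "cost Nul s = 1"
| "cost (Cons e f) s = cost e s + cost f s + 1"
| "cost (Hd e) s = cost e s + 1"
| "cost (Tl e) s = cost e s + 1"
| "cost (Eq e f) s = cost e s + cost f s + 1"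

datatype com = Skip | Assign nat exp | Seq com com | If exp com com | While exp com

text \<open>\<open>exec c s t s'\<close>: started in \<open>s\<close>, program \<open>c\<close> halts in \<open>s'\<close> after time \<open>t\<close>. \<^const>\<open>Tip\<close> is false.\<close>

inductive exec :: "com \<Rightarrow> store \<Rightarrow> nat \<Rightarrow> store \<Rightarrow> bool" where
  Skip: "exec Skip s 1 s"
| Assign: "exec (Assign x e) s (cost e s + 1) (s(x := eval e s))"
| Seq: "exec c1 s t1 s' \<Longrightarrow> exec c2 s' t2 s'' \<Longrightarrow> exec (Seq c1 c2) s (t1 + t2 + 1) s''"
| IfT: "eval e s \<noteq> Tip \<Longrightarrow> exec c1 s t s' \<Longrightarrow> exec (If e c1 c2) s (cost e s + t + 1) s'"
| IfF: "eval e s = Tip \<Longrightarrow> exec c2 s t s' \<Longrightarrow> exec (If e c1 c2) s (cost e s + t + 1) s'"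
| WhileF: "eval e s = Tip \<Longrightarrow> exec (While e c) s (cost e s + 1) s"
| WhileT: "eval e s \<noteq> Tip \<Longrightarrow> exec c s t1 s' \<Longrightarrow> exec (While e c) s' t2 s'' \<Longrightarrow>
    exec (While e c) s (cost e s + t1 + t2 + 1) s''"

text \<open>Variable 0 holds the input at the start and the output at the end.\<close>

definition init_store :: "bt \<Rightarrow> store" where
  "init_store d = (\<lambda>_. Tip)(0 := d)"

definition runs_to :: "com \<Rightarrow> bt \<Rightarrow> nat \<Rightarrow> bt \<Rightarrow> bool" where
  "runs_to c d t d' \<longleftrightarrow> (\<exists>s. exec c (init_store d) t s \<and> s 0 = d')"

text \<open>
  \<open>enc\<close> and \<open>enc'\<close> are the (injective) encodings of inputs and outputs. The time bound is
  a polynomial in the length of the encoded input and applies to all inputs.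
\<close>

definition polytime :: "('a \<Rightarrow> bt) \<Rightarrow> ('b \<Rightarrow> bt) \<Rightarrow> ('a \<Rightarrow> 'b) \<Rightarrow> bool" where
  "polytime enc enc' f \<longleftrightarrow>
     (\<exists>c :: com. \<exists>p :: nat poly. \<forall>x. \<exists>t \<le> poly p (size (enc x)). runs_to c (enc x) t (enc' (f x)))"

lemma exec_deterministic:
  "exec c s t s' \<Longrightarrow> exec c s u s'' \<Longrightarrow> t = u \<and> s' = s''"
proof (induction arbitrary: u s'' rule: exec.induct)
  case (Skip s) then show ?case by (auto elim: exec.cases)
next
  case (Assign x e s) then show ?case by (auto elim: exec.cases)
next
  case (Seq c1 s t1 s' c2 t2 s'')
  from Seq.prems show ?case by (cases rule: exec.cases) (use Seq.IH in blast)+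
next
  case (IfT e s c1 t s' c2)
  from IfT.prems show ?case by (cases rule: exec.cases) (use IfT in blast)+
next
  case (IfF e s c2 t s' c1)
  from IfF.prems show ?case by (cases rule: exec.cases) (use IfF in blast)+
next
  case (WhileF e s c)
  from WhileF.prems show ?case by (cases rule: exec.cases) (use WhileF in blast)+
next
  case (WhileT e s c t1 s' t2 s'')
  from WhileT.prems show ?case by (cases rule: exec.cases) (use WhileT in blast)+
qed

lemma size_eval_le_cost: "size (eval e s) \<le> cost e s"
proof (induction e)
  case (Hd e) then show ?case by (cases "eval e s") auto
next
  case (Tl e) then show ?case by (cases "eval e s") auto
qed (auto simp: true_bt_def)


section \<open>Encoding of proofs\<close>

definition enc_bool :: "bool \<Rightarrow> bt" where
  "enc_bool b = (if b then true_bt else Tip)"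

fun enc_list :: "('a \<Rightarrow> bt) \<Rightarrow> 'a list \<Rightarrow> bt" where
  "enc_list e [] = Tip"
| "enc_list e (x # xs) = Bin (e x) (enc_list e xs)"

text \<open>Indices of propositional variables are written in binary, least significant bit first.\<close>

fun enc_bin :: "nat \<Rightarrow> bt" where
  "enc_bin n = (if n = 0 then Tip else Bin (enc_bool (odd n)) (enc_bin (n div 2)))"

declare enc_bin.simps [simp del]

text \<open>
  Positions of premises are written in unary. In a proof they are smaller than
  the number of lines, so this is polynomially equivalent to binary notation.
\<close>

fun enc_unary :: "nat \<Rightarrow> bt" where
  "enc_unary 0 = Tip"
| "enc_unary (Suc n) = Bin Tip (enc_unary n)"

fun enc_lit :: "lit \<Rightarrow> bt" where
  "enc_lit (Pos x) = Bin (enc_bool True) (enc_bin x)"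
| "enc_lit (Neg x) = Bin (enc_bool False) (enc_bin x)"

fun enc_form :: "form \<Rightarrow> bt" where
  "enc_form (Lit p) = Bin (enc_unary 0) (enc_lit p)"
| "enc_form (Dec A p B) = Bin (enc_unary 1) (Bin (enc_form A) (Bin (enc_lit p) (enc_form B)))"
| "enc_form (Or A B) = Bin (enc_unary 2) (Bin (enc_form A) (enc_form B))"

fun enc_line :: "line \<Rightarrow> bt" where
  "enc_line ((G, D), js) =
     Bin (Bin (enc_list enc_form G) (enc_list enc_form D)) (enc_list enc_unary js)"

definition enc_deriv :: "deriv \<Rightarrow> bt" where
  "enc_deriv \<pi> = enc_list enc_line \<pi>"

lemma inj_enc_list: "inj e \<Longrightarrow> inj (enc_list e)"
proof (rule injI)
  fix xs ys assume e: "inj e" and "enc_list e xs = enc_list e ys"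
  then show "xs = ys"
  proof (induction xs arbitrary: ys)
    case Nil then show ?case by (cases ys) auto
  next
    case (Cons x xs) then show ?case by (cases ys) (auto dest: injD)
  qed
qed

lemma inj_enc_bin: "inj enc_bin"
proof (rule injI)
  fix m n assume "enc_bin m = enc_bin n"
  then show "m = n"
  proof (induction m arbitrary: n rule: less_induct)
    case (less m)
    show ?case
    proof (cases "m = 0 \<or> n = 0")
      case True
      then show ?thesis using less.prems
        by (auto simp: enc_bin.simps[of m] enc_bin.simps[of n] enc_bin.simps[of 0] split: if_splits)
    next
      case False
      then have "enc_bool (odd m) = enc_bool (odd n)" and "enc_bin (m div 2) = enc_bin (n div 2)"
        using less.prems by (simp_all add: enc_bin.simps[of m] enc_bin.simps[of n])
      moreover from this(2) have "m div 2 = n div 2" using False less.IH[of "m div 2"] by simp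
      ultimately have "even m = even n" "m div 2 = n div 2"
        by (auto simp: enc_bool_def true_bt_def split: if_splits)
      then show ?thesis by presburger
    qed
  qed
qed

lemma inj_enc_unary: "inj enc_unary"
proof (rule injI)
  fix m n assume "enc_unary m = enc_unary n"
  then show "m = n"
  proof (induction m arbitrary: n)
    case 0 then show ?case by (cases n) auto
  next
    case (Suc m) then show ?case by (cases n) auto
  qed
qed

lemma inj_enc_lit: "inj enc_lit"
proof (rule injI)
  fix p q assume "enc_lit p = enc_lit q"
  then show "p = q"
    by (cases p; cases q) (auto simp: enc_bool_def true_bt_def dest: injD[OF inj_enc_bin])
qed

lemma inj_enc_form: "inj enc_form"
proof (rule injI)
  fix A B assume "enc_form A = enc_form B"
  then show "A = B"
  proof (induction A arbitrary: B)
    case (Lit p) then show ?case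
      by (cases B) (auto simp: numeral_2_eq_2 dest: injD[OF inj_enc_lit])
  next
    case (Dec A1 p A2) then show ?case
      by (cases B) (auto simp: numeral_2_eq_2 dest: injD[OF inj_enc_lit])
  next
    case (Or A1 A2) then show ?case
      by (cases B) (auto simp: numeral_2_eq_2)
  qed
qed

lemma inj_enc_deriv: "inj enc_deriv"
proof -
  have "inj enc_line"
  proof (rule injI)
    fix k l assume "enc_line k = enc_line l"
    then show "k = l"
      by (cases k rule: enc_line.cases; cases l rule: enc_line.cases)
        (auto dest: injD[OF inj_enc_list[OF inj_enc_form]] injD[OF inj_enc_list[OF inj_enc_unary]])
  qed
  then show ?thesis unfolding enc_deriv_def[abs_def] by (rule inj_enc_list)
qed

end

theory Submission
  imports Defs
begin

text \<open>
  An LDT sequent \<open>\<Gamma> \<rightarrow> \<Delta>\<close> is expressed by the NDT formula \<open>F\<close> that is the disjunction of \<open>\<Delta>\<close> and the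
  negations of \<open>\<Gamma>\<close>; a DT formula is negated at its leaves. If \<open>F\<^sub>1, \<dots>, F\<^sub>n\<close> express the lines of an LDT
  proof, each \<open>F\<^sub>1, \<dots>, F\<^sub>i\<^sub>-\<^sub>1 \<rightarrow> F\<^sub>i\<close> has a short tree-like proof, obtained by repeating the \<open>i\<close>-th inference
  with side formulas, and \<open>n\<close> cuts combine them into a tree-like proof of the last line.

  Conversely, an NDT formula \<open>A\<close> is equivalent to a disjunction of a list \<open>A*\<close> of polynomially many DT
  formulas, with \<open>A* = A\<close> if \<open>A\<close> is DT. This serves for succedents but not for antecedents, so a line
  \<open>\<Gamma> \<rightarrow> \<Delta>\<close> of a tree-like LNDT proof with conclusion \<open>\<Pi> \<rightarrow> \<Sigma>\<close> is read as: from \<open>\<Pi> \<rightarrow> \<Lambda>, A*\<close> for all \<open>A\<close> in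
  \<open>\<Gamma>\<close>, derive \<open>\<Pi> \<rightarrow> \<Lambda>\<close>. Here \<open>\<Lambda>\<close> collects the \<open>B*\<close> for all succedent formulas \<open>B\<close> on the path from the line
  to the root, and it is well defined because the proof is a tree. The inferences need not be
  recognized: instances of local rules for all relevant formulas and contexts are generated, and
  those with underivable premises are skipped.
\<close>

section \<open>Polynomial-time functions on encodable types\<close>

text \<open>The obstacle to a tree is the reuse of a line. A formula in an antecedent can be copied
  by contraction, so a line that has become a formula may again be used many times.

  In the converse, \<open>star A\<close> on the left would demand one derivation per member, and for
  several antecedent formulas these choices multiply; on the right it is merely a part of the
  succedent. Read as transformers of succedents, the premises of a binary rule are used in order:
  what the first one yields becomes a hypothesis for the second. Side formulas only accumulate
  towards the leaves, so hypotheses pass upwards by weakening. In a dag, a line would need different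
  side formulas for different paths to the root.

  The time bounds refer to a concrete machine. Both constructions are therefore expressed by maps,
  filters and folds over lists and by recursion on formulas with additive growth, and proofs are
  built as flat postfix codes or lists of instances rather than as recursive trees.\<close>

class encodable =
  fixes enc :: "'a \<Rightarrow> bt"
  assumes inj_enc: "inj enc"

instantiation bt :: encodable
begin
definition enc_bt :: "bt \<Rightarrow> bt" where [simp]: "enc_bt d = d"
instance by standard (simp add: inj_def)
end

instantiation bool :: encodable
begin
definition enc_bool' [simp]: "enc b = enc_bool b"
instance by standard (auto simp: inj_def enc_bool_def true_bt_def split: if_splits)
end

instantiation nat :: encodable
begin
definition enc_nat: "enc n = enc_unary n"
instance by standard (auto simp: inj_def enc_nat dest: injD[OF inj_enc_unary])
end

instantiation lit :: encodable
begin
definition enc_lit': "enc p = enc_lit p"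
instance by standard (auto simp: inj_def enc_lit' dest: injD[OF inj_enc_lit])
end

instantiation form :: encodable
begin
definition enc_form': "enc A = enc_form A"
instance by standard (auto simp: inj_def enc_form' dest: injD[OF inj_enc_form])
end

instantiation list :: (encodable) encodable
begin
definition enc_list': "enc xs = enc_list enc xs"
instance
proof
  have "(enc :: 'a list \<Rightarrow> bt) = enc_list enc" by (rule ext) (simp add: enc_list')
  then show "inj (enc :: 'a list \<Rightarrow> bt)" using inj_enc_list[OF inj_enc] by metis
qed
end

instantiation prod :: (encodable, encodable) encodable
begin
definition enc_prod [simp]: "enc z = Bin (enc (fst z)) (enc (snd z))"
instance by standard (auto simp: inj_def dest: injD[OF inj_enc])
end

lemma enc_line_eq: "enc_line l = enc l"
proof -
  have "(enc :: form \<Rightarrow> bt) = enc_form" "(enc :: nat \<Rightarrow> bt) = enc_unary"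
    by (rule ext, simp add: enc_form' enc_nat)+
  then show ?thesis by (cases l rule: enc_line.cases) (simp add: enc_list')
qed

lemma enc_deriv_eq: "enc_deriv = enc"
proof
  fix \<pi> :: deriv
  have "enc_line = enc" by (rule ext) (rule enc_line_eq)
  then show "enc_deriv \<pi> = enc \<pi>" by (simp add: enc_deriv_def enc_list')
qed

lemma enc_list_simps [simp]: "enc [] = Tip" "enc (x # xs) = Bin (enc x) (enc xs)"
  by (simp_all add: enc_list')

lemma enc_nat_simps [simp]: "enc (0 :: nat) = Tip" "enc (Suc n) = Bin Tip (enc n)"
  by (simp_all add: enc_nat)

lemma enc_lit_simps [simp]:
  "enc (Pos n) = Bin true_bt (enc_bin n)" "enc (Neg n) = Bin Tip (enc_bin n)"
  by (simp_all add: enc_lit' enc_bool_def)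

lemma enc_form_simps [simp]:
  "enc (Lit p) = Bin Tip (enc p)"
  "enc (Dec A p B) = Bin true_bt (Bin (enc A) (Bin (enc p) (enc B)))"
  "enc (Or A B) = Bin (Bin Tip true_bt) (Bin (enc A) (enc B))"
  by (simp_all add: enc_form' enc_lit' numeral_2_eq_2 true_bt_def)

section \<open>Polynomial bounds in the size of the encoded argument\<close>

abbreviation esize :: "'a::encodable \<Rightarrow> nat" where
  "esize x \<equiv> size (enc x)"

lemma enc_eq_iff [simp]: "enc x = enc y \<longleftrightarrow> x = y"
  by (auto dest: injD[OF inj_enc])

text \<open>Natural coefficients make every bounding polynomial monotone, so it may be evaluated at
  an upper bound of the true size. Composition of bounds rests on this.\<close>

lemma poly_nat_mono: "m \<le> n \<Longrightarrow> poly p m \<le> poly p (n::nat)"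
  by (induction p) (auto intro!: add_mono mult_mono)

definition pbd :: "('a::encodable \<Rightarrow> nat) \<Rightarrow> bool" where
  "pbd h \<longleftrightarrow> (\<exists>p. \<forall>x. h x \<le> poly p (esize x))"

lemma pbd_mono: "pbd k \<Longrightarrow> (\<And>x. h x \<le> k x) \<Longrightarrow> pbd h"
  unfolding pbd_def using le_trans by blast

lemma pbd_const: "pbd (\<lambda>x. c)"
  unfolding pbd_def by (rule exI[of _ "[:c:]"]) simp

lemma pbd_add: "pbd h \<Longrightarrow> pbd k \<Longrightarrow> pbd (\<lambda>x. h x + k x)"
  unfolding pbd_def
  by (elim exE, rule_tac x="p + pa" in exI) (simp add: add_mono)

lemma pbd_mult: "pbd h \<Longrightarrow> pbd k \<Longrightarrow> pbd (\<lambda>x. h x * k x)"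
  unfolding pbd_def
  by (elim exE, rule_tac x="p * pa" in exI) (simp add: mult_mono)

lemma pbd_Suc: "pbd h \<Longrightarrow> pbd (\<lambda>x. Suc (h x))"
  using pbd_add[OF _ pbd_const[of 1]] by fastforce

lemma pbd_esize: "pbd (\<lambda>x. esize x)"
  unfolding pbd_def by (rule exI[of _ "[:0,1:]"]) simp

lemma pbd_poly: "pbd h \<Longrightarrow> pbd (\<lambda>x. poly p (h x))"
  unfolding pbd_def
proof (elim exE)
  fix q assume q: "\<forall>x. h x \<le> poly q (esize x)"
  show "\<exists>r. \<forall>x. poly p (h x) \<le> poly r (esize x)"
    by (rule exI[of _ "pcompose p q"]) (simp add: poly_pcompose q poly_nat_mono)
qed

lemma pbd_comp: "pbd h \<Longrightarrow> pbd (\<lambda>x. esize (f x)) \<Longrightarrow> pbd (\<lambda>x. h (f x))"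
proof -
  assume "pbd h" and f: "pbd (\<lambda>x. esize (f x))"
  then obtain p where "\<forall>x. h x \<le> poly p (esize x)" unfolding pbd_def by blast
  then show ?thesis by (intro pbd_mono[OF pbd_poly[OF f]]) auto
qed

text \<open>The other variables are arbitrary and end unchanged, so a program acts as a pure
  transformation of variable 0. The number \<open>n\<close> is only an upper bound and may be
  loosened.\<close>

definition turns :: "com \<Rightarrow> bt \<Rightarrow> nat \<Rightarrow> bt \<Rightarrow> bool" where
  "turns c d n d' \<longleftrightarrow> (\<forall>s. \<exists>t \<le> n. exec c (s(0 := d)) t (s(0 := d')))"

lemma turns_mono: "turns c d n d' \<Longrightarrow> n \<le> m \<Longrightarrow> turns c d m d'"
  unfolding turns_def using le_trans by blast

lemma turns_Seq:
  assumes "turns c1 d n1 d1" "turns c2 d1 n2 d2"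
  shows "turns (Seq c1 c2) d (n1 + n2 + 1) d2"
  unfolding turns_def
proof
  fix s
  obtain t1 t2 where "t1 \<le> n1" "exec c1 (s(0 := d)) t1 (s(0 := d1))"
    "t2 \<le> n2" "exec c2 (s(0 := d1)) t2 (s(0 := d2))"
    using assms unfolding turns_def by meson
  then show "\<exists>t\<le>n1 + n2 + 1. exec (Seq c1 c2) (s(0 := d)) t (s(0 := d2))"
    by (intro exI[of _ "t1 + t2 + 1"]) (auto intro: exec.Seq[simplified])
qed

text \<open>Programs use variable 0 only: \<open>only0 e\<close> makes evaluation a function of its value.\<close>

fun only0 :: "exp \<Rightarrow> bool" where
  "only0 (Var x) = (x = 0)"
| "only0 Nul = True"
| "only0 (Cons e f) = (only0 e \<and> only0 f)"
| "only0 (Hd e) = only0 e"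
| "only0 (Tl e) = only0 e"
| "only0 (Eq e f) = (only0 e \<and> only0 f)"

definition st0 :: "bt \<Rightarrow> store" where "st0 d = (\<lambda>_. d)"

lemma only0_eval: "only0 e \<Longrightarrow> eval e (s(0 := d)) = eval e (st0 d)"
  by (induction e) (auto simp: st0_def)

lemma only0_cost: "only0 e \<Longrightarrow> cost e (s(0 := d)) = cost e (st0 d)"
  by (induction e) (auto simp: st0_def)

text \<open>A leaf of an expression costs at most \<open>size d + 1\<close> and an inner node adds
  1. The product depends on the store only through \<open>size d\<close>, and linearly.\<close>

definition ecost :: "exp \<Rightarrow> bt \<Rightarrow> nat" where
  "ecost e d = Suc (2 * size e) * (size d + 2)"

lemma cost_le: "cost e (st0 d) \<le> ecost e d"
  unfolding ecost_def by (induction e) (auto simp: st0_def algebra_simps)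

lemma turns_Assign:
  assumes "only0 e" "eval e (st0 d) = d'"
  shows "turns (Assign 0 e) d (ecost e d + 1) d'"
  unfolding turns_def
proof
  fix s
  have "exec (Assign 0 e) (s(0 := d)) (cost e (st0 d) + 1) (s(0 := d'))"
    using exec.Assign[of 0 e "s(0 := d)"] assms by (simp add: only0_eval only0_cost)
  then show "\<exists>t\<le>ecost e d + 1. exec (Assign 0 e) (s(0 := d)) t (s(0 := d'))"
    using cost_le[of e d] by (intro exI[of _ "cost e (st0 d) + 1"]) auto
qed

lemma turns_If:
  assumes e: "only0 e"
    and T: "eval e (st0 d) \<noteq> Tip \<Longrightarrow> turns c1 d n d'"
    and F: "eval e (st0 d) = Tip \<Longrightarrow> turns c2 d n d'"
  shows "turns (If e c1 c2) d (ecost e d + n + 1) d'"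
  unfolding turns_def
proof
  fix s
  have le: "cost e (s(0 := d)) \<le> ecost e d" using cost_le only0_cost[OF e] by simp
  show "\<exists>t\<le>ecost e d + n + 1. exec (If e c1 c2) (s(0 := d)) t (s(0 := d'))"
  proof (cases "eval e (st0 d) = Tip")
    case True
    then obtain t where "t \<le> n" "exec c2 (s(0 := d)) t (s(0 := d'))"
      using F unfolding turns_def by meson
    then show ?thesis using le True e exec.IfF[of e "s(0 := d)" c2 t _ c1]
      by (intro exI[of _ "cost e (s(0 := d)) + t + 1"]) (simp add: only0_eval)
  next
    case False
    then obtain t where "t \<le> n" "exec c1 (s(0 := d)) t (s(0 := d'))"
      using T unfolding turns_def by meson
    then show ?thesis using le False e exec.IfT[of e "s(0 := d)" c1 t _ c2]
      by (intro exI[of _ "cost e (s(0 := d)) + t + 1"]) (simp add: only0_eval)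
  qed
qed

text \<open>\<open>D\<close> traces variable 0 through the \<open>n\<close> rounds, with uniform
  bounds \<open>m\<close> for a round and \<open>b\<close> for a test. The factor
  \<open>Suc n\<close> accounts for the test that ends the loop.\<close>

lemma turns_While:
  assumes e: "only0 e"
    and "\<And>i. i < n \<Longrightarrow> eval e (st0 (D i)) \<noteq> Tip"
    and "\<And>i. i < n \<Longrightarrow> turns c (D i) m (D (Suc i))"
    and "eval e (st0 (D n)) = Tip"
    and "\<And>i. i \<le> n \<Longrightarrow> ecost e (D i) \<le> b"
  shows "turns (While e c) (D 0) (Suc n * (b + m + 1)) (D n)"
  using assms(2-)
proof (induction n arbitrary: D)
  case 0
  show ?case unfolding turns_def
  proof
    fix s
    have "cost e (s(0 := D 0)) \<le> b"
      using cost_le[of e "D 0"] only0_cost[OF e] "0.prems"(4)[of 0] by simp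
    then show "\<exists>t\<le>Suc 0 * (b + m + 1). exec (While e c) (s(0 := D 0)) t (s(0 := D 0))"
      using exec.WhileF[of e "s(0 := D 0)" c] "0.prems"(3) e
      by (intro exI[of _ "cost e (s(0 := D 0)) + 1"]) (simp add: only0_eval)
  qed
next
  case (Suc n)
  have IH: "turns (While e c) (D 1) (Suc n * (b + m + 1)) (D (Suc n))"
    using Suc.IH[of "\<lambda>i. D (Suc i)"] Suc.prems by simp
  show ?case unfolding turns_def
  proof
    fix s
    have le: "cost e (s(0 := D 0)) \<le> b"
      using cost_le[of e "D 0"] only0_cost[OF e] Suc.prems(4)[of 0] by simp
    obtain t1 where t1: "t1 \<le> m" "exec c (s(0 := D 0)) t1 (s(0 := D 1))"
      using Suc.prems(2)[of 0] unfolding turns_def by auto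
    obtain t2 where t2: "t2 \<le> Suc n * (b + m + 1)"
      "exec (While e c) (s(0 := D 1)) t2 (s(0 := D (Suc n)))"
      using IH unfolding turns_def by meson
    have "exec (While e c) (s(0 := D 0)) (cost e (s(0 := D 0)) + t1 + t2 + 1) (s(0 := D (Suc n)))"
      using exec.WhileT[OF _ t1(2) t2(2)] Suc.prems(1)[of 0] e by (simp add: only0_eval)
    then show "\<exists>t\<le>Suc (Suc n) * (b + m + 1).
        exec (While e c) (s(0 := D 0)) t (s(0 := D (Suc n)))"
      using le t1(1) t2(1) by (intro exI[of _ "cost e (s(0 := D 0)) + t1 + t2 + 1"]) simp
  qed
qed

text \<open>
  A program for \<open>f\<close> replaces the top of a stack held in variable 0. Its time may depend on the
  stack below, since every access to variable 0 is charged for the whole stack.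
\<close>

definition pt_by :: "com \<Rightarrow> ('a \<times> bt \<Rightarrow> nat) \<Rightarrow> ('a::encodable \<Rightarrow> 'b::encodable) \<Rightarrow> bool" where
  "pt_by c h f \<longleftrightarrow> pbd (\<lambda>x. esize (f x)) \<and> pbd h \<and>
     (\<forall>x r. turns c (Bin (enc x) r) (h (x, r)) (Bin (enc (f x)) r))"

definition pt :: "('a::encodable \<Rightarrow> 'b::encodable) \<Rightarrow> bool" where
  "pt f \<longleftrightarrow> (\<exists>c h. pt_by c h f)"

lemma pt_byD:
  assumes "pt_by c h f"
  shows "pbd (\<lambda>x. esize (f x))" "pbd h" "turns c (Bin (enc x) r) (h (x, r)) (Bin (enc (f x)) r)"
  using assms unfolding pt_by_def by blast+

lemma ptI:
  assumes "pbd (\<lambda>x. esize (f x))" "pbd h"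
    "\<And>x r. turns c (Bin (enc x) r) (h (x, r)) (Bin (enc (f x)) r)"
  shows "pt f"
  using assms unfolding pt_def pt_by_def by blast

lemma ptE:
  assumes "pt f"
  obtains c h where "pt_by c h f"
  using assms unfolding pt_def by blast

lemma pt_esize: "pt f \<Longrightarrow> pbd (\<lambda>x. esize (f x))"
  by (erule ptE) (rule pt_byD)

lemma pbd_pt: "pt f \<Longrightarrow> pbd (\<lambda>x. esize (g x)) \<Longrightarrow> pbd (\<lambda>x. esize (f (g x)))"
  by (rule pbd_comp[OF pt_esize])

lemma pbd_fst: "pbd (\<lambda>x. esize (g x)) \<Longrightarrow> pbd (\<lambda>x. esize (fst (g x)))"
  by (erule pbd_mono) simp

lemma pbd_snd: "pbd (\<lambda>x. esize (g x)) \<Longrightarrow> pbd (\<lambda>x. esize (snd (g x)))"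
  by (erule pbd_mono) simp

lemma pbd_size_fst: "pbd (\<lambda>x. esize (g x)) \<Longrightarrow> pbd (\<lambda>x. size (fst (g x) :: bt))"
  by (erule pbd_mono) simp

lemma pbd_size_snd: "pbd (\<lambda>x. esize (g x)) \<Longrightarrow> pbd (\<lambda>x. size (snd (g x) :: bt))"
  by (erule pbd_mono) simp

lemmas pbd_intros = pbd_const pbd_add pbd_mult pbd_Suc pbd_fst pbd_snd pbd_esize
  pbd_size_fst pbd_size_snd

lemma pbd_ecost: "pbd (\<lambda>x. size (g x)) \<Longrightarrow> pbd (\<lambda>x. ecost e (g x))"
  unfolding ecost_def by (intro pbd_intros)

text \<open>No separate estimate for the size of \<open>f x\<close> is needed: the cost of
  evaluating an expression bounds the size of its value.\<close>

lemma pt_expression: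
  assumes "only0 e" "\<And>x r. eval e (st0 (Bin (enc x) r)) = Bin (enc (f x)) r"
  shows "pt f"
proof (rule ptI)
  show "pbd (\<lambda>x. esize (f x))"
  proof (rule pbd_mono)
    show "pbd (\<lambda>x. ecost e (Bin (enc x) Tip))" by (intro pbd_ecost) (simp, intro pbd_intros)
    fix x
    show "esize (f x) \<le> ecost e (Bin (enc x) Tip)"
      using size_eval_le_cost[of e "st0 (Bin (enc x) Tip)"] cost_le[of e "Bin (enc x) Tip"] assms(2)[of x Tip]
      by simp
  qed
  show "pbd (\<lambda>z. ecost e (Bin (enc (fst z)) (snd z)) + 1)"
    by (intro pbd_intros pbd_ecost) (simp, intro pbd_intros)
  show "turns (Assign 0 e) (Bin (enc x) r) (ecost e (Bin (enc (fst (x, r))) (snd (x, r))) + 1)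
      (Bin (enc (f x)) r)" for x r
    using turns_Assign[OF assms(1) assms(2)] by simp
qed

section \<open>Closure under composition, pairing, branching and loops\<close>

lemma pt_comp:
  assumes "pt f" "pt g"
  shows "pt (\<lambda>x. f (g x))"
proof -
  obtain cf hf where "pt_by cf hf f" using assms(1) by (rule ptE)
  note f = pt_byD[OF this]
  obtain cg hg where "pt_by cg hg g" using assms(2) by (rule ptE)
  note g = pt_byD[OF this]
  show ?thesis
  proof (rule ptI)
    show "pbd (\<lambda>x. esize (f (g x)))" by (rule pbd_comp[OF f(1) g(1)])
    show "pbd (\<lambda>z. hg z + hf (g (fst z), snd z) + 1)"
      by (intro pbd_intros g(2) pbd_comp[OF f(2)], simp, intro pbd_intros pbd_comp[OF g(1)])
    show "turns (Seq cg cf) (Bin (enc x) r) (hg (x, r) + hf (g (fst (x, r)), snd (x, r)) + 1)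
        (Bin (enc (f (g x))) r)" for x r
      using turns_Seq[OF g(3) f(3)] by simp
  qed
qed

abbreviation "v0 \<equiv> Var 0"

lemma st0_apply [simp]: "st0 d x = d"
  by (simp add: st0_def)

lemma pt_Pair:
  assumes "pt f" "pt g"
  shows "pt (\<lambda>x. (f x, g x))"
proof -
  obtain cf hf where "pt_by cf hf f" using assms(1) by (rule ptE)
  note f = pt_byD[OF this]
  obtain cg hg where "pt_by cg hg g" using assms(2) by (rule ptE)
  note g = pt_byD[OF this]
  \<comment> \<open>From top to bottom the stack is \<open>x, x, r\<close>, then
    \<open>f x, x, r\<close>, then after the swap \<open>e2\<close> it is \<open>x, f x, r\<close>,
    then \<open>g x, f x, r\<close>. Finally \<open>e3\<close> joins the two results.\<close>
  define e1 where "e1 = Cons (Hd v0) v0"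
  define e2 where "e2 = Cons (Hd (Tl v0)) (Cons (Hd v0) (Tl (Tl v0)))"
  define e3 where "e3 = Cons (Cons (Hd (Tl v0)) (Hd v0)) (Tl (Tl v0))"
  have [simp]: "only0 e1" "only0 e2" "only0 e3" by (auto simp: e1_def e2_def e3_def)
  define H where "H = (\<lambda>z. ecost e1 (Bin (enc (fst z)) (snd z)) + 1 +
     (hf (fst z, Bin (enc (fst z)) (snd z)) +
     (ecost e2 (Bin (enc (f (fst z))) (Bin (enc (fst z)) (snd z))) + 1 +
     (hg (fst z, Bin (enc (f (fst z))) (snd z)) +
     (ecost e3 (Bin (enc (g (fst z))) (Bin (enc (f (fst z))) (snd z))) + 1) + 1) + 1) + 1) + 1)"
  show ?thesis
  proof (rule ptI)
    show "pbd (\<lambda>x. esize (f x, g x))" by (simp, intro pbd_intros f g)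
    show "pbd H" unfolding H_def
      by (intro pbd_intros pbd_comp[OF f(2)] pbd_comp[OF g(2)] pbd_ecost; simp;
          intro pbd_intros pbd_comp[OF g(1)] pbd_comp[OF f(1)])
    show "turns (Seq (Assign 0 e1) (Seq cf (Seq (Assign 0 e2) (Seq cg (Assign 0 e3)))))
        (Bin (enc x) r) (H (x, r)) (Bin (enc (f x, g x)) r)" for x r
      unfolding H_def fst_conv snd_conv
      by (rule turns_Seq[OF turns_Assign turns_Seq[OF f(3) turns_Seq[OF turns_Assign
              turns_Seq[OF g(3) turns_Assign]]]]) (simp_all add: e1_def e2_def e3_def)
  qed
qed

lemma pt_If:
  assumes "pt b" "pt f" "pt g"
  shows "pt (\<lambda>x. if b x then f x else g x)"
proof -
  obtain cb hb where "pt_by cb hb b" using assms(1) by (rule ptE)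
  note b = pt_byD[OF this]
  obtain cf hf where "pt_by cf hf f" using assms(2) by (rule ptE)
  note f = pt_byD[OF this]
  obtain cg hg where "pt_by cg hg g" using assms(3) by (rule ptE)
  note g = pt_byD[OF this]
  define e1 where "e1 = Cons (Hd v0) v0"
  define e2 where "e2 = Hd v0"
  define e3 where "e3 = Tl v0"
  have [simp]: "only0 e1" "only0 e2" "only0 e3" by (auto simp: e1_def e2_def e3_def)
  \<comment> \<open>The test consumes a copy of \<open>x\<close>. Each branch first drops the truth
    value with \<open>e3\<close>, which brings \<open>x\<close> back to the top.\<close>
  define B where "B = (\<lambda>z. Bin (enc (b (fst z))) (Bin (enc (fst z)) (snd z)))"
  define H where "H = (\<lambda>z. ecost e1 (Bin (enc (fst z)) (snd z)) + 1 +
     (hb (fst z, Bin (enc (fst z)) (snd z)) +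
     (ecost e2 (B z) + (ecost e3 (B z) + 1 + (hf z + hg z) + 1) + 1) + 1) + 1)"
  show ?thesis
  proof (rule ptI)
    show "pbd (\<lambda>x. esize (if b x then f x else g x))"
      by (rule pbd_mono[OF pbd_add[OF f(1) g(1)]]) simp
    show "pbd H" unfolding H_def B_def
      by (intro pbd_intros f(2) g(2) pbd_comp[OF b(2)] pbd_ecost; simp;
          intro pbd_intros pbd_comp[OF b(1), simplified])
    show "turns (Seq (Assign 0 e1) (Seq cb (If e2 (Seq (Assign 0 e3) cf) (Seq (Assign 0 e3) cg))))
        (Bin (enc x) r) (H (x, r)) (Bin (enc (if b x then f x else g x)) r)" for x r
      unfolding H_def B_def fst_conv snd_conv
    proof (rule turns_Seq[OF turns_Assign turns_Seq[OF b(3) turns_If]])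
      show "turns (Seq (Assign 0 e3) cf) (Bin (enc (b x)) (Bin (enc x) r))
          (ecost e3 (Bin (enc (b x)) (Bin (enc x) r)) + 1 + (hf (x, r) + hg (x, r)) + 1)
          (Bin (enc (if b x then f x else g x)) r)"
        if "eval e2 (st0 (Bin (enc (b x)) (Bin (enc x) r))) \<noteq> Tip"
        using that turns_mono[OF f(3)]
        by (intro turns_Seq[OF turns_Assign]) (auto simp: e2_def e3_def enc_bool_def)
      show "turns (Seq (Assign 0 e3) cg) (Bin (enc (b x)) (Bin (enc x) r))
          (ecost e3 (Bin (enc (b x)) (Bin (enc x) r)) + 1 + (hf (x, r) + hg (x, r)) + 1)
          (Bin (enc (if b x then f x else g x)) r)"
        if "eval e2 (st0 (Bin (enc (b x)) (Bin (enc x) r))) = Tip"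
        using that turns_mono[OF g(3)]
        by (intro turns_Seq[OF turns_Assign])
          (auto simp: e2_def e3_def enc_bool_def true_bt_def split: if_splits)
    qed (simp_all add: e1_def)
  qed
qed

text \<open>One bound \<open>N\<close> controls both the number of rounds and the sizes of all
  intermediate states. Bounding the rounds alone would not do, since a step that doubles its
  argument is itself polynomial.\<close>

lemma pt_while:
  fixes init :: "'a::encodable \<Rightarrow> 's::encodable" and step :: "'s \<Rightarrow> 's" and out :: "'a \<Rightarrow> 's"
  assumes "pt init" "pt step" "pt test" "pbd N"
    and run: "\<And>x. \<exists>n \<le> N x. (\<forall>i \<le> n. esize ((step ^^ i) (init x)) \<le> N x) \<and>
      (\<forall>i < n. test ((step ^^ i) (init x))) \<and> \<not> test ((step ^^ n) (init x)) \<and>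
      out x = (step ^^ n) (init x)"
  shows "pt out"
proof -
  obtain ci hi where "pt_by ci hi init" using assms(1) by (rule ptE)
  note i = pt_byD[OF this]
  obtain cs hs where "pt_by cs hs step" using assms(2) by (rule ptE)
  note s = pt_byD[OF this]
  obtain ct ht where "pt_by ct ht test" using assms(3) by (rule ptE)
  note t = pt_byD[OF this]
  define e1 where "e1 = Cons (Hd v0) v0"
  define e2 where "e2 = Hd v0"
  define e3 where "e3 = Tl v0"
  have [simp]: "only0 e1" "only0 e2" "only0 e3" by (auto simp: e1_def e2_def e3_def)
  obtain p where p: "\<And>z. hs z \<le> poly p (esize z)" using s(2) unfolding pbd_def by blast
  obtain q where q: "\<And>z. ht z \<le> poly q (esize z)" using t(2) unfolding pbd_def by blast
  \<comment> \<open>\<open>L\<close> bounds the whole stack: two copies of the state before a test,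
    or a truth value and the state after it, above the untouched rest.\<close>
  define L where "L = (\<lambda>z. 2 * N (fst z) + size (snd z :: bt) + 3)"
  define E where "E = (\<lambda>e z. Suc (2 * size (e :: exp)) * (L z + 2))"
  define M where "M = (\<lambda>z. E e3 z + 1 + (poly p (L z) + (E e1 z + 1 + poly q (L z) + 1) + 1) + 1)"
  define H where "H = (\<lambda>z. hi z + (E e1 z + 1 + (poly q (L z) +
    (Suc (N (fst z)) * (E e2 z + M z + 1) + (E e3 z + 1) + 1) + 1) + 1) + 1)"
  have L: "pbd L" unfolding L_def by (intro pbd_intros pbd_comp[OF assms(4)])
  have "pbd (E e)" for e unfolding E_def by (intro pbd_intros L)
  note pb = pbd_intros L this pbd_poly i(2) pbd_comp[OF assms(4)]
  have enc_bool_le: "size (enc_bool b) \<le> 1" for b by (simp add: enc_bool_def true_bt_def)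
  show ?thesis
  proof (rule ptI)
    show "pbd (\<lambda>x. esize (out x))"
    proof (rule pbd_mono[OF assms(4)])
      show "esize (out x) \<le> N x" for x using run[of x] by auto
    qed
    show "pbd H" unfolding H_def M_def by (intro pb)
    fix x r
    obtain n where n: "n \<le> N x" "\<forall>i \<le> n. esize ((step ^^ i) (init x)) \<le> N x"
      "\<forall>i < n. test ((step ^^ i) (init x))" "\<not> test ((step ^^ n) (init x))"
      "out x = (step ^^ n) (init x)" using run by blast
    define S where "S = (\<lambda>i. (step ^^ i) (init x))"
    define D where "D = (\<lambda>i. Bin (enc (test (S i))) (Bin (enc (S i)) r))"
    have S: "esize (S i) \<le> N x" if "i \<le> n" for i using n(2) that by (simp add: S_def)
    have ec: "ecost e d \<le> E e (x, r)" if "size d \<le> L (x, r)" for e d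
      unfolding ecost_def E_def using that by (intro mult_le_mono) auto
    have D: "size (D i) \<le> L (x, r)" if "i \<le> n" for i
      using S[OF that] enc_bool_le[of "test (S i)"] by (simp add: D_def L_def)
    have tst: "turns (Seq (Assign 0 e1) ct) (Bin (enc (S i)) r) (E e1 (x, r) + 1 + poly q (L (x, r)) + 1) (D i)"
      if "i \<le> n" for i
    proof (intro turns_Seq)
      show "turns (Assign 0 e1) (Bin (enc (S i)) r) (E e1 (x, r) + 1) (Bin (enc (S i)) (Bin (enc (S i)) r))"
        by (rule turns_mono[OF turns_Assign])
          (use S[OF that] in \<open>simp_all add: e1_def ec L_def\<close>)
      show "turns ct (Bin (enc (S i)) (Bin (enc (S i)) r)) (poly q (L (x, r))) (D i)"
        unfolding D_def using S[OF that]
        by (intro turns_mono[OF t(3)] order_trans[OF q] poly_nat_mono) (simp add: L_def)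
    qed
    have body: "turns (Seq (Assign 0 e3) (Seq cs (Seq (Assign 0 e1) ct))) (D i) (M (x, r)) (D (Suc i))"
      if "i < n" for i
      unfolding M_def
    proof (rule turns_Seq[OF _ turns_Seq])
      show "turns (Assign 0 e3) (D i) (E e3 (x, r) + 1) (Bin (enc (S i)) r)"
        by (rule turns_mono[OF turns_Assign]) (use ec[OF D[of i]] that in \<open>simp_all add: e3_def D_def\<close>)
      show "turns cs (Bin (enc (S i)) r) (poly p (L (x, r))) (Bin (enc (S (Suc i))) r)"
        using S[of i] that s(3)[where x = "S i" and r = r]
        by (intro turns_mono[OF _ order_trans[OF p poly_nat_mono]]) (auto simp: L_def S_def)
      show "turns (Seq (Assign 0 e1) ct) (Bin (enc (S (Suc i))) r)
        (E e1 (x, r) + 1 + poly q (L (x, r)) + 1) (D (Suc i))"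
        using tst[of "Suc i"] that by simp
    qed
    have loop: "turns (While e2 (Seq (Assign 0 e3) (Seq cs (Seq (Assign 0 e1) ct)))) (D 0)
        (Suc n * (E e2 (x, r) + M (x, r) + 1)) (D n)"
      by (intro turns_While body)
        (use n(3,4) ec[OF D] in \<open>simp_all add: e2_def D_def S_def enc_bool_def true_bt_def\<close>)
    have fin: "turns (Assign 0 e3) (D n) (E e3 (x, r) + 1) (Bin (enc (out x)) r)"
      by (rule turns_mono[OF turns_Assign]) (use ec[OF D[of n]] n(5) in \<open>simp_all add: e3_def D_def S_def\<close>)
    have "turns (Seq ci (Seq (Seq (Assign 0 e1) ct)
        (Seq (While e2 (Seq (Assign 0 e3) (Seq cs (Seq (Assign 0 e1) ct)))) (Assign 0 e3))))
        (Bin (enc x) r) (hi (x, r) + ((E e1 (x, r) + 1 + poly q (L (x, r)) + 1) +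
          (Suc n * (E e2 (x, r) + M (x, r) + 1) + (E e3 (x, r) + 1) + 1) + 1) + 1) (Bin (enc (out x)) r)"
    proof (rule turns_Seq[OF i(3) turns_Seq[OF _ turns_Seq[OF loop fin]]])
      show "turns (Seq (Assign 0 e1) ct) (Bin (enc (init x)) r) (E e1 (x, r) + 1 + poly q (L (x, r)) + 1) (D 0)"
        using tst[of 0] by (simp add: S_def)
    qed
    then show "turns (Seq ci (Seq (Seq (Assign 0 e1) ct)
        (Seq (While e2 (Seq (Assign 0 e3) (Seq cs (Seq (Assign 0 e1) ct)))) (Assign 0 e3))))
        (Bin (enc x) r) (H (x, r)) (Bin (enc (out x)) r)"
    proof (rule turns_mono)
      have "Suc n * (E e2 (x, r) + M (x, r) + 1) \<le> Suc (N x) * (E e2 (x, r) + M (x, r) + 1)"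
        using n(1) by (intro mult_le_mono) auto
      then show "hi (x, r) + ((E e1 (x, r) + 1 + poly q (L (x, r)) + 1) +
          (Suc n * (E e2 (x, r) + M (x, r) + 1) + (E e3 (x, r) + 1) + 1) + 1) + 1 \<le> H (x, r)"
        unfolding H_def fst_conv by linarith
    qed
  qed
qed

lemma pt_polytime: "pt f \<Longrightarrow> polytime enc enc f"
proof -
  assume "pt f"
  then obtain c h where "pt_by c h f" by (rule ptE)
  note f = pt_byD[OF this]
  define H where "H = (\<lambda>x. ecost (Cons v0 Nul) (enc x) + 1 + (h (x, Tip) + (ecost (Hd v0) (Bin (enc (f x)) Tip) + 1) + 1) + 1)"
  have "pbd H" unfolding H_def
    by (intro pbd_intros pbd_ecost pbd_comp[OF f(2)]; simp; intro pbd_intros f(1))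
  then obtain p where p: "\<And>x. H x \<le> poly p (esize x)" unfolding pbd_def by blast
  have "turns (Seq (Assign 0 (Cons v0 Nul)) (Seq c (Assign 0 (Hd v0)))) (enc x) (H x) (enc (f x))" for x
    unfolding H_def by (rule turns_Seq[OF turns_Assign turns_Seq[OF f(3) turns_Assign]]) simp_all
  then have "turns (Seq (Assign 0 (Cons v0 Nul)) (Seq c (Assign 0 (Hd v0)))) (enc x) (poly p (esize x)) (enc (f x))" for x
    using p by (rule turns_mono)
  then show ?thesis
    unfolding polytime_def runs_to_def init_store_def turns_def by (metis fun_upd_same)
qed

section \<open>A library of polynomial-time functions\<close>

named_theorems pt_intros

lemma pt_enc: "pt f \<Longrightarrow> pt (\<lambda>x. enc (f x))"
  unfolding pt_def pt_by_def by simp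

text \<open>Programs see encodings only, so a function on any type may be implemented by tree
  operations on the code of its argument.\<close>

lemma pt_encI: "pt (\<lambda>x. enc (f x)) \<Longrightarrow> pt f"
  unfolding pt_def pt_by_def by simp

fun cexp :: "bt \<Rightarrow> exp" where
  "cexp Tip = Nul"
| "cexp (Bin a b) = Cons (cexp a) (cexp b)"

lemma only0_cexp [simp]: "only0 (cexp d)"
  by (induction d) auto

lemma eval_cexp [simp]: "eval (cexp d) s = d"
  by (induction d) auto

lemma pt_const [pt_intros]: "pt (\<lambda>x. c)"
  by (rule pt_expression[of "Cons (cexp (enc c)) (Tl v0)"]) auto

lemma pt_id [pt_intros]: "pt (\<lambda>x. x)"
  by (rule pt_expression[of v0]) auto

lemma pt_fst [pt_intros]: "pt f \<Longrightarrow> pt (\<lambda>x. fst (f x))"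
  by (rule pt_comp[of fst], rule pt_expression[of "Cons (Hd (Hd v0)) (Tl v0)"]) auto

lemma pt_snd [pt_intros]: "pt f \<Longrightarrow> pt (\<lambda>x. snd (f x))"
  by (rule pt_comp[of snd], rule pt_expression[of "Cons (Tl (Hd v0)) (Tl v0)"]) auto

lemma pt_hd_bt: "pt f \<Longrightarrow> pt (\<lambda>x. hd_bt (f x))"
  by (rule pt_comp[of hd_bt], rule pt_expression[of "Cons (Hd (Hd v0)) (Tl v0)"]) auto

lemma pt_tl_bt: "pt f \<Longrightarrow> pt (\<lambda>x. tl_bt (f x))"
  by (rule pt_comp[of tl_bt], rule pt_expression[of "Cons (Tl (Hd v0)) (Tl v0)"]) auto

lemma pt_Bin: "pt f \<Longrightarrow> pt g \<Longrightarrow> pt (\<lambda>x. Bin (f x) (g x))"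
  using pt_enc[OF pt_Pair] by fastforce

declare pt_Pair [pt_intros]

lemma pt_eq [pt_intros]: "pt f \<Longrightarrow> pt g \<Longrightarrow> pt (\<lambda>x. f x = g x)"
proof -
  assume "pt f" "pt g"
  moreover have "pt (\<lambda>z :: 'b \<times> 'b. fst z = snd z)"
    by (rule pt_expression[of "Cons (Eq (Hd (Hd v0)) (Tl (Hd v0))) (Tl v0)"]) (auto simp: enc_bool_def)
  ultimately show ?thesis using pt_comp[OF _ pt_Pair] by fastforce
qed

lemmas pt_base = pt_enc pt_hd_bt pt_tl_bt pt_Bin

text \<open>A function of several arguments is shown computable once, on the projections of a tuple.
  These rules then insert arbitrary computed arguments, which lets \<open>pt_intros\<close> follow
  the syntax of a definition.\<close>

lemma pt_app2: "pt (\<lambda>z. F (fst z) (snd z)) \<Longrightarrow> pt a \<Longrightarrow> pt b \<Longrightarrow> pt (\<lambda>x. F (a x) (b x))"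
  using pt_comp[OF _ pt_Pair] by fastforce

lemma pt_app3: "pt (\<lambda>z. F (fst z) (fst (snd z)) (snd (snd z))) \<Longrightarrow> pt a \<Longrightarrow> pt b \<Longrightarrow> pt c \<Longrightarrow>
    pt (\<lambda>x. F (a x) (b x) (c x))"
  using pt_comp[OF _ pt_Pair[OF _ pt_Pair]] by fastforce

lemma pt_app4: "pt (\<lambda>z. F (fst z) (fst (snd z)) (fst (snd (snd z))) (snd (snd (snd z)))) \<Longrightarrow>
    pt a \<Longrightarrow> pt b \<Longrightarrow> pt c \<Longrightarrow> pt d \<Longrightarrow> pt (\<lambda>x. F (a x) (b x) (c x) (d x))"
  using pt_comp[OF _ pt_Pair[OF _ pt_Pair[OF _ pt_Pair]]] by fastforce

declare pt_If [pt_intros]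

lemma pt_not [pt_intros]: "pt b \<Longrightarrow> pt (\<lambda>x. \<not> b x)"
proof -
  assume "pt b"
  then have "pt (\<lambda>x. b x = False)" by (intro pt_intros)
  then show ?thesis by simp
qed

lemma pt_conj [pt_intros]: "pt b \<Longrightarrow> pt c \<Longrightarrow> pt (\<lambda>x. b x \<and> c x)"
proof -
  assume "pt b" "pt c"
  then have "pt (\<lambda>x. if b x then c x else False)" by (intro pt_intros)
  also have "(\<lambda>x. if b x then c x else False) = (\<lambda>x. b x \<and> c x)" by auto
  finally show ?thesis .
qed

subsection \<open>Lists\<close>

lemma pt_Cons [pt_intros]: "pt f \<Longrightarrow> pt g \<Longrightarrow> pt (\<lambda>x. f x # g x)"
  by (rule pt_encI) (simp add: pt_base)

lemma pt_hd [pt_intros]: "pt f \<Longrightarrow> pt (\<lambda>x. hd (f x))"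
proof (rule pt_encI)
  assume f: "pt f"
  \<comment> \<open>\<open>hd []\<close> is some fixed value; the program contains its code as a
    constant.\<close>
  have "enc (hd (f x)) = (if enc (f x) = Tip then enc (hd [] :: 'b) else hd_bt (enc (f x)))" for x
    by (cases "f x") auto
  then show "pt (\<lambda>x. enc (hd (f x)))" by (simp only:) (intro pt_intros pt_base f)
qed

lemma pt_tl [pt_intros]: "pt f \<Longrightarrow> pt (\<lambda>x. tl (f x))"
proof (rule pt_encI)
  assume f: "pt f"
  have "enc (tl (f x)) = tl_bt (enc (f x))" for x by (cases "f x") auto
  then show "pt (\<lambda>x. enc (tl (f x)))" by (simp only:) (intro pt_base f)
qed

lemma esize_append: "esize (xs @ ys) = esize xs + esize ys"
  by (induction xs) simp_all

lemma esize_in_list: "x \<in> set xs \<Longrightarrow> esize x < esize xs"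
  by (induction xs) auto

lemma length_le_esize: "length xs \<le> esize xs"
  by (induction xs) auto

lemma esize_nat [simp]: "esize (n :: nat) = n"
  by (induction n) auto

text \<open>The growth condition is additive: a step may add at most \<open>B x\<close>, a bound
  that depends on the input but not on the accumulator. Growth relative to the accumulator would
  compound over the list. Only accumulators of prefixes of the actual list matter.\<close>

lemma pt_foldl:
  fixes step :: "'a::encodable \<Rightarrow> 's::encodable \<Rightarrow> 'y::encodable \<Rightarrow> 's"
  assumes "pt (\<lambda>z. step (fst z) (fst (snd z)) (snd (snd z)))" "pt init" "pt xs" "pbd B"
    and add: "\<And>x ys y zs. xs x = ys @ y # zs \<Longrightarrow>
      esize (foldl (step x) (init x) (ys @ [y])) \<le> esize (foldl (step x) (init x) ys) + B x"
  shows "pt (\<lambda>x. foldl (step x) (init x) (xs x))"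
proof -
  define start where "start = (\<lambda>x. (xs x, (x, init x)))"
  define st where "st = (\<lambda>z :: 'y list \<times> 'a \<times> 's.
    (tl (fst z), (fst (snd z), step (fst (snd z)) (snd (snd z)) (hd (fst z)))))"
  define N where "N = (\<lambda>x. esize (xs x) + esize x + (esize (init x) + esize (xs x) * B x) + 2)"
  have iter: "(st ^^ i) (start x) = (drop i (xs x), (x, foldl (step x) (init x) (take i (xs x))))"
    if "i \<le> length (xs x)" for i x
    using that
  proof (induction i)
    case (Suc i)
    then show ?case
      by (simp add: st_def take_Suc_conv_app_nth hd_drop_conv_nth tl_drop drop_Suc)
  qed (simp add: start_def)
  have bnd: "esize (foldl (step x) (init x) (take i (xs x))) \<le> esize (init x) + i * B x"
    if "i \<le> length (xs x)" for i x
    using that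
  proof (induction i)
    case (Suc i)
    have "xs x = take i (xs x) @ (xs x ! i) # drop (Suc i) (xs x)"
      using Suc.prems by (simp add: id_take_nth_drop)
    then have "esize (foldl (step x) (init x) (take i (xs x) @ [xs x ! i])) \<le>
        esize (foldl (step x) (init x) (take i (xs x))) + B x" by (rule add)
    then show ?case using Suc by (simp add: take_Suc_conv_app_nth)
  qed simp
  have drp: "esize (drop i ys) \<le> esize ys" for i and ys :: "'y list"
    using esize_append[of "take i ys" "drop i ys"] by simp
  have "pt (\<lambda>x. (drop (length (xs x)) (xs x), (x, foldl (step x) (init x) (xs x))))"
  proof (rule pt_while)
    show "pt start" unfolding start_def by (intro pt_intros assms)
    have "pt (\<lambda>z :: 'y list \<times> 'a \<times> 's. (\<lambda>z. step (fst z) (fst (snd z)) (snd (snd z)))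
        (fst (snd z), snd (snd z), hd (fst z)))"
      by (rule pt_comp[OF assms(1)]) (intro pt_intros)
    then have s: "pt (\<lambda>z :: 'y list \<times> 'a \<times> 's. step (fst (snd z)) (snd (snd z)) (hd (fst z)))" by simp
    show "pt st" unfolding st_def by (intro pt_intros s)
    show "pt (\<lambda>z :: 'y list \<times> 'a \<times> 's. \<not> fst z = [])" by (intro pt_intros)
    show "pbd N" unfolding N_def
      by (intro pbd_intros pbd_pt[OF assms(2)] pbd_pt[OF assms(3)] assms(4))
    fix x
    show "\<exists>n\<le>N x. (\<forall>i\<le>n. esize ((st ^^ i) (start x)) \<le> N x) \<and>
      (\<forall>i<n. fst ((st ^^ i) (start x)) \<noteq> []) \<and> \<not> fst ((st ^^ n) (start x)) \<noteq> [] \<and>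
      (drop (length (xs x)) (xs x), (x, foldl (step x) (init x) (xs x))) = (st ^^ n) (start x)"
    proof (intro exI[of _ "length (xs x)"] conjI allI impI)
      show "length (xs x) \<le> N x" using length_le_esize[of "xs x"] by (simp add: N_def)
      show "esize ((st ^^ i) (start x)) \<le> N x" if "i \<le> length (xs x)" for i
      proof -
        have "i * B x \<le> esize (xs x) * B x"
          using that length_le_esize[of "xs x"] by (intro mult_le_mono) auto
        then show ?thesis
          using bnd[OF that] drp[of i "xs x"] unfolding iter[OF that] N_def enc_prod bt.size fst_conv snd_conv
          by linarith
      qed
    qed (use iter in auto)
  qed
  from pt_snd[OF pt_snd[OF this]] show ?thesis by simp
qed

lemma pt_rev [pt_intros]: "pt xs \<Longrightarrow> pt (\<lambda>x. rev (xs x))"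
proof -
  assume xs: "pt xs"
  have eq: "foldl (\<lambda>s y. y # s) zs ys = rev ys @ zs" for ys zs :: "'b list"
    by (induction ys arbitrary: zs) auto
  have "pt (\<lambda>x. foldl (\<lambda>s y. y # s) [] (xs x))"
  proof (rule pt_foldl[where B = "\<lambda>x. esize (xs x)"])
    fix x ys y zs assume "xs x = ys @ y # zs"
    then show "esize (foldl (\<lambda>s y. y # s) [] (ys @ [y])) \<le>
        esize (foldl (\<lambda>s y. y # s) [] ys) + esize (xs x)"
      by (simp add: esize_append)
  qed (intro pt_intros xs pbd_pt[OF xs] pbd_esize)+
  then show ?thesis by (simp add: eq)
qed

text \<open>Primitive recursion is a left fold over the reversed list. The fold also carries the
  part of the list already treated, because \<open>c\<close> may refer to the tail.\<close>

lemma pt_rec_list: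
  fixes h :: "'a::encodable \<Rightarrow> 'y::encodable list \<Rightarrow> 'v::encodable"
  assumes Nil: "\<And>x. h x [] = n x" and Cons: "\<And>x y ys. h x (y # ys) = c x y ys (h x ys)"
    and "pt n" "pt (\<lambda>z. c (fst z) (fst (snd z)) (fst (snd (snd z))) (snd (snd (snd z))))"
    and xs: "pt xs" and B: "pbd B"
    and add: "\<And>x zs y ys. xs x = zs @ y # ys \<Longrightarrow> esize (h x (y # ys)) \<le> esize (h x ys) + B x"
  shows "pt (\<lambda>x. h x (xs x))"
proof -
  define st where "st = (\<lambda>x (s :: 'y list \<times> 'v) y. (y # fst s, c x y (fst s) (snd s)))"
  have eq: "foldl (st x) ([], n x) (rev ys) = (ys, h x ys)" for x ys
    by (induction ys) (auto simp: st_def Nil Cons)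
  have "pt (\<lambda>x. foldl (st x) ([], n x) (rev (xs x)))"
  proof (rule pt_foldl[where B = "\<lambda>x. esize (xs x) + B x"])
    have "pt (\<lambda>z :: 'a \<times> ('y list \<times> 'v) \<times> 'y.
        (\<lambda>z. c (fst z) (fst (snd z)) (fst (snd (snd z))) (snd (snd (snd z))))
        (fst z, (snd (snd z), (fst (fst (snd z)), snd (fst (snd z))))))"
      by (rule pt_comp[OF assms(4)]) (intro pt_intros)
    then have "pt (\<lambda>z :: 'a \<times> ('y list \<times> 'v) \<times> 'y.
        c (fst z) (snd (snd z)) (fst (fst (snd z))) (snd (fst (snd z))))" by simp
    then show "pt (\<lambda>z :: 'a \<times> ('y list \<times> 'v) \<times> 'y. st (fst z) (fst (snd z)) (snd (snd z)))"
      unfolding st_def by (intro pt_intros)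
    show "pbd (\<lambda>x. esize (xs x) + B x)" by (intro pbd_intros pbd_pt[OF xs] B)
    fix x ys y zs assume *: "rev (xs x) = ys @ y # zs"
    then have xs: "xs x = rev zs @ y # rev ys" by (metis rev_append rev_rev_ident rev.simps(2) append.assoc append_Cons append_Nil)
    have "esize (h x (y # rev ys)) \<le> esize (h x (rev ys)) + B x" using xs by (rule add)
    moreover have "esize (y # rev ys) \<le> esize (rev ys) + esize (xs x)"
      unfolding xs esize_append by simp
    ultimately show "esize (foldl (st x) ([], n x) (ys @ [y])) \<le>
        esize (foldl (st x) ([], n x) ys) + (esize (xs x) + B x)"
      using eq[of x "rev ys"] eq[of x "y # rev ys"] by simp
  qed (intro pt_intros assms)+
  then have "pt (\<lambda>x. snd (foldl (st x) ([], n x) (rev (xs x))))" by (rule pt_snd)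
  then show ?thesis by (simp add: eq)
qed

lemma pt_append [pt_intros]:
  fixes f :: "'a::encodable \<Rightarrow> 'b::encodable list"
  assumes "pt f" "pt g"
  shows "pt (\<lambda>x. f x @ g x)"
  by (rule pt_rec_list[where h = "\<lambda>x ys. ys @ g x" and n = g and c = "\<lambda>x y ys v. y # v"
        and B = "\<lambda>x. Suc (esize (f x))"])
    (auto intro!: pt_intros assms pbd_intros pbd_pt[OF assms(1)] simp: esize_append)

text \<open>Packages an output bound as a monotone function of the sum of the argument sizes. In
  this form the size of a list element can be replaced by that of the list.\<close>

lemma pt_pbd2:
  assumes "pt (\<lambda>z. f (fst z) (snd z))"
  obtains P where "\<And>m n. m \<le> n \<Longrightarrow> P m \<le> P n" "\<And>h. pbd h \<Longrightarrow> pbd (\<lambda>x. P (h x))"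
    "\<And>x y. esize (f x y) \<le> P (esize x + esize y)"
proof -
  obtain p where p: "\<And>z. esize (f (fst z) (snd z)) \<le> poly p (esize z)"
    using pt_esize[OF assms] unfolding pbd_def by blast
  show ?thesis
  proof (rule that[of "\<lambda>n. poly p (Suc n)"])
    show "pbd (\<lambda>x. poly p (Suc (h x)))" if "pbd h" for h :: "'z::encodable \<Rightarrow> nat"
      by (intro pbd_poly pbd_Suc that)
    show "esize (f x y) \<le> poly p (Suc (esize x + esize y))" for x y using p[of "(x, y)"] by simp
  qed (auto intro: poly_nat_mono)
qed

lemma pt_map [pt_intros]:
  fixes f :: "'a::encodable \<Rightarrow> 'y::encodable \<Rightarrow> 'b::encodable"
  assumes xs: "pt xs" and f: "pt (\<lambda>z. f (fst z) (snd z))"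
  shows "pt (\<lambda>x. map (f x) (xs x))"
proof -
  obtain P where P: "\<And>m n. m \<le> n \<Longrightarrow> P m \<le> P n"
    "\<And>h :: 'a \<Rightarrow> nat. pbd h \<Longrightarrow> pbd (\<lambda>x. P (h x))" "\<And>x y. esize (f x y) \<le> P (esize x + esize y)"
    using pt_pbd2[OF f] by metis
  show ?thesis
  proof (rule pt_rec_list[where h = "\<lambda>x. map (f x)" and n = "\<lambda>x. []" and c = "\<lambda>x y ys v. f x y # v"
        and B = "\<lambda>x. Suc (P (esize x + esize (xs x)))"])
    have "pt (\<lambda>z :: 'a \<times> 'y \<times> 'y list \<times> 'b list. (\<lambda>z. f (fst z) (snd z)) (fst z, fst (snd z)))"
      by (rule pt_comp[OF f]) (intro pt_intros)
    then show "pt (\<lambda>z :: 'a \<times> 'y \<times> 'y list \<times> 'b list. f (fst z) (fst (snd z)) # snd (snd (snd z)))"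
      by (intro pt_intros) simp
    show "pbd (\<lambda>x. Suc (P (esize x + esize (xs x))))"
      by (intro pbd_intros P(2) pbd_pt[OF xs])
    fix x zs y ys assume "xs x = zs @ y # ys"
    then have "esize (f x y) \<le> P (esize x + esize (xs x))"
      using esize_in_list[of y "xs x"] by (intro order_trans[OF P(3)] P(1)) simp
    then show "esize (map (f x) (y # ys)) \<le> esize (map (f x) ys) + Suc (P (esize x + esize (xs x)))"
      by simp
  qed (simp_all add: pt_const xs)
qed

lemma pt_filter [pt_intros]:
  fixes f :: "'a::encodable \<Rightarrow> 'y::encodable \<Rightarrow> bool"
  assumes xs: "pt xs" and f: "pt (\<lambda>z. f (fst z) (snd z))"
  shows "pt (\<lambda>x. filter (f x) (xs x))"
proof (rule pt_rec_list[where h = "\<lambda>x. filter (f x)" and n = "\<lambda>x. []"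
        and c = "\<lambda>x y ys v. if f x y then y # v else v" and B = "\<lambda>x. esize (xs x)"])
  have "pt (\<lambda>z :: 'a \<times> 'y \<times> 'y list \<times> 'y list. (\<lambda>z. f (fst z) (snd z)) (fst z, fst (snd z)))"
    by (rule pt_comp[OF f]) (intro pt_intros)
  then show "pt (\<lambda>z :: 'a \<times> 'y \<times> 'y list \<times> 'y list.
      if f (fst z) (fst (snd z)) then fst (snd z) # snd (snd (snd z)) else snd (snd (snd z)))"
    by (intro pt_intros) simp
  show "pbd (\<lambda>x. esize (xs x))" by (intro pbd_intros pbd_pt[OF xs])
  fix x zs y ys assume "xs x = zs @ y # ys"
  then have "esize y < esize (xs x)" by (intro esize_in_list) simp
  then show "esize (filter (f x) (y # ys)) \<le> esize (filter (f x) ys) + esize (xs x)" by simp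
qed (simp_all add: pt_const xs)

lemma pt_concat [pt_intros]:
  fixes f :: "'a::encodable \<Rightarrow> 'b::encodable list list"
  assumes f: "pt f"
  shows "pt (\<lambda>x. concat (f x))"
proof (rule pt_rec_list[where h = "\<lambda>x. concat" and n = "\<lambda>x. []" and c = "\<lambda>x y ys v. y @ v"
        and B = "\<lambda>x. esize (f x)"])
  show "pt (\<lambda>z :: 'a \<times> 'b list \<times> 'b list list \<times> 'b list. fst (snd z) @ snd (snd (snd z)))"
    by (intro pt_intros)
  show "pbd (\<lambda>x. esize (f x))" by (intro pbd_intros pbd_pt[OF f])
  fix x zs y ys assume "f x = zs @ y # ys"
  then have "esize y < esize (f x)" by (intro esize_in_list) simp
  then show "esize (concat (y # ys)) \<le> esize (concat ys) + esize (f x)"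
    by (simp add: esize_append)
qed (simp_all add: pt_const f)

lemma pt_Suc [pt_intros]: "pt f \<Longrightarrow> pt (\<lambda>x. Suc (f x))"
  by (rule pt_encI) (simp add: pt_base pt_const)

lemma pt_length [pt_intros]:
  fixes f :: "'a::encodable \<Rightarrow> 'b::encodable list"
  assumes f: "pt f"
  shows "pt (\<lambda>x. length (f x))"
proof (rule pt_rec_list[where h = "\<lambda>x. length" and n = "\<lambda>x. 0" and c = "\<lambda>x y ys v. Suc v"
        and B = "\<lambda>x. 1"])
  show "pt (\<lambda>z :: 'a \<times> 'b \<times> 'b list \<times> nat. Suc (snd (snd (snd z))))"
    by (intro pt_intros)
qed (simp_all add: pt_const pbd_const f)

lemma pt_member [pt_intros]:
  fixes f :: "'a::encodable \<Rightarrow> 'b::encodable"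
  assumes "pt f" "pt g"
  shows "pt (\<lambda>x. f x \<in> set (g x))"
proof -
  have "pt (\<lambda>x. \<not> filter (\<lambda>y. y = f x) (g x) = [])"
    by (intro pt_intros assms pt_comp[OF assms(1)])
  then show ?thesis by (simp add: filter_empty_conv cong: conj_cong)
qed

lemma pt_Ball [pt_intros]:
  fixes f :: "'a::encodable \<Rightarrow> 'b::encodable \<Rightarrow> bool"
  assumes "pt xs" "pt (\<lambda>z. f (fst z) (snd z))"
  shows "pt (\<lambda>x. \<forall>y \<in> set (xs x). f x y)"
proof -
  have "pt (\<lambda>x. filter (\<lambda>y. \<not> f x y) (xs x) = [])"
    by (intro pt_intros assms)
  then show ?thesis by (simp add: filter_empty_conv)
qed

lemma pt_subset [pt_intros]:
  fixes f :: "'a::encodable \<Rightarrow> 'b::encodable list"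
  assumes "pt f" "pt g"
  shows "pt (\<lambda>x. set (f x) \<subseteq> set (g x))"
  unfolding subset_iff Ball_def[symmetric]
  by (intro pt_intros assms pt_comp[OF assms(2)])

lemma pt_enumerate [pt_intros]:
  fixes f :: "'a::encodable \<Rightarrow> 'b::encodable list"
  assumes f: "pt f"
  shows "pt (\<lambda>x. List.enumerate 0 (f x))"
proof -
  define st where "st = (\<lambda>s (y :: 'b). s @ [(length s, y)])"
  have eq: "foldl st [] ys = List.enumerate 0 ys" for ys
    by (induction ys rule: rev_induct) (auto simp: st_def enumerate_append_eq)
  have "pt (\<lambda>x. foldl st [] (f x))"
  proof (rule pt_foldl[where B = "\<lambda>x. 2 * esize (f x) + 2"])
    show "pt (\<lambda>z :: 'a \<times> (nat \<times> 'b) list \<times> 'b. st (fst (snd z)) (snd (snd z)))"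
      unfolding st_def by (intro pt_intros)
    fix x ys y zs assume *: "f x = ys @ y # zs"
    \<comment> \<open>Indices are written in unary, but none exceeds the length of the list and
      hence its encoded size.\<close>
    have "length ys \<le> esize (f x)" using length_le_esize[of "f x"] * by simp
    moreover have "esize y < esize (f x)" using * by (intro esize_in_list) simp
    ultimately show "esize (foldl st [] (ys @ [y])) \<le> esize (foldl st [] ys) + (2 * esize (f x) + 2)"
      unfolding eq by (simp add: enumerate_append_eq esize_append)
  qed (intro pt_intros f pbd_intros pbd_pt[OF f])+
  then show ?thesis by (simp add: eq)
qed

subsection \<open>Formulas\<close>

lemma pt_Lit [pt_intros]: "pt f \<Longrightarrow> pt (\<lambda>x. Lit (f x))"
  by (rule pt_encI) (simp add: pt_base pt_const)

lemma pt_Dec [pt_intros]: "pt f \<Longrightarrow> pt g \<Longrightarrow> pt h \<Longrightarrow> pt (\<lambda>x. Dec (f x) (g x) (h x))"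
  by (rule pt_encI) (simp add: pt_base pt_const)

lemma pt_Or [pt_intros]: "pt f \<Longrightarrow> pt g \<Longrightarrow> pt (\<lambda>x. Or (f x) (g x))"
  by (rule pt_encI) (simp add: pt_base pt_const)

lemma pt_compl [pt_intros]: "pt f \<Longrightarrow> pt (\<lambda>x. compl (f x))"
proof (rule pt_encI)
  assume f: "pt f"
  have "enc (compl (f x)) = Bin (if hd_bt (enc (f x)) = Tip then true_bt else Tip) (tl_bt (enc (f x)))" for x
    by (cases "f x") (auto simp: true_bt_def)
  then show "pt (\<lambda>x. enc (compl (f x)))" by (simp only:) (intro pt_intros pt_base f)
qed

text \<open>Total selectors: a literal is its own left and right part, and a disjunction has literal \<open>Pos 0\<close>.\<close>

fun form_left :: "form \<Rightarrow> form" where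
  "form_left (Lit p) = Lit p"
| "form_left (Dec A p B) = A"
| "form_left (Or A B) = A"

fun form_right :: "form \<Rightarrow> form" where
  "form_right (Lit p) = Lit p"
| "form_right (Dec A p B) = B"
| "form_right (Or A B) = B"

fun form_lit :: "form \<Rightarrow> lit" where
  "form_lit (Lit p) = p"
| "form_lit (Dec A p B) = p"
| "form_lit (Or A B) = Pos 0"

fun form_is_Lit :: "form \<Rightarrow> bool" where
  "form_is_Lit (Lit p) = True"
| "form_is_Lit (Dec A p B) = False"
| "form_is_Lit (Or A B) = False"

fun form_is_Dec :: "form \<Rightarrow> bool" where
  "form_is_Dec (Lit p) = False"
| "form_is_Dec (Dec A p B) = True"
| "form_is_Dec (Or A B) = False"

lemma pt_form_is_Lit [pt_intros]: "pt f \<Longrightarrow> pt (\<lambda>x. form_is_Lit (f x))"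
proof -
  assume f: "pt f"
  have eq: "form_is_Lit A \<longleftrightarrow> hd_bt (enc A) = Tip" for A by (cases A) (auto simp: true_bt_def)
  show ?thesis unfolding eq by (intro pt_intros pt_base f)
qed

lemma pt_form_is_Dec [pt_intros]: "pt f \<Longrightarrow> pt (\<lambda>x. form_is_Dec (f x))"
proof -
  assume f: "pt f"
  have eq: "form_is_Dec A \<longleftrightarrow> hd_bt (enc A) = true_bt" for A by (cases A) (auto simp: true_bt_def)
  show ?thesis unfolding eq by (intro pt_intros pt_base f)
qed

lemma pt_form_left [pt_intros]: "pt f \<Longrightarrow> pt (\<lambda>x. form_left (f x))"
proof (rule pt_encI)
  assume f: "pt f"
  have eq: "enc (form_left A) = (if form_is_Lit A then enc A else hd_bt (tl_bt (enc A)))" for A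
    by (cases A) auto
  show "pt (\<lambda>x. enc (form_left (f x)))" unfolding eq by (intro pt_intros pt_base f)
qed

lemma pt_form_right [pt_intros]: "pt f \<Longrightarrow> pt (\<lambda>x. form_right (f x))"
proof (rule pt_encI)
  assume f: "pt f"
  have eq: "enc (form_right A) = (if form_is_Lit A then enc A else if form_is_Dec A
      then tl_bt (tl_bt (tl_bt (enc A))) else tl_bt (tl_bt (enc A)))" for A
    by (cases A) auto
  show "pt (\<lambda>x. enc (form_right (f x)))" unfolding eq by (intro pt_intros pt_base f)
qed

lemma pt_form_lit [pt_intros]: "pt f \<Longrightarrow> pt (\<lambda>x. form_lit (f x))"
proof (rule pt_encI)
  assume f: "pt f"
  have eq: "enc (form_lit A) = (if form_is_Lit A then tl_bt (enc A) else if form_is_Dec A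
      then hd_bt (tl_bt (tl_bt (enc A))) else enc (Pos 0))" for A
    by (cases A) auto
  show "pt (\<lambda>x. enc (form_lit (f x)))" unfolding eq by (intro pt_intros pt_base f)
qed

section \<open>Recursion on formulas by a machine with an explicit stack\<close>

definition run_within :: "('s::encodable \<Rightarrow> 's) \<Rightarrow> ('s \<Rightarrow> bool) \<Rightarrow> nat \<Rightarrow> nat \<Rightarrow> 's \<Rightarrow> 's \<Rightarrow> bool" where
  "run_within step test b n s s' \<longleftrightarrow> (step ^^ n) s = s' \<and>
     (\<forall>i \<le> n. esize ((step ^^ i) s) \<le> b) \<and> (\<forall>i < n. test ((step ^^ i) s))"

lemma run_within_trans:
  assumes "run_within step test b n s s'" "run_within step test b m s' s''"
  shows "run_within step test b (n + m) s s''"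
proof -
  have *: "(step ^^ i) s = (step ^^ (i - n)) s'" if "n \<le> i" for i
    using assms(1) funpow_add[of "i - n" n step] that by (simp add: run_within_def)
  show ?thesis
    unfolding run_within_def
  proof (intro conjI allI impI)
    show "(step ^^ (n + m)) s = s''" using * assms(2) by (simp add: run_within_def)
    show "esize ((step ^^ i) s) \<le> b" if "i \<le> n + m" for i
      using assms * that by (cases "n \<le> i") (auto simp: run_within_def)
    show "test ((step ^^ i) s)" if "i < n + m" for i
      using assms * that by (cases "n \<le> i") (auto simp: run_within_def)
  qed
qed

lemma run_within_1:
  "test s \<Longrightarrow> esize s \<le> b \<Longrightarrow> esize (step s) \<le> b \<Longrightarrow> run_within step test b 1 s (step s)"
  by (auto simp: run_within_def le_Suc_eq)

text \<open>
  Recursion on formulas is run on a stack machine: the pair \<open>(False, Z)\<close> asks for the value of \<open>Z\<close>,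
  the pair \<open>(True, Z)\<close> combines the values of the two immediate subformulas of \<open>Z\<close>.
\<close>

lemma pt_rec_form:
  fixes h :: "form \<Rightarrow> 'v::encodable"
  assumes h_Lit: "\<And>p. h (Lit p) = l p"
    and h_Dec: "\<And>A p B. h (Dec A p B) = c (Dec A p B) (h A) (h B)"
    and h_Or: "\<And>A B. h (Or A B) = c (Or A B) (h A) (h B)"
    and l: "pt l" and c: "pt (\<lambda>z. c (fst z) (fst (snd z)) (snd (snd z)))" and K: "pbd K"
    and add_Dec: "\<And>A p B. esize (h (Dec A p B)) \<le> esize (h A) + esize (h B) + K (Dec A p B)"
    and add_Or: "\<And>A B. esize (h (Or A B)) \<le> esize (h A) + esize (h B) + K (Or A B)"
    and f: "pt f"
  shows "pt (\<lambda>x. h (f x))"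
proof (rule pt_comp[OF _ f])
  obtain p1 where p1: "\<And>p. esize (l p) \<le> poly p1 (esize p)"
    using pt_esize[OF l] unfolding pbd_def by blast
  obtain p2 where p2: "\<And>Z. K Z \<le> poly p2 (esize Z)" using K unfolding pbd_def by blast
  \<comment> \<open>\<open>Q\<close> bounds both the value of a literal and the overhead
    \<open>K\<close> of a node. Subformulas occupy disjoint parts of the encoding, so a charge of
    \<open>Q (esize Z)\<close> per unit of size pays for the value of \<open>Z\<close>.\<close>
  define Q where "Q = (\<lambda>n. poly (p1 + p2) n)"
  have Q_mono: "m \<le> n \<Longrightarrow> Q m \<le> Q n" for m n unfolding Q_def by (rule poly_nat_mono)
  have bin_size: "esize (h Z) \<le> esize Z * Q (esize Z)"
    if "esize (h A) \<le> esize A * Q (esize A)" "esize (h B) \<le> esize B * Q (esize B)"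
      and Z: "esize A + esize B + 1 \<le> esize Z" "esize (h Z) \<le> esize (h A) + esize (h B) + K Z" for A B Z
  proof -
    have "esize (h A) \<le> esize A * Q (esize Z)"
      by (rule order_trans[OF that(1)]) (intro mult_le_mono Q_mono, use Z(1) in simp_all)
    moreover have "esize (h B) \<le> esize B * Q (esize Z)"
      by (rule order_trans[OF that(2)]) (intro mult_le_mono Q_mono, use Z(1) in simp_all)
    moreover have "K Z \<le> Q (esize Z)" using p2[of Z] by (simp add: Q_def)
    ultimately have "esize (h Z) \<le> (esize A + esize B + 1) * Q (esize Z)"
      using Z(2) unfolding add_mult_distrib by linarith
    also have "\<dots> \<le> esize Z * Q (esize Z)" using Z(1) by (intro mult_le_mono) auto
    finally show ?thesis .
  qed
  have h_size: "esize (h Z) \<le> esize Z * Q (esize Z)" for Z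
  proof (induction Z)
    case (Lit p)
    have "esize (l p) \<le> poly p1 (esize p)" by (rule p1)
    also have "\<dots> \<le> poly p1 (esize (Lit p))" by (rule poly_nat_mono) simp
    also have "\<dots> \<le> Q (esize (Lit p))" by (simp add: Q_def)
    finally show ?case by (simp add: h_Lit)
  next
    case (Dec A p B)
    show ?case by (rule bin_size[OF Dec.IH _ add_Dec]) simp
  next
    case (Or A B)
    show ?case by (rule bin_size[OF Or.IH _ add_Or]) simp
  qed
  define test where "test = (\<lambda>s :: (bool \<times> form) list \<times> 'v list. \<not> fst s = [])"
  \<comment> \<open>The left subformula is evaluated first, so its value lies below that of the
    right one.\<close>
  define step where "step = (\<lambda>s :: (bool \<times> form) list \<times> 'v list.
    if fst (hd (fst s)) then (tl (fst s), c (snd (hd (fst s))) (hd (tl (snd s))) (hd (snd s)) # tl (tl (snd s)))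
    else if form_is_Lit (snd (hd (fst s))) then (tl (fst s), l (form_lit (snd (hd (fst s)))) # snd s)
    else ((False, form_left (snd (hd (fst s)))) # (False, form_right (snd (hd (fst s)))) #
      (True, snd (hd (fst s))) # tl (fst s), snd s))"
  \<comment> \<open>One share \<open>R N\<close> covers two formulas of size at most
    \<open>N\<close>, two of their values, and list cells. A formula \<open>Z\<close> may use
    \<open>esize Z\<close> shares; its immediate subformulas leave at least two of them, which pay
    for what \<open>Z\<close> itself puts on the stacks.\<close>
  define R where "R = (\<lambda>n. 2 * (n * Q n) + 2 * n + 10)"
  have R_mono: "m \<le> n \<Longrightarrow> R m \<le> R n" for m n
    unfolding R_def by (intro add_mono mult_le_mono Q_mono) auto
  have bin: "\<exists>n \<le> 2 * esize Z. run_within step test b n ((False, Z) # w, vs) (w, h Z # vs)"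
    if IHA: "\<And>w vs. esize w + esize vs + esize A * R N + 10 \<le> b \<Longrightarrow>
        \<exists>n \<le> 2 * esize A. run_within step test b n ((False, A) # w, vs) (w, h A # vs)"
      and IHB: "\<And>w vs. esize w + esize vs + esize B * R N + 10 \<le> b \<Longrightarrow>
        \<exists>n \<le> 2 * esize B. run_within step test b n ((False, B) # w, vs) (w, h B # vs)"
      and Z: "form_left Z = A" "form_right Z = B" "\<not> form_is_Lit Z" "h Z = c Z (h A) (h B)"
        "esize A + esize B + 2 \<le> esize Z" "esize Z \<le> N"
      and b: "esize w + esize vs + esize Z * R N + 10 \<le> b"
    for A B Z N w vs b
  proof -
    have hX: "2 * esize (h X) + 2 * esize X + 10 \<le> R N" if "esize X \<le> N" for X
      using h_size[of X] R_mono[OF that] by (simp add: R_def)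
    have "(esize A + esize B + 2) * R N \<le> esize Z * R N" using Z(5) by (intro mult_le_mono) auto
    then have bR: "esize w + esize vs + esize A * R N + esize B * R N + R N + R N + 10 \<le> b"
      using b by (simp add: algebra_simps)
    define w1 where "w1 = (True, Z) # w"
    define w2 where "w2 = (False, B) # w1"
    have bl: "size (enc_bool y) \<le> 1" for y by (simp add: enc_bool_def true_bt_def)
    have w1: "esize w1 \<le> esize w + esize Z + 3"
      using bl[of True] by (simp add: w1_def)
    have w2: "esize w2 \<le> esize w + esize Z + esize B + 6"
      using bl[of False] w1 by (simp add: w2_def)
    have A: "2 * esize (h A) + 2 * esize A + 10 \<le> R N" and B: "2 * esize (h B) + 2 * esize B + 10 \<le> R N"
      and ZR: "2 * esize (h Z) + 2 * esize Z + 10 \<le> R N"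
      using hX[of A] hX[of B] hX[of Z] Z(5,6) by simp_all
    have 1: "run_within step test b 1 ((False, Z) # w, vs) ((False, A) # w2, vs)"
    proof -
      have s: "step ((False, Z) # w, vs) = ((False, A) # w2, vs)"
        using Z by (simp add: step_def w1_def w2_def)
      have "esize ((False, Z) # w, vs) \<le> b" "esize ((False, A) # w2, vs) \<le> b"
        using bl[of False] w2 bR ZR A Z(5) by simp_all
      then show ?thesis using run_within_1[of test "((False, Z) # w, vs)" b step] s
        by (simp add: test_def)
    qed
    obtain n2 where n2: "n2 \<le> 2 * esize A"
      "run_within step test b n2 ((False, A) # w2, vs) (w2, h A # vs)"
      using IHA[of w2 vs] w2 bR ZR Z(5) by auto
    obtain n3 where n3: "n3 \<le> 2 * esize B"
      "run_within step test b n3 ((False, B) # w1, h A # vs) (w1, h B # h A # vs)"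
      using IHB[of w1 "h A # vs"] w1 bR ZR A Z(5) by auto
    have 4: "run_within step test b 1 (w1, h B # h A # vs) (w, h Z # vs)"
    proof -
      have s: "step (w1, h B # h A # vs) = (w, h Z # vs)"
        using Z by (simp add: step_def w1_def)
      have "esize (w1, h B # h A # vs) \<le> b" "esize (w, h Z # vs) \<le> b"
        using w1 bR ZR A B Z(5) by simp_all
      then show ?thesis using run_within_1[of test "(w1, h B # h A # vs)" b step] s
        by (simp add: test_def w1_def)
    qed
    have "run_within step test b (1 + n2 + n3 + 1) ((False, Z) # w, vs) (w, h Z # vs)"
      using run_within_trans[OF run_within_trans[OF run_within_trans[OF 1 n2(2)]] 4] n3(2)
      unfolding w2_def by blast
    then show ?thesis using n2(1) n3(1) Z(5) by (intro exI[of _ "1 + n2 + n3 + 1"]) simp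
  qed
  have run: "\<exists>n \<le> 2 * esize Z. run_within step test b n ((False, Z) # w, vs) (w, h Z # vs)"
    if "esize Z \<le> N" "esize w + esize vs + esize Z * R N + 10 \<le> b" for Z N w vs b
    using that
  proof (induction Z arbitrary: w vs)
    case (Lit p)
    have s: "step ((False, Lit p) # w, vs) = (w, h (Lit p) # vs)" by (simp add: step_def h_Lit)
    have "2 * esize (h (Lit p)) + 2 * esize (Lit p) + 10 \<le> R N"
      using h_size[of "Lit p"] R_mono[OF Lit.prems(1)] unfolding R_def by linarith
    then have "2 * esize (h (Lit p)) + 2 * esize (Lit p) + 10 \<le> esize (Lit p) * R N"
      by (rule order_trans) simp
    then have "esize ((False, Lit p) # w, vs) \<le> b" "esize (w, h (Lit p) # vs) \<le> b"
      using Lit.prems(2) by (simp_all add: enc_bool_def)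
    then have "run_within step test b 1 ((False, Lit p) # w, vs) (w, h (Lit p) # vs)"
      using run_within_1[of test "((False, Lit p) # w, vs)" b step] s by (simp add: test_def)
    then show ?case by (intro exI[of _ 1]) simp
  next
    case (Dec A p B)
    show ?case
      by (rule bin[of A N b B "Dec A p B"]) (use Dec in \<open>auto simp: h_Dec true_bt_def\<close>)
  next
    case (Or A B)
    show ?case
      by (rule bin[of A N b B "Or A B"]) (use Or in \<open>auto simp: h_Or true_bt_def\<close>)
  qed
  have "pt (\<lambda>Z. ([] :: (bool \<times> form) list, [h Z]))"
  proof (rule pt_while)
    show "pt (\<lambda>Z. ([(False, Z :: form)], [] :: 'v list))" by (intro pt_intros)
    have "pt (\<lambda>s :: (bool \<times> form) list \<times> 'v list. (\<lambda>z. c (fst z) (fst (snd z)) (snd (snd z)))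
        (snd (hd (fst s)), hd (tl (snd s)), hd (snd s)))"
      by (rule pt_comp[OF c]) (intro pt_intros)
    then show "pt step" unfolding step_def by (intro pt_intros pt_comp[OF l]) simp_all
    show "pt test" unfolding test_def by (intro pt_intros)
    show "pbd (\<lambda>Z. 2 * esize Z + (esize (Z :: form) * R (esize Z) + 10))"
      unfolding R_def Q_def by (intro pbd_intros pbd_poly)
    fix Z :: form
    let ?N = "2 * esize Z + (esize Z * R (esize Z) + 10)"
    obtain n where n: "n \<le> 2 * esize Z"
      "run_within step test (esize Z * R (esize Z) + 10) n ([(False, Z)], []) ([], [h Z])"
      using run[of Z "esize Z" "[]" "[]" "esize Z * R (esize Z) + 10"] by auto
    then show "\<exists>n \<le> ?N. (\<forall>i\<le>n. esize ((step ^^ i) ([(False, Z)], [])) \<le> ?N) \<and>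
        (\<forall>i<n. test ((step ^^ i) ([(False, Z)], []))) \<and> \<not> test ((step ^^ n) ([(False, Z)], [])) \<and>
        ([], [h Z]) = (step ^^ n) ([(False, Z)], [])"
      by (intro exI[of _ n]) (auto simp: run_within_def test_def intro: trans_le_add2)
  qed
  then have "pt (\<lambda>Z. hd (snd ([] :: (bool \<times> form) list, [h Z])))" by (intro pt_hd pt_snd)
  then show "pt h" by simp
qed

section \<open>Weakening and contraction\<close>

type_synonym lseq = "form list \<times> form list"

definition ms :: "lseq \<Rightarrow> sequent" where
  "ms S = (mset (fst S), mset (snd S))"

lemma line_seq_eq: "line_seq l = ms (fst l)"
  by (simp add: line_seq_def ms_def)

text \<open>The nonempty suffixes, longest first, are the stages of a process that consumes a list
  element by element. Mapping over them writes down a sequence of inferences without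
  recursion.\<close>

fun sufs :: "'a list \<Rightarrow> 'a list list" where
  "sufs [] = []"
| "sufs (x # xs) = (x # xs) # sufs xs"

lemma pt_sufs [pt_intros]:
  fixes f :: "'a::encodable \<Rightarrow> 'b::encodable list"
  assumes "pt f"
  shows "pt (\<lambda>x. sufs (f x))"
proof (rule pt_rec_list[where h = "\<lambda>x. sufs" and n = "\<lambda>x. []" and c = "\<lambda>x y ys v. (y # ys) # v"
        and B = "\<lambda>x. Suc (esize (f x))"])
  show "pt (\<lambda>z :: 'a \<times> 'b \<times> 'b list \<times> 'b list list.
      (fst (snd z) # fst (snd (snd z))) # snd (snd (snd z)))"
    by (intro pt_intros)
  show "pbd (\<lambda>x. Suc (esize (f x)))" by (intro pbd_intros pbd_pt[OF assms])
  show "esize (sufs (y # ys)) \<le> esize (sufs ys) + Suc (esize (f x))" if "f x = zs @ y # ys" for x zs y ys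
    using that by (simp add: esize_append)
qed (simp_all add: pt_const assms)

text \<open>An inference instance consists of its conclusion and the list of its premises.\<close>

type_synonym inst = "lseq \<times> lseq list"

definition valid_inst :: "inst \<Rightarrow> bool" where
  "valid_inst i \<longleftrightarrow> ldt_inf (map ms (snd i)) (ms (fst i))"

text \<open>The formulas of \<open>T\<close> are added by weakening in front of those of
  \<open>S\<close>, and then each formula of \<open>S\<close> is contracted with its copy in
  \<open>T\<close>. Hence inclusion of sets suffices, whatever the multiplicities and the
  order.\<close>

definition wk :: "lseq \<Rightarrow> lseq \<Rightarrow> inst list" where
  "wk S T =
     map (\<lambda>s. ((s @ fst S, snd S), [(tl s @ fst S, snd S)])) (rev (sufs (fst T))) @
     map (\<lambda>s. ((fst T @ fst S, s @ snd S), [(fst T @ fst S, tl s @ snd S)])) (rev (sufs (snd T))) @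
     map (\<lambda>s. ((fst T @ tl s, snd T @ snd S), [(fst T @ s, snd T @ snd S)])) (sufs (fst S)) @
     map (\<lambda>s. ((fst T, snd T @ tl s), [(fst T, snd T @ s)])) (sufs (snd S))"

definition subseq :: "lseq \<Rightarrow> lseq \<Rightarrow> bool" where
  "subseq S T \<longleftrightarrow> set (fst S) \<subseteq> set (fst T) \<and> set (snd S) \<subseteq> set (snd T)"

lemma subseq_simp [simp]: "subseq (G, D) (G', D') \<longleftrightarrow> set G \<subseteq> set G' \<and> set D \<subseteq> set D'"
  by (simp add: subseq_def)

fun chain :: "lseq \<Rightarrow> inst list \<Rightarrow> lseq \<Rightarrow> bool" where
  "chain S [] T \<longleftrightarrow> S = T"
| "chain S (i # is) T \<longleftrightarrow> snd i = [S] \<and> valid_inst i \<and> chain (fst i) is T"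

lemma chain_append: "chain S is T \<Longrightarrow> chain T js U \<Longrightarrow> chain S (is @ js) U"
  by (induction "is" arbitrary: S) auto

lemma chain_grow:
  assumes "\<And>x s. valid_inst (g (x # s), [g s])"
  shows "chain (g []) (map (\<lambda>s. (g s, [g (tl s)])) (rev (sufs xs))) (g xs)"
proof (induction xs)
  case (Cons x xs)
  then show ?case using assms by (auto intro: chain_append)
qed simp

lemma chain_shrink:
  assumes "\<And>x s. x \<in> set xs \<Longrightarrow> valid_inst (g s, [g (x # s)])"
  shows "chain (g xs) (map (\<lambda>s. (g (tl s), [g s])) (sufs xs)) (g [])"
  using assms by (induction xs) auto

lemma valid_weak_l: "valid_inst ((x # G, D), [(G, D)])"
  by (simp add: valid_inst_def ms_def weak_l)

lemma valid_weak_r: "valid_inst ((G, x # D), [(G, D)])"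
  by (simp add: valid_inst_def ms_def weak_r)

lemma valid_contr_l:
  assumes "x \<in> set G" shows "valid_inst ((G @ s, D), [(G @ x # s, D)])"
proof -
  obtain M where "mset G = add_mset x M" using assms by (metis in_multiset_in_set multi_member_split)
  then show ?thesis using contr_l[of x "M + mset s" "mset D"] by (simp add: valid_inst_def ms_def)
qed

lemma valid_contr_r:
  assumes "x \<in> set D" shows "valid_inst ((G, D @ s), [(G, D @ x # s)])"
proof -
  obtain M where "mset D = add_mset x M" using assms by (metis in_multiset_in_set multi_member_split)
  then show ?thesis using contr_r[of "mset G" x "M + mset s"] by (simp add: valid_inst_def ms_def)
qed

lemma chain_wk:
  assumes "subseq S T"
  shows "chain S (wk S T) T"
proof -
  have 1: "chain S (map (\<lambda>s. ((s @ fst S, snd S), [(tl s @ fst S, snd S)])) (rev (sufs (fst T))))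
      (fst T @ fst S, snd S)"
    using chain_grow[of "\<lambda>s. (s @ fst S, snd S)" "fst T"] by (simp add: valid_weak_l)
  have 2: "chain (fst T @ fst S, snd S)
      (map (\<lambda>s. ((fst T @ fst S, s @ snd S), [(fst T @ fst S, tl s @ snd S)])) (rev (sufs (snd T))))
      (fst T @ fst S, snd T @ snd S)"
    using chain_grow[of "\<lambda>s. (fst T @ fst S, s @ snd S)" "snd T"] by (simp add: valid_weak_r)
  have 3: "chain (fst T @ fst S, snd T @ snd S)
      (map (\<lambda>s. ((fst T @ tl s, snd T @ snd S), [(fst T @ s, snd T @ snd S)])) (sufs (fst S)))
      (fst T, snd T @ snd S)"
    using chain_shrink[of "fst S" "\<lambda>s. (fst T @ s, snd T @ snd S)"] assms
    by (simp add: valid_contr_l subseq_def subset_iff)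
  have 4: "chain (fst T, snd T @ snd S)
      (map (\<lambda>s. ((fst T, snd T @ tl s), [(fst T, snd T @ s)])) (sufs (snd S))) T"
    using chain_shrink[of "snd S" "\<lambda>s. (fst T, snd T @ s)"] assms
    by (simp add: valid_contr_r subseq_def subset_iff)
  show ?thesis unfolding wk_def using chain_append[OF 1 chain_append[OF 2 chain_append[OF 3 4]]] .
qed

lemma pt_wk [pt_intros]: "pt f \<Longrightarrow> pt g \<Longrightarrow> pt (\<lambda>x. wk (f x) (g x))"
  by (rule pt_app2[of wk]) (unfold wk_def, intro pt_intros)

section \<open>Tree-like proofs in postfix notation\<close>

text \<open>
  An entry \<open>(S, k)\<close> of a postfix code pops the premises of \<open>S\<close> from a stack of sequents and pushes
  \<open>S\<close>. There are \<open>k\<close> premises, except that \<open>k = 3\<close> stands for two premises in reverse order.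
\<close>

type_synonym code = "(lseq \<times> nat) list"

inductive rn :: "code \<Rightarrow> lseq list \<Rightarrow> lseq list \<Rightarrow> bool" where
  rn_Nil: "rn [] st st"
| rn_0: "lndt_inf [] (ms S) \<Longrightarrow> rn c (S # st) st' \<Longrightarrow> rn ((S, 0) # c) st st'"
| rn_1: "lndt_inf [ms P] (ms S) \<Longrightarrow> rn c (S # st) st' \<Longrightarrow> rn ((S, Suc 0) # c) (P # st) st'"
| rn_2: "lndt_inf [ms P, ms Q] (ms S) \<Longrightarrow> rn c (S # st) st' \<Longrightarrow> rn ((S, 2) # c) (Q # P # st) st'"
| rn_3: "lndt_inf [ms P, ms Q] (ms S) \<Longrightarrow> rn c (S # st) st' \<Longrightarrow> rn ((S, 3) # c) (P # Q # st) st'"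

lemma rn_append: "rn c st st1 \<Longrightarrow> rn d st1 st2 \<Longrightarrow> rn (c @ d) st st2"
  by (induction rule: rn.induct) (auto intro: rn.intros)

lemmas rn_0' = rn_0[OF _ rn_Nil] and rn_1' = rn_1[OF _ rn_Nil] and rn_2' = rn_2[OF _ rn_Nil]
  and rn_3' = rn_3[OF _ rn_Nil]

definition cw :: "lseq \<Rightarrow> lseq \<Rightarrow> code" where
  "cw S T = map (\<lambda>i. (fst i, Suc 0)) (wk S T)"

lemma pt_cw [pt_intros]: "pt f \<Longrightarrow> pt g \<Longrightarrow> pt (\<lambda>x. cw (f x) (g x))"
  unfolding cw_def by (intro pt_intros)

lemma rn_cw:
  assumes "subseq S T"
  shows "rn (cw S T) (S # st) (T # st)"
proof -
  have "chain S is T \<Longrightarrow> rn (map (\<lambda>i. (fst i, Suc 0)) is) (S # st) (T # st)" for "is"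
    by (induction "is" arbitrary: S) (auto intro!: rn_Nil rn_1 ldt simp: valid_inst_def)
  then show ?thesis unfolding cw_def using chain_wk[OF assms] by blast
qed

section \<open>Turning a postfix code into a written proof\<close>

definition pos_args :: "nat \<Rightarrow> nat list \<Rightarrow> nat list" where
  "pos_args k st = (if k = 0 then [] else if k = Suc 0 then [hd (st @ [0])]
     else if k = 2 then [hd (tl st @ [0]), hd (st @ [0])] else [hd (st @ [0]), hd (tl st @ [0])])"

definition pops :: "nat \<Rightarrow> nat list \<Rightarrow> nat list" where
  "pops k st = (if k = 0 then st else if k = Suc 0 then tl st else tl (tl st))"

fun push_line :: "deriv \<times> nat list \<Rightarrow> lseq \<times> nat \<Rightarrow> deriv \<times> nat list" where
  "push_line (\<pi>, ps) (S, k) = (\<pi> @ [(S, pos_args k ps)], length \<pi> # pops k ps)"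

lemma push_line_eq:
  "push_line s i = (fst s @ [(fst i, pos_args (snd i) (snd s))], length (fst s) # pops (snd i) (snd s))"
  by (cases s; cases i) simp

definition assemble :: "code \<Rightarrow> deriv" where
  "assemble c = fst (foldl push_line ([], []) c)"

lemma push_line_bounds:
  "length (fst (foldl push_line ([], []) c)) = length c \<and>
   (\<forall>j \<in> set (snd (foldl push_line ([], []) c)). j < length c)"
proof (induction c rule: rev_induct)
  case (snoc i c)
  have "set (tl ns) \<subseteq> set ns" for ns :: "nat list" by (cases ns) auto
  then have sub: "j \<in> set (pops k st) \<Longrightarrow> j \<in> set st" for j k st
    unfolding pops_def by (auto split: if_splits)
  show ?case
  proof (intro conjI ballI)
    show "length (fst (foldl push_line ([], []) (c @ [i]))) = length (c @ [i])"
      using snoc.IH by (simp add: push_line_eq[of "foldl push_line ([], []) c"])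
    fix j assume "j \<in> set (snd (foldl push_line ([], []) (c @ [i])))"
    then have "j = length c \<or> j \<in> set (snd (foldl push_line ([], []) c))"
      using snoc.IH sub by (simp add: push_line_eq[of "foldl push_line ([], []) c"]) blast
    then show "j < length (c @ [i])" using snoc.IH by auto
  qed
qed simp

lemma pt_assemble: "pt assemble"
  unfolding assemble_def
proof (rule pt_fst, rule pt_foldl[where step = "\<lambda>x. push_line" and init = "\<lambda>x. ([], [])" and xs = "\<lambda>x. x"
      and B = "\<lambda>x. 10 * esize x + 10"])
  show "pt (\<lambda>z :: code \<times> (deriv \<times> nat list) \<times> lseq \<times> nat. push_line (fst (snd z)) (snd (snd z)))"
    unfolding push_line_eq pos_args_def pops_def by (intro pt_intros)
  show "pbd (\<lambda>x :: code. 10 * esize x + 10)" by (intro pbd_intros)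
  fix x ys :: code and i and zs assume x: "x = ys @ i # zs"
  let ?s = "foldl push_line ([], []) ys"
  have l: "length ys \<le> esize x" using length_le_esize[of x] x by simp
  have i: "esize (fst i) \<le> esize x" "esize i < esize x"
    using esize_in_list[of i x] x by auto
  have st: "\<forall>j \<in> set (snd ?s). j < length ys" "length (fst ?s) = length ys"
    using push_line_bounds[of ys] by auto
  \<comment> \<open>The time bound concerns all codes, including malformed ones that exhaust the
    stack. The padding with 0 in \<open>pos_args\<close> keeps the positions bounded there as
    well.\<close>
  have hd: "hd (st @ [0]) \<le> esize x" if "set st \<subseteq> set (snd ?s)" for st
    using st l that by (cases st) auto
  have "set (tl (snd ?s)) \<subseteq> set (snd ?s)" by (cases "snd ?s") auto
  then have "esize (pos_args (snd i) (snd ?s)) \<le> 2 * esize x + 4"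
    using hd[of "snd ?s"] hd[of "tl (snd ?s)"] by (simp add: pos_args_def)
  moreover have tl: "esize (tl ns) \<le> esize ns" for ns :: "nat list" by (cases ns) auto
  have "esize (pops (snd i) (snd ?s)) \<le> esize (snd ?s)"
    using tl[of "snd ?s"] tl[of "tl (snd ?s)"] by (simp add: pops_def)
  ultimately show "esize (foldl push_line ([], []) (ys @ [i])) \<le> esize ?s + (10 * esize x + 10)"
    using i l st by (simp add: push_line_eq[of ?s] esize_append)
qed (intro pt_intros)+

text \<open>By the last conjunct the positions on the stack are pairwise distinct and have not yet
  served as premises. Popping therefore uses each one for the first time, which yields
  tree-likeness.\<close>

definition asm_inv :: "deriv \<Rightarrow> nat list \<Rightarrow> lseq list \<Rightarrow> bool" where
  "asm_inv \<pi> ps st \<longleftrightarrow>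
     (\<forall>i < length \<pi>. (\<forall>j \<in> set (line_prems (\<pi> ! i)). j < i) \<and>
        lndt_inf (map (\<lambda>j. line_seq (\<pi> ! j)) (line_prems (\<pi> ! i))) (line_seq (\<pi> ! i))) \<and>
     map (\<lambda>j. fst (\<pi> ! j)) ps = st \<and> (\<forall>j \<in> set ps. j < length \<pi>) \<and>
     distinct (ps @ concat (map line_prems \<pi>))"

lemma asm_inv_bound:
  assumes "asm_inv \<pi> ps st" "j \<in> set (concat (map line_prems \<pi>))"
  shows "j < length \<pi>"
proof -
  obtain l where "l \<in> set \<pi>" "j \<in> set (line_prems l)" using assms(2) by auto
  then obtain i where "i < length \<pi>" "j \<in> set (line_prems (\<pi> ! i))" by (metis in_set_conv_nth)
  then show ?thesis using assms(1) unfolding asm_inv_def by fastforce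
qed

text \<open>\<open>ps\<close> is what is popped and \<open>rs\<close> is the order in which the rule
  wants its premises. Allowing a permutation treats both orders of two premises at once.\<close>

lemma asm_inv_push:
  assumes inv: "asm_inv \<pi> (ps @ qs) (Ps @ st)" "length ps = length Ps"
    and perm: "mset rs = mset ps" and inf: "lndt_inf (map (\<lambda>j. ms (fst (\<pi> ! j))) rs) (ms S)"
  shows "asm_inv (\<pi> @ [(S, rs)]) (length \<pi> # qs) (S # st)"
proof -
  have rs: "set rs = set ps" using perm by (rule mset_eq_setD)
  have ps: "\<forall>j \<in> set ps. j < length \<pi>" "\<forall>j \<in> set qs. j < length \<pi>" "map (\<lambda>j. fst (\<pi> ! j)) qs = st"
    using inv unfolding asm_inv_def by auto
  have d: "distinct (ps @ qs @ concat (map line_prems \<pi>))" using inv unfolding asm_inv_def by simp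
  moreover have "distinct rs" using d perm by (metis distinct_append mset_eq_imp_distinct_iff)
  ultimately have d': "distinct (qs @ concat (map line_prems \<pi>) @ rs)" using rs by auto
  have b: "length \<pi> \<notin> set (concat (map line_prems \<pi>))" using asm_inv_bound[OF inv(1)] by blast
  have m: "map (\<lambda>j. line_seq ((\<pi> @ [(S, rs)]) ! j)) rs = map (\<lambda>j. ms (fst (\<pi> ! j))) rs"
    using ps(1) rs by (simp add: nth_append line_seq_eq)
  have old: "map (\<lambda>j. line_seq ((\<pi> @ [(S, rs)]) ! j)) (line_prems (\<pi> ! i)) =
      map (\<lambda>j. line_seq (\<pi> ! j)) (line_prems (\<pi> ! i))" if "i < length \<pi>" for i
  proof (rule map_cong[OF refl])
    fix j assume "j \<in> set (line_prems (\<pi> ! i))"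
    then have "j < length \<pi>" using inv(1) that unfolding asm_inv_def by fastforce
    then show "line_seq ((\<pi> @ [(S, rs)]) ! j) = line_seq (\<pi> ! j)" by (simp add: nth_append)
  qed
  show ?thesis unfolding asm_inv_def
  proof (intro conjI allI impI)
    fix i assume i: "i < length (\<pi> @ [(S, rs)])"
    show "\<forall>j \<in> set (line_prems ((\<pi> @ [(S, rs)]) ! i)). j < i"
      using i inv(1) ps(1) rs unfolding asm_inv_def
      by (cases "i = length \<pi>") (auto simp: nth_append line_prems_def)
    show "lndt_inf (map (\<lambda>j. line_seq ((\<pi> @ [(S, rs)]) ! j)) (line_prems ((\<pi> @ [(S, rs)]) ! i)))
        (line_seq ((\<pi> @ [(S, rs)]) ! i))"
    proof (cases "i = length \<pi>")
      case True
      moreover have "lndt_inf (map (\<lambda>j. line_seq ((\<pi> @ [(S, rs)]) ! j)) rs) (ms S)"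
        unfolding m by (rule inf)
      ultimately show ?thesis by (simp add: line_prems_def line_seq_eq)
    next
      case False
      then have "i < length \<pi>" using i by simp
      moreover from this have "(\<pi> @ [(S, rs)]) ! i = \<pi> ! i" by (simp add: nth_append)
      ultimately show ?thesis using inv(1) unfolding asm_inv_def by (simp only: old)
    qed
  next
    show "map (\<lambda>j. fst ((\<pi> @ [(S, rs)]) ! j)) (length \<pi> # qs) = S # st"
      using ps by (auto simp: nth_append)
    show "\<forall>j \<in> set (length \<pi> # qs). j < length (\<pi> @ [(S, rs)])" using ps(2) by auto
    show "distinct ((length \<pi> # qs) @ concat (map line_prems (\<pi> @ [(S, rs)])))"
      using d' b ps rs by (auto simp: line_prems_def)
  qed
qed

lemma foldl_push_line:
  assumes "rn c st st'" "asm_inv \<pi> ps st"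
  shows "\<exists>\<pi>' ps'. foldl push_line (\<pi>, ps) c = (\<pi>', ps') \<and> asm_inv \<pi>' ps' st'"
  using assms
proof (induction arbitrary: \<pi> ps rule: rn.induct)
  case (rn_Nil st)
  then show ?case by simp
next
  case (rn_0 S c st st')
  have "asm_inv (\<pi> @ [(S, [])]) (length \<pi> # ps) (S # st)"
    using asm_inv_push[of \<pi> "[]" ps "[]" st "[]" S] rn_0 by simp
  from rn_0.IH[OF this] show ?case by (simp add: pos_args_def pops_def)
next
  case (rn_1 P S c st st')
  then obtain j qs where ps: "ps = j # qs" "fst (\<pi> ! j) = P" unfolding asm_inv_def by auto
  have "asm_inv (\<pi> @ [(S, [j])]) (length \<pi> # qs) (S # st)"
    using asm_inv_push[of \<pi> "[j]" qs "[P]" st "[j]" S] rn_1 ps by simp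
  from rn_1.IH[OF this] show ?case by (simp add: pos_args_def pops_def ps)
next
  case (rn_2 P Q S c st st')
  then obtain j k qs where ps: "ps = k # j # qs" "fst (\<pi> ! j) = P" "fst (\<pi> ! k) = Q"
    unfolding asm_inv_def by auto
  have "asm_inv (\<pi> @ [(S, [j, k])]) (length \<pi> # qs) (S # st)"
    using asm_inv_push[of \<pi> "[k, j]" qs "[Q, P]" st "[j, k]" S] rn_2 ps by simp
  from rn_2.IH[OF this] show ?case by (simp add: pos_args_def pops_def ps)
next
  case (rn_3 P Q S c st st')
  then obtain j k qs where ps: "ps = j # k # qs" "fst (\<pi> ! j) = P" "fst (\<pi> ! k) = Q"
    unfolding asm_inv_def by auto
  have "asm_inv (\<pi> @ [(S, [j, k])]) (length \<pi> # qs) (S # st)"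
    using asm_inv_push[of \<pi> "[j, k]" qs "[P, Q]" st "[j, k]" S] rn_3 ps by simp
  from rn_3.IH[OF this] show ?case by (simp add: pos_args_def pops_def ps)
qed

lemma assemble_tree_proof:
  assumes "rn c [] st" "c \<noteq> []"
  shows "tree_LNDT_proof (assemble c) (ms (fst (last c)))"
proof -
  have "asm_inv [] [] []" by (simp add: asm_inv_def)
  then obtain \<pi> ps where *: "foldl push_line ([], []) c = (\<pi>, ps)" "asm_inv \<pi> ps st"
    using foldl_push_line[OF assms(1)] by blast
  obtain d i where c: "c = d @ [i]" using assms(2) by (metis rev_exhaust)
  then have "\<pi> \<noteq> []" "fst (last \<pi>) = fst (last c)"
    using *(1) push_line_eq[of "foldl push_line ([], []) d" i] by auto
  then show ?thesis using * unfolding asm_inv_def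
    by (simp add: tree_LNDT_proof_def derives_def tree_like_def assemble_def line_seq_eq)
qed

section \<open>From LDT to tree-like LNDT\<close>

text \<open>A decision formula takes the value of one of its branches, so negating both branches
  negates it, without disjunctions and without new leaves.\<close>

fun neg :: "form \<Rightarrow> form" where
  "neg (Lit p) = Lit (compl p)"
| "neg (Dec A p B) = Dec (neg A) p (neg B)"
| "neg (Or A B) = Or A B"

lemma pt_neg [pt_intros]: "pt f \<Longrightarrow> pt (\<lambda>x. neg (f x))"
proof (rule pt_rec_form[where h = neg and l = "\<lambda>p. Lit (compl p)" and K = "\<lambda>Z. esize Z + 1"
      and c = "\<lambda>Z v w. if form_is_Dec Z then Dec v (form_lit Z) w else Z"])
  show "pt (\<lambda>z. if form_is_Dec (fst z) then Dec (fst (snd z)) (form_lit (fst z)) (snd (snd z)) else fst z)"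
    by (intro pt_intros)
  show "pbd (\<lambda>Z :: form. esize Z + 1)" by (intro pbd_intros)
qed (auto intro!: pt_intros)

text \<open>Decomposing \<open>Dec B p C\<close> and its negation gives four cases, as both test
  \<open>p\<close>. Where the tests agree, a recursive code applies; where they disagree,
  \<open>p\<close> stands on both sides. Each recursive code is inserted once, so the growth is
  additive.\<close>

definition contra_Dec :: "form \<Rightarrow> lit \<Rightarrow> form \<Rightarrow> code \<Rightarrow> code \<Rightarrow> code" where
  "contra_Dec B p C cB cC = cB @ cw ([B, neg B], []) ([neg B, B], [Lit p, Lit p]) @
     [(([Lit p], [Lit p]), 0)] @ cw ([Lit p], [Lit p]) ([Lit p, neg C, B], [Lit p]) @
     [(([B, neg (Dec B p C)], [Lit p]), 2)] @
     [(([Lit p], [Lit p]), 0)] @ cw ([Lit p], [Lit p]) ([neg B, Lit p, C], [Lit p]) @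
     cC @ cw ([C, neg C], []) ([Lit p, neg C, Lit p, C], []) @
     [(([Lit p, C, neg (Dec B p C)], []), 2)] @ [(([Dec B p C, neg (Dec B p C)], []), 2)]"

definition excl_mid_Dec :: "form \<Rightarrow> lit \<Rightarrow> form \<Rightarrow> code \<Rightarrow> code \<Rightarrow> code" where
  "excl_mid_Dec B p C cB cC = cB @ cw ([], [B, neg B]) ([], [neg B, Lit p, B, Lit p]) @
     [(([Lit p], [Lit p]), 0)] @ cw ([Lit p], [Lit p]) ([Lit p], [neg C, B, Lit p]) @
     [(([], [B, Lit p, neg (Dec B p C)]), 2)] @
     [(([Lit p], [Lit p]), 0)] @ cw ([Lit p], [Lit p]) ([Lit p], [neg B, Lit p, C]) @
     cC @ cw ([], [C, neg C]) ([Lit p, Lit p], [neg C, C]) @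
     [(([Lit p], [C, neg (Dec B p C)]), 2)] @ [(([], [Dec B p C, neg (Dec B p C)]), 2)]"

fun contra :: "form \<Rightarrow> code" where
  "contra (Lit p) = [(([Lit p, Lit (compl p)], []), 0)]"
| "contra (Dec B p C) = contra_Dec B p C (contra B) (contra C)"
| "contra (Or B C) = []"

fun excl_mid :: "form \<Rightarrow> code" where
  "excl_mid (Lit p) = [(([], [Lit p, Lit (compl p)]), 0)]"
| "excl_mid (Dec B p C) = excl_mid_Dec B p C (excl_mid B) (excl_mid C)"
| "excl_mid (Or B C) = []"

lemma pt_contra [pt_intros]:
  assumes "pt f" shows "pt (\<lambda>x. contra (f x))"
proof -
  have r: "pt (\<lambda>z. contra_Dec (form_left (fst z)) (form_lit (fst z)) (form_right (fst z)) (fst (snd z)) (snd (snd z)))"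
    unfolding contra_Dec_def by (intro pt_intros)
  have K: "pbd (\<lambda>Z. esize (contra_Dec (form_left Z) (form_lit Z) (form_right Z) [] []))"
    by (rule pbd_pt[OF _ pbd_esize]) (unfold contra_Dec_def, intro pt_intros)
  show ?thesis
    by (rule pt_rec_form[where h = contra and l = "\<lambda>p. [(([Lit p, Lit (compl p)], []), 0)]"
        and c = "\<lambda>Z v w. if form_is_Dec Z then contra_Dec (form_left Z) (form_lit Z) (form_right Z) v w else []", OF _ _ _ _ _ K])
      (intro pt_intros r assms | simp add: contra_Dec_def esize_append)+
qed

lemma pt_excl_mid [pt_intros]:
  assumes "pt f" shows "pt (\<lambda>x. excl_mid (f x))"
proof -
  have r: "pt (\<lambda>z. excl_mid_Dec (form_left (fst z)) (form_lit (fst z)) (form_right (fst z)) (fst (snd z)) (snd (snd z)))"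
    unfolding excl_mid_Dec_def by (intro pt_intros)
  have K: "pbd (\<lambda>Z. esize (excl_mid_Dec (form_left Z) (form_lit Z) (form_right Z) [] []))"
    by (rule pbd_pt[OF _ pbd_esize]) (unfold excl_mid_Dec_def, intro pt_intros)
  show ?thesis
    by (rule pt_rec_form[where h = excl_mid and l = "\<lambda>p. [(([], [Lit p, Lit (compl p)]), 0)]"
        and c = "\<lambda>Z v w. if form_is_Dec Z then excl_mid_Dec (form_left Z) (form_lit Z) (form_right Z) v w else []", OF _ _ _ _ _ K])
      (intro pt_intros r assms | simp add: excl_mid_Dec_def esize_append)+
qed

lemma rn_id: "rn [(([Lit p], [Lit p]), 0)] st (([Lit p], [Lit p]) # st)"
  by (rule rn_0') (simp add: ms_def ldt init_id)

lemma ms_dec_l: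
  assumes "mset G1 = add_mset A (mset G)" "mset D1 = add_mset (Lit p) (mset D)"
    "mset G2 = add_mset (Lit p) (add_mset B (mset G))" "mset D2 = mset D"
    "mset G' = add_mset (Dec A p B) (mset G)" "mset D' = mset D"
  shows "ldt_inf [ms (G1, D1), ms (G2, D2)] (ms (G', D'))"
  using assms dec_l[of A "mset G" p "mset D" B] by (simp add: ms_def)

lemma ms_dec_r:
  assumes "mset G1 = mset G" "mset D1 = add_mset A (add_mset (Lit p) (mset D))"
    "mset G2 = add_mset (Lit p) (mset G)" "mset D2 = add_mset B (mset D)"
    "mset G' = mset G" "mset D' = add_mset (Dec A p B) (mset D)"
  shows "ldt_inf [ms (G1, D1), ms (G2, D2)] (ms (G', D'))"
  using assms dec_r[of "mset G" A p "mset D" B] by (simp add: ms_def)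

lemma ms_cut:
  assumes "mset G1 = mset G" "mset D1 = add_mset A (mset D)"
    "mset G2 = add_mset A (mset G)" "mset D2 = mset D"
  shows "ldt_inf [ms (G1, D1), ms (G2, D2)] (ms (G, D))"
  using assms cut[of "mset G" A "mset D"] by (simp add: ms_def)

lemma rn_contra: "is_DT A \<Longrightarrow> rn (contra A) st (([A, neg A], []) # st)"
proof (induction A arbitrary: st)
  case (Lit p)
  show ?case by (simp, rule rn_0') (simp add: ms_def ldt init_l)
next
  case (Dec B p C)
  have 1: "lndt_inf [ms ([neg B, B], [Lit p, Lit p]), ms ([Lit p, neg C, B], [Lit p])]
      (ms ([B, neg (Dec B p C)], [Lit p]))"
    by (rule ldt, rule ms_dec_l[where G = "[B]" and D = "[Lit p]" and A = "neg B" and B = "neg C"]) auto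
  have 2: "lndt_inf [ms ([neg B, Lit p, C], [Lit p]), ms ([Lit p, neg C, Lit p, C], [])]
      (ms ([Lit p, C, neg (Dec B p C)], []))"
    by (rule ldt, rule ms_dec_l[where G = "[Lit p, C]" and D = "[]" and A = "neg B" and B = "neg C"]) auto
  have 3: "lndt_inf [ms ([B, neg (Dec B p C)], [Lit p]), ms ([Lit p, C, neg (Dec B p C)], [])]
      (ms ([Dec B p C, neg (Dec B p C)], []))"
    by (rule ldt, rule ms_dec_l[where G = "[neg (Dec B p C)]" and D = "[]" and A = "B" and B = "C"]) auto
  have B: "rn (contra B) st (([B, neg B], []) # st)" and C: "rn (contra C) st (([C, neg C], []) # st)" for st
    using Dec by auto
  show ?case
    unfolding contra.simps contra_Dec_def
    by (rule rn_append[OF B rn_append[OF rn_cw rn_append[OF rn_id rn_append[OF rn_cw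
          rn_append[OF rn_2'[OF 1] rn_append[OF rn_id rn_append[OF rn_cw
          rn_append[OF C rn_append[OF rn_cw rn_append[OF rn_2'[OF 2] rn_2'[OF 3]]]]]]]]]]]) auto
qed simp

lemma rn_excl_mid: "is_DT A \<Longrightarrow> rn (excl_mid A) st (([], [A, neg A]) # st)"
proof (induction A arbitrary: st)
  case (Lit p)
  show ?case by (simp, rule rn_0') (simp add: ms_def ldt init_r)
next
  case (Dec B p C)
  have 1: "lndt_inf [ms ([], [neg B, Lit p, B, Lit p]), ms ([Lit p], [neg C, B, Lit p])]
      (ms ([], [B, Lit p, neg (Dec B p C)]))"
    by (rule ldt, rule ms_dec_r[where G = "[]" and D = "[B, Lit p]" and A = "neg B" and B = "neg C"]) auto
  have 2: "lndt_inf [ms ([Lit p], [neg B, Lit p, C]), ms ([Lit p, Lit p], [neg C, C])]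
      (ms ([Lit p], [C, neg (Dec B p C)]))"
    by (rule ldt, rule ms_dec_r[where G = "[Lit p]" and D = "[C]" and A = "neg B" and B = "neg C"]) auto
  have 3: "lndt_inf [ms ([], [B, Lit p, neg (Dec B p C)]), ms ([Lit p], [C, neg (Dec B p C)])]
      (ms ([], [Dec B p C, neg (Dec B p C)]))"
    by (rule ldt, rule ms_dec_r[where G = "[]" and D = "[neg (Dec B p C)]" and A = "B" and B = "C"]) auto
  have B: "rn (excl_mid B) st (([], [B, neg B]) # st)" and C: "rn (excl_mid C) st (([], [C, neg C]) # st)" for st
    using Dec by auto
  show ?case
    unfolding excl_mid.simps excl_mid_Dec_def
    by (rule rn_append[OF B rn_append[OF rn_cw rn_append[OF rn_id rn_append[OF rn_cw
          rn_append[OF rn_2'[OF 1] rn_append[OF rn_id rn_append[OF rn_cw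
          rn_append[OF C rn_append[OF rn_cw rn_append[OF rn_2'[OF 2] rn_2'[OF 3]]]]]]]]]]]) auto
qed simp

text \<open>A cut on \<open>neg A\<close> between excluded middle and contradiction replaces a
  separate recursion on \<open>A\<close>.\<close>

definition identity :: "form \<Rightarrow> code" where
  "identity A = excl_mid A @ cw ([], [A, neg A]) ([A], [neg A, A]) @
     contra A @ cw ([A, neg A], []) ([neg A, A], [A]) @ [(([A], [A]), 2)]"

lemma pt_identity [pt_intros]: "pt f \<Longrightarrow> pt (\<lambda>x. identity (f x))"
  unfolding identity_def by (intro pt_intros)

lemma rn_identity:
  assumes "is_DT A" shows "rn (identity A) st (([A], [A]) # st)"
proof -
  have 1: "lndt_inf [ms ([A], [neg A, A]), ms ([neg A, A], [A])] (ms ([A], [A]))"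
    by (rule ldt, rule ms_cut[where A = "neg A"]) auto
  show ?thesis
    unfolding identity_def
    by (rule rn_append[OF rn_excl_mid[OF assms] rn_append[OF rn_cw rn_append[OF rn_contra[OF assms]
          rn_append[OF rn_cw rn_2'[OF 1]]]]]) auto
qed

text \<open>The language has no constant for falsity. This formula says: if variable 0 is false,
  then variable 0, else its negation.\<close>

definition bot :: form where
  "bot = Dec (Lit (Pos 0)) (Pos 0) (Lit (Neg 0))"

definition contra_bot :: code where
  "contra_bot = [(([Lit (Pos 0)], [Lit (Pos 0)]), 0)] @
     [(([Lit (Pos 0), Lit (Neg 0)], []), 0)] @ [(([bot], []), 2)]"

lemma rn_contra_bot: "rn contra_bot st (([bot], []) # st)"
proof -
  have "ldt_inf [] (ms ([Lit (Pos 0), Lit (Neg 0)], []))"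
    using init_l[of "Pos 0"] by (simp add: ms_def)
  then have 1: "rn [(([Lit (Pos 0), Lit (Neg 0)], []), 0)] st (([Lit (Pos 0), Lit (Neg 0)], []) # st)" for st
    by (intro rn_0' ldt)
  have 2: "lndt_inf [ms ([Lit (Pos 0)], [Lit (Pos 0)]), ms ([Lit (Pos 0), Lit (Neg 0)], [])] (ms ([bot], []))"
    unfolding bot_def
    by (rule ldt, rule ms_dec_l[where G = "[]" and D = "[]" and A = "Lit (Pos 0)" and B = "Lit (Neg 0)"]) auto
  show ?thesis unfolding contra_bot_def by (rule rn_append[OF rn_id rn_append[OF 1 rn_2'[OF 2]]])
qed

section \<open>Disjunctions that express sequents\<close>

fun big_or :: "form list \<Rightarrow> form" where
  "big_or [] = bot"
| "big_or (A # As) = Or (big_or As) A"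

lemma pt_big_or [pt_intros]:
  fixes f :: "'a::encodable \<Rightarrow> form list"
  assumes "pt f" shows "pt (\<lambda>x. big_or (f x))"
proof (rule pt_rec_list[where h = "\<lambda>x. big_or" and n = "\<lambda>x. bot" and c = "\<lambda>x y ys v. Or v y"
        and B = "\<lambda>x. esize (f x) + 5"])
  show "pt (\<lambda>z :: 'a \<times> form \<times> form list \<times> form. Or (snd (snd (snd z))) (fst (snd z)))"
    by (intro pt_intros)
  show "pbd (\<lambda>x. esize (f x) + 5)" by (intro pbd_intros pbd_pt[OF assms])
  show "esize (big_or (y # ys)) \<le> esize (big_or ys) + (esize (f x) + 5)" if "f x = zs @ y # ys" for x zs y ys
    using that by (simp add: esize_append true_bt_def)
qed (simp_all add: pt_const assms)

text \<open>The reversal makes the disjunctions of initial segments occur as subformulas. A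
  succedent can then be absorbed from left to right, one right disjunction inference per formula;
  \<open>splits\<close> lists the stages.\<close>

definition seq_form :: "lseq \<Rightarrow> form" where
  "seq_form S = big_or (rev (map neg (fst S) @ snd S))"

lemma pt_seq_form [pt_intros]: "pt f \<Longrightarrow> pt (\<lambda>x. seq_form (f x))"
  unfolding seq_form_def by (intro pt_intros)

definition branches :: "lseq \<Rightarrow> (form \<times> code) list" where
  "branches S =
     map (\<lambda>A. (neg A, contra A @ cw ([A, neg A], []) (neg A # fst S, snd S))) (fst S) @
     map (\<lambda>A. (A, identity A @ cw ([A], [A]) (A # fst S, snd S))) (snd S)"

text \<open>Each disjunct closes against \<open>S\<close> separately: a negated antecedent formula
  by \<open>contra\<close>, a succedent formula by \<open>identity\<close>. The innermost disjunct
  \<open>bot\<close> is refuted first, and the left disjunction inferences add the others.\<close>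

definition seq_form_elim :: "lseq \<Rightarrow> code" where
  "seq_form_elim S = contra_bot @ cw ([bot], []) (bot # fst S, snd S) @
     concat (map (\<lambda>s. snd (hd s) @ [((big_or (map fst s) # fst S, snd S), 2)]) (rev (sufs (rev (branches S)))))"

lemma pt_seq_form_elim [pt_intros]: "pt f \<Longrightarrow> pt (\<lambda>x. seq_form_elim (f x))"
  by (rule pt_comp[of seq_form_elim])
    (unfold seq_form_elim_def branches_def, intro pt_intros)

lemma rn_branches:
  assumes "\<And>b st. b \<in> set bs \<Longrightarrow> rn (snd b) st ((fst b # G, D) # st)"
  shows "rn (concat (map (\<lambda>s. snd (hd s) @ [((big_or (map fst s) # G, D), 2)]) (rev (sufs bs))))
    ((bot # G, D) # st) ((big_or (map fst bs) # G, D) # st)"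
  using assms
proof (induction bs)
  case (Cons b bs)
  have "lndt_inf [ms (big_or (map fst bs) # G, D), ms (fst b # G, D)] (ms (big_or (map fst (b # bs)) # G, D))"
    by (simp add: ms_def or_l)
  from rn_append[OF _ rn_append[OF Cons.prems rn_2'[OF this]]] Cons show ?case by simp
qed (simp add: rn_Nil)

lemma rn_seq_form_elim:
  assumes "\<forall>A \<in> set (fst S) \<union> set (snd S). is_DT A"
  shows "rn (seq_form_elim S) st ((seq_form S # fst S, snd S) # st)"
proof -
  have b: "rn (snd b) st ((fst b # fst S, snd S) # st)" if b: "b \<in> set (rev (branches S))" for b st
  proof -
    consider A where "A \<in> set (fst S)" "b = (neg A, contra A @ cw ([A, neg A], []) (neg A # fst S, snd S))"
      | A where "A \<in> set (snd S)" "b = (A, identity A @ cw ([A], [A]) (A # fst S, snd S))"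
      using b unfolding branches_def by auto
    then show ?thesis
    proof cases
      case 1
      then have "is_DT A" using assms by blast
      from rn_append[OF rn_contra[OF this] rn_cw] 1 show ?thesis by simp
    next
      case 2
      then have "is_DT A" using assms by blast
      from rn_append[OF rn_identity[OF this] rn_cw] 2 show ?thesis by simp
    qed
  qed
  have "map fst (rev (branches S)) = rev (map neg (fst S) @ snd S)"
    unfolding branches_def by (simp add: comp_def rev_map)
  then have "big_or (map fst (rev (branches S))) = seq_form S" unfolding seq_form_def by simp
  with rn_branches[of "rev (branches S)", OF b] show ?thesis
    unfolding seq_form_elim_def
    by (intro rn_append[OF rn_contra_bot rn_append[OF rn_cw]]) auto
qed

section \<open>Deriving the formula of a line from the formulas of its premises\<close>

fun splits :: "'a list \<Rightarrow> ('a list \<times> 'a list) list" where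
  "splits [] = [([], [])]"
| "splits (x # xs) = ([], x # xs) # map (\<lambda>z. (fst z @ [x], snd z)) (splits xs)"

lemma length_splits: "length (splits xs) = Suc (length xs)"
  by (induction xs) auto

lemma pt_splits [pt_intros]:
  fixes f :: "'a::encodable \<Rightarrow> 'b::encodable list"
  assumes "pt f"
  shows "pt (\<lambda>x. splits (f x))"
proof (rule pt_rec_list[where h = "\<lambda>x. splits" and n = "\<lambda>x. [([], [])]"
        and c = "\<lambda>x y ys v. ([], y # ys) # map (\<lambda>z. (fst z @ [y], snd z)) v"
        and B = "\<lambda>x. (esize (f x) + 2) * (esize (f x) + 2)"])
  show "pt (\<lambda>z :: 'a \<times> 'b \<times> 'b list \<times> ('b list \<times> 'b list) list.
      ([], fst (snd z) # fst (snd (snd z))) # map (\<lambda>za. (fst za @ [fst (snd z)], snd za)) (snd (snd (snd z))))"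
    by (intro pt_intros)
  show "pbd (\<lambda>x. (esize (f x) + 2) * (esize (f x) + 2))" by (intro pbd_intros pbd_pt[OF assms])
  fix x zs y ys assume *: "f x = zs @ y # ys"
  have "esize (map (\<lambda>z. (fst z @ [y], snd z)) v) = esize v + length v * Suc (esize y)"
    for v :: "('b list \<times> 'b list) list"
    by (induction v) (auto simp: esize_append)
  then have "esize (splits (y # ys)) = esize (splits ys) + (esize (y # ys) + 2 + Suc (length ys) * Suc (esize y))"
    by (simp add: length_splits)
  moreover have "esize (y # ys) \<le> esize (f x)" using * by (simp add: esize_append)
  moreover have "Suc (length ys) * Suc (esize y) \<le> Suc (esize (f x)) * esize (f x)"
    using * length_le_esize[of ys] by (intro mult_le_mono) (simp_all add: esize_append)
  ultimately show "esize (splits (y # ys)) \<le> esize (splits ys) + (esize (f x) + 2) * (esize (f x) + 2)"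
    by (simp add: algebra_simps)
qed (simp_all add: pt_const assms)

lemma rn_splits_tl:
  "rn (map (\<lambda>z. ((K, big_or (fst z @ q) # snd z @ R), Suc 0)) (tl (splits xs)))
     ((K, big_or q # xs @ R) # st) ((K, big_or (rev xs @ q) # R) # st)"
proof (induction xs arbitrary: q)
  case (Cons x xs)
  have hd: "splits xs = ([], xs) # tl (splits xs)" by (cases xs) auto
  have "lndt_inf [ms (K, big_or q # x # xs @ R)] (ms (K, big_or (x # q) # xs @ R))"
    by (simp add: ms_def or_r)
  from rn_1[OF this Cons.IH[of "x # q"]] show ?case
    by (subst splits.simps, simp only: list.sel map_map comp_def fst_conv snd_conv, subst hd) simp
qed (simp add: rn_Nil)

lemma rn_splits:
  "rn (map (\<lambda>z. ((K, big_or (fst z) # snd z @ R), Suc 0)) (splits xs))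
     ((K, xs @ R) # st) ((K, big_or (rev xs) # R) # st)"
proof -
  have hd: "splits xs = ([], xs) # tl (splits xs)" by (cases xs) auto
  have "lndt_inf [ms (K, xs @ R)] (ms (K, big_or [] # xs @ R))"
    by (rule ldt) (simp add: ms_def weak_r)
  from rn_1[OF this, of _ st] rn_splits_tl[of K "[]" R xs st] show ?thesis by (subst hd) simp
qed

text \<open>
  The code of \<open>K \<rightarrow> seq_form S, R\<close> for an inference of \<open>S\<close> from \<open>Ps\<close>, when \<open>K\<close> contains the
  formulas of the premises: the inference is repeated with the side formulas \<open>K\<close> and \<open>R\<close>.
\<close>

definition seq_form_intro :: "form list \<Rightarrow> form list \<Rightarrow> lseq \<Rightarrow> lseq list \<Rightarrow> code" where
  "seq_form_intro K R S Ps =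
     (if Ps = [] then [(S, 0)] @ cw S (fst S @ K, map neg (fst S) @ snd S @ R)
      else concat (map (\<lambda>P. seq_form_elim P @
          cw (seq_form P # fst P, snd P) (fst P @ K, snd P @ R)) Ps) @
        [((fst S @ K, snd S @ R), length Ps)] @
        cw (fst S @ K, snd S @ R) (fst S @ K, map neg (fst S) @ snd S @ R)) @
     concat (map (\<lambda>s. excl_mid (hd s) @
         cw ([], [hd s, neg (hd s)]) (tl s @ K, hd s # map neg (fst S) @ snd S @ R) @
         [((tl s @ K, map neg (fst S) @ snd S @ R), 3)]) (sufs (fst S))) @
     map (\<lambda>z. ((K, big_or (fst z) # snd z @ R), Suc 0)) (splits (map neg (fst S) @ snd S))"

lemma pt_seq_form_intro [pt_intros]:
  "pt a \<Longrightarrow> pt b \<Longrightarrow> pt c \<Longrightarrow> pt d \<Longrightarrow> pt (\<lambda>x. seq_form_intro (a x) (b x) (c x) (d x))"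
  by (rule pt_app4[of seq_form_intro]) (unfold seq_form_intro_def, intro pt_intros)

text \<open>Initial sequents admit no side formulas, hence the restriction;
  \<open>seq_form_intro\<close> weakens them afterwards instead.\<close>

lemma ldt_inf_context:
  assumes "ldt_inf Ps S" "Ps \<noteq> []"
  shows "ldt_inf (map (\<lambda>P. (fst P + K, snd P + R)) Ps) (fst S + K, snd S + R)"
  using assms by cases (auto intro: ldt_inf.intros)

lemma ldt_inf_prems: "ldt_inf Ps S \<Longrightarrow> Ps = [] \<or> (\<exists>P. Ps = [P]) \<or> (\<exists>P Q. Ps = [P, Q])"
  by (cases rule: ldt_inf.cases) auto

text \<open>A cut with excluded middle for \<open>A\<close> trades \<open>A\<close> on the left for
  \<open>neg A\<close> on the right. The sequent with \<open>A\<close> on the left is the second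
  premise of this cut but is already on the stack, which explains the entry 3.\<close>

lemma rn_moves:
  assumes "\<And>A. A \<in> set G \<Longrightarrow> is_DT A \<and> neg A \<in> set D"
  shows "rn (concat (map (\<lambda>s. excl_mid (hd s) @ cw ([], [hd s, neg (hd s)]) (tl s @ K, hd s # D) @
      [((tl s @ K, D), 3)]) (sufs G))) ((G @ K, D) # st) ((K, D) # st)"
  using assms
proof (induction G)
  case (Cons A G)
  then have A: "is_DT A" "neg A \<in> set D" by auto
  have "lndt_inf [ms (G @ K, A # D), ms (A # G @ K, D)] (ms (G @ K, D))"
    by (rule ldt, rule ms_cut[where A = A]) auto
  from rn_append[OF rn_excl_mid[OF A(1)] rn_append[OF rn_cw rn_3'[OF this]]] A(2)
  have "rn (excl_mid A @ cw ([], [A, neg A]) (G @ K, A # D) @ [((G @ K, D), 3)])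
      ((A # G @ K, D) # st) ((G @ K, D) # st)" by simp
  from rn_append[OF this Cons.IH] Cons.prems show ?case by simp
qed (simp add: rn_Nil)

lemma rn_concat_rev:
  assumes "\<And>x st. x \<in> set xs \<Longrightarrow> rn (c x) st (g x # st)"
  shows "rn (concat (map c (rev xs))) st (map g xs @ st)"
  using assms
proof (induction xs)
  case (Cons x xs)
  have "rn (concat (map c (rev xs))) st (map g xs @ st)" using Cons by simp
  from rn_append[OF this Cons.prems[of x]] show ?case by simp
qed (simp add: rn_Nil)

lemma rn_seq_form_intro:
  assumes inf: "ldt_inf (map ms Ps) (ms S)"
    and DT: "\<And>P A. P \<in> set (S # Ps) \<Longrightarrow> A \<in> set (fst P) \<union> set (snd P) \<Longrightarrow> is_DT A"
    and K: "\<And>P. P \<in> set Ps \<Longrightarrow> seq_form P \<in> set K"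
  shows "rn (seq_form_intro K R S Ps) st ((K, seq_form S # R) # st)"
proof -
  let ?D = "map neg (fst S) @ snd S"
  have start: "rn (if Ps = [] then [(S, 0)] @ cw S (fst S @ K, ?D @ R)
      else concat (map (\<lambda>P. seq_form_elim P @
          cw (seq_form P # fst P, snd P) (fst P @ K, snd P @ R)) Ps) @
        [((fst S @ K, snd S @ R), length Ps)] @ cw (fst S @ K, snd S @ R) (fst S @ K, ?D @ R))
      st ((fst S @ K, ?D @ R) # st)"
  proof (cases "Ps = []")
    case True
    then have "rn [(S, 0)] st (S # st)" using inf by (intro rn_0' ldt) simp
    from rn_append[OF this rn_cw[of S "(fst S @ K, ?D @ R)"]] True show ?thesis
      by (simp add: subseq_def le_supI1 le_supI2)
  next
    case False
    have P: "rn (seq_form_elim P @ cw (seq_form P # fst P, snd P) (fst P @ K, snd P @ R)) st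
        ((fst P @ K, snd P @ R) # st)" if "P \<in> set Ps" for P st
    proof (rule rn_append[OF rn_seq_form_elim rn_cw])
      show "\<forall>A \<in> set (fst P) \<union> set (snd P). is_DT A" using DT[of P] that by (metis list.set_intros(2))
      show "subseq (seq_form P # fst P, snd P) (fst P @ K, snd P @ R)" using K that by auto
    qed
    have elims: "rn (concat (map (\<lambda>P. seq_form_elim P @
        cw (seq_form P # fst P, snd P) (fst P @ K, snd P @ R)) Ps)) st
        (map (\<lambda>P. (fst P @ K, snd P @ R)) (rev Ps) @ st)"
      using rn_concat_rev[of "rev Ps", OF P] by simp
    have "lndt_inf (map (\<lambda>P. ms (fst P @ K, snd P @ R)) Ps) (ms (fst S @ K, snd S @ R))"
      using ldt_inf_context[OF inf, of "mset K" "mset R"] False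
      by (intro ldt) (simp add: ms_def comp_def)
    moreover have "(\<exists>P. Ps = [P]) \<or> (\<exists>P Q. Ps = [P, Q])"
      using ldt_inf_prems[OF inf] False by auto
    ultimately have "rn [((fst S @ K, snd S @ R), length Ps)]
        (map (\<lambda>P. (fst P @ K, snd P @ R)) (rev Ps) @ st) ((fst S @ K, snd S @ R) # st)"
      using rn_2'[unfolded numeral_2_eq_2] by (auto intro: rn_1')
    from rn_append[OF elims rn_append[OF this rn_cw]] False show ?thesis by simp
  qed
  have mv: "rn (concat (map (\<lambda>s. excl_mid (hd s) @ cw ([], [hd s, neg (hd s)]) (tl s @ K, hd s # ?D @ R) @
      [((tl s @ K, ?D @ R), 3)]) (sufs (fst S)))) ((fst S @ K, ?D @ R) # st) ((K, ?D @ R) # st)"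
    by (rule rn_moves) (use DT[of S] in auto)
  show ?thesis
    using rn_append[OF start rn_append[OF mv rn_splits]]
    unfolding seq_form_intro_def seq_form_def[of S] by (simp only: append_assoc)
qed

section \<open>Combining the blocks of all lines by cuts\<close>

definition look :: "deriv \<Rightarrow> nat \<Rightarrow> lseq" where
  "look \<pi> j = fst (snd (hd (filter (\<lambda>e. fst e = j) (List.enumerate 0 \<pi>))))"

lemma pt_look [pt_intros]: "pt f \<Longrightarrow> pt g \<Longrightarrow> pt (\<lambda>x. look (f x) (g x))"
  by (rule pt_app2[of look]) (unfold look_def, intro pt_intros)

lemma look_eq: "j < length \<pi> \<Longrightarrow> look \<pi> j = fst (\<pi> ! j)"
proof -
  assume j: "j < length \<pi>"
  have "(j, \<pi> ! j) \<in> set (filter (\<lambda>e. fst e = j) (List.enumerate 0 \<pi>))"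
    using j by (simp add: in_set_enumerate_eq)
  moreover have "e = (j, \<pi> ! j)" if "e \<in> set (filter (\<lambda>e. fst e = j) (List.enumerate 0 \<pi>))" for e
  proof -
    have "e \<in> set (List.enumerate 0 \<pi>)" "fst e = j" using that by (simp_all only: set_filter mem_Collect_eq)
    then show ?thesis by (auto simp: in_set_enumerate_eq prod_eq_iff)
  qed
  ultimately have "hd (filter (\<lambda>e. fst e = j) (List.enumerate 0 \<pi>)) = (j, \<pi> ! j)"
    by (metis empty_iff hd_in_set list.set(1))
  then show ?thesis by (simp add: look_def)
qed

definition side :: "lseq \<Rightarrow> line list \<Rightarrow> form list" where
  "side S ls = map (\<lambda>l. seq_form (fst l)) ls @ fst S"

lemma pt_side [pt_intros]: "pt f \<Longrightarrow> pt g \<Longrightarrow> pt (\<lambda>x. side (f x) (g x))"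
  by (rule pt_app2[of side]) (unfold side_def, intro pt_intros)

text \<open>Let \<Pi> \<rightarrow> \<Sigma> be the last line. The block of line i leaves F_1, ...,
  F_(i-1), \<Pi> \<rightarrow> F_i, \<Sigma> on the stack. From F_n, all of F_1, ..., F_n, \<Pi>
  \<rightarrow> \<Sigma> is put on top, and each cut removes the formula of the latest remaining
  line. In a suffix of \<open>rev \<pi>\<close>, the tail consists of the lines before the
  head.\<close>

definition tree_code :: "deriv \<Rightarrow> code" where
  "tree_code \<pi> = concat (map (\<lambda>s. seq_form_intro (side (fst (hd (rev \<pi>))) (tl s)) (snd (fst (hd (rev \<pi>))))
       (fst (hd s)) (map (look \<pi>) (snd (hd s)))) (rev (sufs (rev \<pi>)))) @
     seq_form_elim (fst (hd (rev \<pi>))) @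
     cw (seq_form (fst (hd (rev \<pi>))) # fst (fst (hd (rev \<pi>))), snd (fst (hd (rev \<pi>))))
        (side (fst (hd (rev \<pi>))) (rev \<pi>), snd (fst (hd (rev \<pi>)))) @
     map (\<lambda>s. ((side (fst (hd (rev \<pi>))) (tl s), snd (fst (hd (rev \<pi>)))), 2)) (sufs (rev \<pi>))"

lemma pt_tree_code: "pt tree_code"
  unfolding tree_code_def by (intro pt_intros)

lemma rn_cuts:
  "rn (map (\<lambda>s. ((side S (tl s), D), 2)) (sufs ls))
     ((side S ls, D) # map (\<lambda>s. (side S (tl s), seq_form (fst (hd s)) # D)) (sufs ls) @ st)
     ((side S [], D) # st)"
proof (induction ls)
  case (Cons l ls)
  have "lndt_inf [ms (side S ls, seq_form (fst l) # D), ms (side S (l # ls), D)] (ms (side S ls, D))"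
    by (rule ldt, rule ms_cut[where A = "seq_form (fst l)"]) (auto simp: side_def)
  from rn_2[OF this Cons.IH] show ?case by simp
qed (simp add: rn_Nil)

lemma sufs_iff: "s \<in> set (sufs xs) \<longleftrightarrow> s \<noteq> [] \<and> (\<exists>zs. xs = zs @ s)"
proof (induction xs)
  case (Cons x xs)
  then show ?case by (auto simp: Cons_eq_append_conv)
qed simp

lemma last_sufs: "xs \<noteq> [] \<Longrightarrow> \<exists>x. last (sufs xs) = [x]"
proof (induction xs)
  case (Cons x xs)
  then show ?case by (cases xs) auto
qed simp

lemma sufs_Nil_iff [simp]: "sufs xs = [] \<longleftrightarrow> xs = []"
  by (cases xs) auto

lemma tree_code_proof:
  assumes "LDT_proof \<pi> S"
  shows "tree_LNDT_proof (assemble (tree_code \<pi>)) S"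
proof -
  have ne: "\<pi> \<noteq> []" and S: "ms (fst (last \<pi>)) = S"
    and inf: "\<And>i. i < length \<pi> \<Longrightarrow> (\<forall>j \<in> set (snd (\<pi> ! i)). j < i) \<and>
      ldt_inf (map (\<lambda>j. ms (fst (\<pi> ! j))) (snd (\<pi> ! i))) (ms (fst (\<pi> ! i)))"
    and DT: "\<And>l A. l \<in> set \<pi> \<Longrightarrow> A \<in> set (fst (fst l)) \<union> set (snd (fst l)) \<Longrightarrow> is_DT A"
    using assms unfolding LDT_proof_def derives_def line_seq_eq line_prems_def
    by (auto simp: DT_sequent_def ms_def)
  define Z where "Z = fst (last \<pi>)"
  have Z: "fst (hd (rev \<pi>)) = Z" by (simp add: Z_def hd_rev)
  let ?g = "\<lambda>s. (side Z (tl s), seq_form (fst (hd s)) # snd Z)"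
  have block: "rn (seq_form_intro (side Z (tl s)) (snd Z) (fst (hd s)) (map (look \<pi>) (snd (hd s)))) st (?g s # st)"
    if suf: "s \<in> set (sufs (rev \<pi>))" for s st
  proof -
    obtain l r zs where s: "s = l # r" "rev \<pi> = zs @ l # r"
      using suf by (auto simp: sufs_iff neq_Nil_conv)
    \<comment> \<open>In a suffix \<open>l # r\<close> of the reversed proof, \<open>r\<close> holds
      the lines before \<open>l\<close>, so its length is the position of \<open>l\<close>.\<close>
    define i where "i = length r"
    have \<pi>: "\<pi> = rev r @ l # rev zs" using s(2) by (metis append.assoc append_Cons append_Nil rev.simps(2) rev_append rev_rev_ident)
    then have i: "i < length \<pi>" "\<pi> ! i = l" by (auto simp: i_def nth_append)
    have lk: "look \<pi> j = fst (\<pi> ! j)" "\<pi> ! j \<in> set r" "j < length \<pi>" if "j \<in> set (snd l)" for j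
    proof -
      have "j < i" using inf[OF i(1)] that i(2) by auto
      then show "look \<pi> j = fst (\<pi> ! j)" "j < length \<pi>" using i look_eq by simp_all
      show "\<pi> ! j \<in> set r" using \<open>j < i\<close> nth_mem[of j "rev r"] by (simp add: \<pi> i_def nth_append)
    qed
    show ?thesis
      unfolding s(1) list.sel
    proof (rule rn_seq_form_intro)
      have "map (ms \<circ> look \<pi>) (snd l) = map (\<lambda>j. ms (fst (\<pi> ! j))) (snd l)" using lk by simp
      then show "ldt_inf (map ms (map (look \<pi>) (snd l))) (ms (fst l))" using inf[OF i(1)] i(2) by (simp only: map_map)
      show "is_DT A" if P: "P \<in> set (fst l # map (look \<pi>) (snd l))" and A: "A \<in> set (fst P) \<union> set (snd P)" for P A
      proof -
        have "l \<in> set \<pi>" using i nth_mem by blast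
        moreover have "\<pi> ! j \<in> set \<pi>" if "j \<in> set (snd l)" for j using lk(3)[OF that] by simp
        ultimately have "P \<in> fst ` set \<pi>" using P lk(1) by auto
        then obtain k where "k \<in> set \<pi>" "P = fst k" by blast
        then show ?thesis using DT A by blast
      qed
      show "seq_form P \<in> set (side Z r)" if "P \<in> set (map (look \<pi>) (snd l))" for P
        using that lk by (auto simp: side_def)
    qed
  qed
  have blocks: "rn (concat (map (\<lambda>s. seq_form_intro (side Z (tl s)) (snd Z) (fst (hd s)) (map (look \<pi>) (snd (hd s))))
      (rev (sufs (rev \<pi>))))) [] (map ?g (sufs (rev \<pi>)) @ [])"
    by (rule rn_concat_rev) (rule block)
  have "rn (seq_form_elim Z) st ((seq_form Z # fst Z, snd Z) # st)" for st
    using DT[of "last \<pi>"] ne by (intro rn_seq_form_elim) (auto simp: Z_def)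
  moreover have "subseq (seq_form Z # fst Z, snd Z) (side Z (rev \<pi>), snd Z)"
    using ne by (auto simp: side_def Z_def)
  ultimately have "rn (tree_code \<pi>) [] ((side Z [], snd Z) # [])"
    unfolding tree_code_def Z by (rule rn_append[OF blocks rn_append[OF _ rn_append[OF rn_cw rn_cuts]]])
  moreover have "tree_code \<pi> \<noteq> []" "fst (last (tree_code \<pi>)) = Z"
  proof -
    obtain l where "last (sufs (rev \<pi>)) = [l]" using last_sufs[of "rev \<pi>"] ne by auto
    then show "tree_code \<pi> \<noteq> []" "fst (last (tree_code \<pi>)) = Z"
      using ne unfolding tree_code_def Z by (auto simp: last_map side_def)
  qed
  ultimately show ?thesis using assemble_tree_proof S by (metis Z_def)
qed

lemma polytime_tree_code:
  "polytime enc_deriv enc_deriv (\<lambda>\<pi>. assemble (tree_code \<pi>))"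
  unfolding enc_deriv_eq by (intro pt_polytime pt_comp[OF pt_assemble pt_tree_code])

section \<open>Dag-like proofs from unordered inference instances\<close>

definition DT_lseq :: "lseq \<Rightarrow> bool" where
  "DT_lseq S \<longleftrightarrow> (\<forall>A \<in> set (fst S) \<union> set (snd S). is_DT A)"

definition inst_ok :: "inst \<Rightarrow> bool" where
  "inst_ok i \<longleftrightarrow> valid_inst i \<and> DT_lseq (fst i)"

definition find_lines :: "deriv \<Rightarrow> lseq \<Rightarrow> nat list" where
  "find_lines \<pi> P = map fst (filter (\<lambda>e. fst (snd e) = P) (List.enumerate 0 \<pi>))"

lemma pt_find_lines [pt_intros]: "pt f \<Longrightarrow> pt g \<Longrightarrow> pt (\<lambda>x. find_lines (f x) (g x))"
  by (rule pt_app2[of find_lines]) (unfold find_lines_def, intro pt_intros)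

lemma in_find_lines: "j \<in> set (find_lines \<pi> P) \<longleftrightarrow> j < length \<pi> \<and> fst (\<pi> ! j) = P"
  by (auto simp: find_lines_def in_set_enumerate_eq image_iff)

lemma find_lines_eq_Nil: "find_lines \<pi> P = [] \<longleftrightarrow> P \<notin> fst ` set \<pi>"
proof -
  have "find_lines \<pi> P \<noteq> [] \<longleftrightarrow> (\<exists>j. j \<in> set (find_lines \<pi> P))" by (metis all_not_in_conv set_empty)
  also have "\<dots> \<longleftrightarrow> (\<exists>j < length \<pi>. fst (\<pi> ! j) = P)" by (auto simp: in_find_lines)
  also have "\<dots> \<longleftrightarrow> P \<in> fst ` set \<pi>" unfolding in_set_conv_nth image_iff Bex_def by metis
  finally show ?thesis by blast
qed

lemma hd_find_lines:
  "P \<in> fst ` set \<pi> \<Longrightarrow> hd (find_lines \<pi> P) < length \<pi> \<and> fst (\<pi> ! hd (find_lines \<pi> P)) = P"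
  using find_lines_eq_Nil in_find_lines hd_in_set by blast

text \<open>Premises are looked up as pairs of lists, not of multisets, so instances meant to be
  chained must agree in the order of formulas. An instance with a missing premise changes nothing
  and may fire in a later round.\<close>

definition add_inst :: "deriv \<Rightarrow> inst \<Rightarrow> deriv" where
  "add_inst \<pi> i = (if \<forall>P \<in> set (snd i). find_lines \<pi> P \<noteq> []
     then \<pi> @ [(fst i, map (\<lambda>P. hd (find_lines \<pi> P)) (snd i))] else \<pi>)"

lemma length_add_insts: "length (foldl add_inst [] is) \<le> length is"
  by (induction "is" rule: rev_induct) (auto simp: add_inst_def)

lemma esize_nats:
  assumes "\<forall>j \<in> set js. j \<le> n"
  shows "esize js \<le> length js * Suc n"
  using assms by (induction js) auto

lemma pt_add_insts: "pt (foldl add_inst [])"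
proof (rule pt_foldl[where step = "\<lambda>x. add_inst" and init = "\<lambda>x. []" and xs = "\<lambda>x. x"
      and B = "\<lambda>x. esize x + esize x * Suc (esize x) + 2"])
  show "pt (\<lambda>z :: inst list \<times> deriv \<times> inst. add_inst (fst (snd z)) (snd (snd z)))"
    unfolding add_inst_def by (intro pt_intros)
  show "pbd (\<lambda>x :: inst list. esize x + esize x * Suc (esize x) + 2)" by (intro pbd_intros)
  fix x ys :: "inst list" and i zs assume x: "x = ys @ i # zs"
  let ?s = "foldl add_inst [] ys"
  have i: "esize i < esize x" using x by (intro esize_in_list) simp
  have l: "length ?s \<le> esize x" using length_add_insts[of ys] length_le_esize[of x] x by simp
  show "esize (foldl add_inst [] (ys @ [i])) \<le> esize ?s + (esize x + esize x * Suc (esize x) + 2)"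
  proof (cases "\<forall>P \<in> set (snd i). find_lines ?s P \<noteq> []")
    case True
    have "hd (find_lines ?s P) \<le> esize x" if "P \<in> set (snd i)" for P
      using hd_find_lines[of P ?s] find_lines_eq_Nil[of ?s P] True l that by auto
    then have "esize (map (\<lambda>P. hd (find_lines ?s P)) (snd i)) \<le> length (snd i) * Suc (esize x)"
      using esize_nats[of "map (\<lambda>P. hd (find_lines ?s P)) (snd i)" "esize x"] by simp
    also have "\<dots> \<le> esize x * Suc (esize x)"
      using length_le_esize[of "snd i"] i by (intro mult_le_mono) simp_all
    finally show ?thesis using True i by (simp add: add_inst_def[of ?s] esize_append)
  next
    case False
    then have "add_inst ?s i = ?s" unfolding add_inst_def by (rule if_not_P)
    then show ?thesis by simp
  qed
qed (intro pt_intros)+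

definition dag_inv :: "deriv \<Rightarrow> bool" where
  "dag_inv \<pi> \<longleftrightarrow> (\<forall>i < length \<pi>. (\<forall>j \<in> set (snd (\<pi> ! i)). j < i) \<and> DT_lseq (fst (\<pi> ! i)) \<and>
     ldt_inf (map (\<lambda>j. ms (fst (\<pi> ! j))) (snd (\<pi> ! i))) (ms (fst (\<pi> ! i))))"

lemma dag_inv_add_inst:
  assumes "dag_inv \<pi>" "inst_ok i"
  shows "dag_inv (add_inst \<pi> i)"
proof (cases "\<forall>P \<in> set (snd i). find_lines \<pi> P \<noteq> []")
  case True
  define js where "js = map (\<lambda>P. hd (find_lines \<pi> P)) (snd i)"
  have js: "j < length \<pi>" if "j \<in> set js" for j
  proof -
    obtain P where "P \<in> set (snd i)" "j = hd (find_lines \<pi> P)" using \<open>j \<in> set js\<close> by (auto simp: js_def)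
    then show ?thesis using True hd_find_lines[of P \<pi>] find_lines_eq_Nil[of \<pi> P] by auto
  qed
  have m: "map (\<lambda>j. ms (fst (\<pi> ! j))) js = map ms (snd i)"
    unfolding js_def map_map comp_def
  proof (rule map_cong[OF refl])
    fix P assume "P \<in> set (snd i)"
    then show "ms (fst (\<pi> ! hd (find_lines \<pi> P))) = ms P"
      using True hd_find_lines[of P \<pi>] find_lines_eq_Nil[of \<pi> P] by auto
  qed
  have eq: "add_inst \<pi> i = \<pi> @ [(fst i, js)]" using True by (simp add: add_inst_def js_def)
  have nth: "map (\<lambda>j. ms (fst ((\<pi> @ [(fst i, js)]) ! j))) ks = map (\<lambda>j. ms (fst (\<pi> ! j))) ks"
    if "\<And>k. k \<in> set ks \<Longrightarrow> k < length \<pi>" for ks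
    using that by (simp add: nth_append)
  show ?thesis
    unfolding eq dag_inv_def
  proof (intro allI impI)
    fix k assume "k < length (\<pi> @ [(fst i, js)])"
    then consider "k < length \<pi>" | "k = length \<pi>" by fastforce
    then show "(\<forall>j \<in> set (snd ((\<pi> @ [(fst i, js)]) ! k)). j < k) \<and> DT_lseq (fst ((\<pi> @ [(fst i, js)]) ! k)) \<and>
      ldt_inf (map (\<lambda>j. ms (fst ((\<pi> @ [(fst i, js)]) ! j))) (snd ((\<pi> @ [(fst i, js)]) ! k)))
        (ms (fst ((\<pi> @ [(fst i, js)]) ! k)))"
    proof cases
      case 1
      then have k: "(\<forall>j \<in> set (snd (\<pi> ! k)). j < k) \<and> DT_lseq (fst (\<pi> ! k)) \<and>
          ldt_inf (map (\<lambda>j. ms (fst (\<pi> ! j))) (snd (\<pi> ! k))) (ms (fst (\<pi> ! k)))"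
        using assms(1) unfolding dag_inv_def by blast
      then have "map (\<lambda>j. ms (fst ((\<pi> @ [(fst i, js)]) ! j))) (snd (\<pi> ! k)) =
          map (\<lambda>j. ms (fst (\<pi> ! j))) (snd (\<pi> ! k))" using 1 by (intro nth) auto
      moreover have "(\<pi> @ [(fst i, js)]) ! k = \<pi> ! k" using 1 by (simp add: nth_append)
      ultimately show ?thesis using k by metis
    next
      case 2
      then have "(\<pi> @ [(fst i, js)]) ! k = (fst i, js)" by simp
      moreover have "map (\<lambda>j. ms (fst ((\<pi> @ [(fst i, js)]) ! j))) js = map ms (snd i)"
        unfolding m[symmetric] by (rule nth[OF js])
      ultimately show ?thesis using assms(2) js 2
        by (simp only: snd_conv fst_conv inst_ok_def valid_inst_def) blast
    qed
  qed
next
  case False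
  then show ?thesis using assms by (auto simp: add_inst_def)
qed

lemma dag_inv_add_insts:
  "dag_inv \<pi> \<Longrightarrow> \<forall>i \<in> set is. inst_ok i \<Longrightarrow> dag_inv (foldl add_inst \<pi> is)"
proof (induction "is" arbitrary: \<pi>)
  case (Cons i "is")
  then show ?case using dag_inv_add_inst[of \<pi> i] by simp
qed simp

lemma add_inst_mono: "fst ` set \<pi> \<subseteq> fst ` set (add_inst \<pi> i)"
  by (auto simp: add_inst_def)

lemma add_insts_mono: "fst ` set \<pi> \<subseteq> fst ` set (foldl add_inst \<pi> is)"
proof (induction "is" arbitrary: \<pi>)
  case (Cons i "is")
  show ?case using order_trans[OF add_inst_mono Cons.IH[of "add_inst \<pi> i"]] by simp
qed simp

lemma add_inst_fires: "set (snd i) \<subseteq> fst ` set \<pi> \<Longrightarrow> fst i \<in> fst ` set (add_inst \<pi> i)"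
  by (auto simp: add_inst_def find_lines_eq_Nil)

lemma add_insts_fires:
  assumes "i \<in> set is" "set (snd i) \<subseteq> fst ` set \<pi>"
  shows "fst i \<in> fst ` set (foldl add_inst \<pi> is)"
  using assms
proof (induction "is" arbitrary: \<pi>)
  case (Cons k ks)
  show ?case
  proof (cases "i = k")
    case True
    then show ?thesis
      using add_inst_fires[OF Cons.prems(2)] subsetD[OF add_insts_mono[of "add_inst \<pi> k" ks]] by simp
  next
    case False
    then show ?thesis
      using Cons.IH[of "add_inst \<pi> k"] Cons.prems order_trans[OF Cons.prems(2) add_inst_mono] by simp
  qed
qed simp

lemma add_insts_concl: "fst ` set (foldl add_inst \<pi> is) \<subseteq> fst ` set \<pi> \<union> fst ` set is"
proof (induction "is" arbitrary: \<pi>)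
  case (Cons i "is")
  have "fst ` set (add_inst \<pi> i) \<subseteq> fst ` set \<pi> \<union> {fst i}" by (auto simp: add_inst_def)
  then show ?case using Cons[of "add_inst \<pi> i"] by (simp del: image_subset_iff) blast
qed simp

section \<open>Completeness of repeated rounds over all instances\<close>

inductive der :: "inst set \<Rightarrow> lseq \<Rightarrow> bool" for I where
  derI: "(S, Ps) \<in> I \<Longrightarrow> (\<And>P. P \<in> set Ps \<Longrightarrow> der I P) \<Longrightarrow> der I S"

text \<open>
  Each round either adds a new sequent or leaves a set closed under all instances, so that as many
  rounds as there are instances suffice, whatever their order.
\<close>

lemma rounds_complete:
  fixes I :: "inst list"
  assumes "der (set I) S"
  shows "S \<in> fst ` set (foldl add_inst [] (concat (map (\<lambda>_. I) I)))"
proof -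
  define X where "X = (\<lambda>r. fst ` set (foldl add_inst [] (concat (replicate r I))))"
  have X_Suc: "X (Suc r) = fst ` set (foldl add_inst (foldl add_inst [] (concat (replicate r I))) I)" for r
    by (simp add: X_def replicate_append_same[symmetric])
  have concl: "X r \<subseteq> fst ` set I" for r
  proof -
    have "fst ` set (concat (replicate r I)) \<subseteq> fst ` set I" by (induction r) auto
    then show ?thesis using add_insts_concl[of "[]" "concat (replicate r I)"] by (auto simp: X_def)
  qed
  have closed: "S \<in> X r" if "der (set I) S" "X (Suc r) \<subseteq> X r" for S r
    using that(1)
  proof induction
    case (derI S Ps)
    then have "fst (S, Ps) \<in> X (Suc r)"
      unfolding X_Suc by (intro add_insts_fires) (auto simp: X_def)
    then show ?case using that(2) by auto
  qed
  have "(\<forall>S. der (set I) S \<longrightarrow> S \<in> X r) \<or> r \<le> card (X r)" for r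
  proof (induction r)
    case (Suc r)
    have mono: "X r \<subseteq> X (Suc r)" unfolding X_Suc unfolding X_def by (rule add_insts_mono)
    show ?case
    proof (cases "X (Suc r) \<subseteq> X r")
      case True
      have "S \<in> X (Suc r)" if "der (set I) S" for S
        using closed[OF that True] mono by (rule subsetD[rotated])
      then show ?thesis by simp
    next
      case False
      then have "card (X r) < card (X (Suc r))"
        using mono by (intro psubset_card_mono) (auto simp: X_def simp del: image_subset_iff)
      moreover have "\<forall>S. der (set I) S \<longrightarrow> S \<in> X (Suc r)" if "\<forall>S. der (set I) S \<longrightarrow> S \<in> X r"
        using that mono by blast
      ultimately show ?thesis using Suc by (elim disjE) auto
    qed
  qed simp
  then consider "\<forall>S. der (set I) S \<longrightarrow> S \<in> X (length I)" | "length I \<le> card (X (length I))" by blast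
  then have "S \<in> X (length I)"
  proof cases
    case 2
    \<comment> \<open>There are at most \<open>length I\<close> conclusions, so that many sequents
      exhaust them; and \<open>S\<close> is a conclusion because it is derivable.\<close>
    have "card (fst ` set I) \<le> length I"
      by (rule order_trans[OF card_image_le card_length]) simp
    then have "X (length I) = fst ` set I"
      using 2 by (intro card_seteq concl) auto
    moreover have "S \<in> fst ` set I" using assms by (cases rule: der.cases) (auto intro: rev_image_eqI)
    ultimately show ?thesis by simp
  next
    case 1
    then show ?thesis using assms by blast
  qed
  then show ?thesis by (simp add: X_def map_replicate_const)
qed

text \<open>A cut that derives \<open>S\<close> once more, so that it becomes the last line.\<close>

definition restate :: "lseq \<Rightarrow> inst list" where
  "restate S = [((fst S, Lit (Pos 0) # snd S), [S]), ((Lit (Pos 0) # fst S, snd S), [S]),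
     (S, [(fst S, Lit (Pos 0) # snd S), (Lit (Pos 0) # fst S, snd S)])]"

definition dag_of :: "inst list \<Rightarrow> lseq \<Rightarrow> deriv" where
  "dag_of I S = foldl add_inst [] (concat (map (\<lambda>_. I) I) @ restate S)"

lemma pt_dag_of [pt_intros]: "pt f \<Longrightarrow> pt g \<Longrightarrow> pt (\<lambda>x. dag_of (f x) (g x))"
  by (rule pt_app2[of dag_of]) (unfold dag_of_def restate_def, intro pt_comp[OF pt_add_insts] pt_intros)

lemma last_add_inst: "set (snd i) \<subseteq> fst ` set \<pi> \<Longrightarrow> fst (last (add_inst \<pi> i)) = fst i \<and> add_inst \<pi> i \<noteq> []"
  by (auto simp: add_inst_def find_lines_eq_Nil)

lemma dag_of_proof:
  assumes "\<forall>i \<in> set I. inst_ok i" "der (set I) S" "DT_lseq S"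
  shows "LDT_proof (dag_of I S) (ms S)"
proof -
  define \<pi>0 where "\<pi>0 = foldl add_inst [] (concat (map (\<lambda>_. I) I))"
  define i1 i2 where "i1 = ((fst S, Lit (Pos 0) # snd S), [S])" and "i2 = ((Lit (Pos 0) # fst S, snd S), [S])"
  define i3 where "i3 = (S, [(fst S, Lit (Pos 0) # snd S), (Lit (Pos 0) # fst S, snd S)])"
  define \<pi>1 where "\<pi>1 = add_inst \<pi>0 i1"
  define \<pi>2 where "\<pi>2 = add_inst \<pi>1 i2"
  have eq: "dag_of I S = add_inst \<pi>2 i3"
    by (simp add: dag_of_def restate_def \<pi>0_def \<pi>1_def \<pi>2_def i1_def i2_def i3_def)
  have S: "S \<in> fst ` set \<pi>0" unfolding \<pi>0_def by (rule rounds_complete[OF assms(2)])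
  have S1: "S \<in> fst ` set \<pi>1" "fst i1 \<in> fst ` set \<pi>1"
    using S add_inst_mono[of \<pi>0 i1] add_inst_fires[of i1 \<pi>0] by (auto simp: \<pi>1_def i1_def)
  then have S2: "fst i1 \<in> fst ` set \<pi>2" "fst i2 \<in> fst ` set \<pi>2"
    using add_inst_mono[of \<pi>1 i2] add_inst_fires[of i2 \<pi>1] by (auto simp: \<pi>2_def i2_def)
  then have l: "fst (last (dag_of I S)) = S" "dag_of I S \<noteq> []"
    unfolding eq using last_add_inst[of i3 \<pi>2] by (auto simp: i3_def i1_def i2_def)
  have v: "valid_inst i3"
    unfolding i3_def valid_inst_def using ms_cut[of "fst S" "fst S" "Lit (Pos 0) # snd S" "Lit (Pos 0)" "snd S"]
    by simp
  have DT: "DT_lseq (fst S, Lit (Pos 0) # snd S)" "DT_lseq (Lit (Pos 0) # fst S, snd S)"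
    using assms(3) by (auto simp: DT_lseq_def)
  have "inst_ok i1" "inst_ok i2" "inst_ok i3"
    using v DT assms(3) valid_weak_l[of "Lit (Pos 0)" "fst S" "snd S"] valid_weak_r[of "fst S" "Lit (Pos 0)" "snd S"]
    by (auto simp: inst_ok_def i1_def i2_def i3_def)
  then have "\<forall>i \<in> set (concat (map (\<lambda>_. I) I) @ restate S). inst_ok i"
    using assms(1) by (auto simp: restate_def i1_def i2_def i3_def)
  then have "dag_inv (dag_of I S)"
    unfolding dag_of_def by (intro dag_inv_add_insts) (simp_all add: dag_inv_def)
  moreover have "DT_sequent (line_seq l)" if "DT_lseq (fst l)" for l
    using that by (auto simp: DT_lseq_def DT_sequent_def line_seq_def)
  moreover have "DT_lseq (fst l)" if "l \<in> set (dag_of I S)" for l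
    using \<open>dag_inv (dag_of I S)\<close> \<open>l \<in> set _\<close> unfolding dag_inv_def by (metis in_set_conv_nth)
  ultimately show ?thesis
    using l unfolding LDT_proof_def derives_def dag_inv_def line_seq_eq line_prems_def by simp
qed

section \<open>From tree-like LNDT to LDT\<close>

subsection \<open>Inference instances over a set of succedents\<close>

fun subs :: "form \<Rightarrow> form list" where
  "subs (Lit p) = [Lit p]"
| "subs (Dec A p B) = Dec A p B # subs A @ subs B"
| "subs (Or A B) = Or A B # subs A @ subs B"

lemma pt_subs [pt_intros]: "pt f \<Longrightarrow> pt (\<lambda>x. subs (f x))"
proof (rule pt_rec_form[where h = subs and l = "\<lambda>p. [Lit p]" and K = "\<lambda>Z. esize Z + 1"
      and c = "\<lambda>Z v w. Z # v @ w"])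
  show "pt (\<lambda>z :: form \<times> form list \<times> form list. fst z # fst (snd z) @ snd (snd z))"
    by (intro pt_intros)
  show "pbd (\<lambda>Z :: form. esize Z + 1)" by (intro pbd_intros)
qed (auto intro!: pt_intros simp: esize_append)

lemma subs_refl [simp]: "A \<in> set (subs A)"
  by (cases A) auto

lemma subs_trans: "A \<in> set (subs B) \<Longrightarrow> B \<in> set (subs C) \<Longrightarrow> A \<in> set (subs C)"
  by (induction C) auto

lemma DT_parts: "is_DT A \<Longrightarrow> is_DT (form_left A) \<and> is_DT (form_right A)"
  by (cases A) auto

lemma subs_DT: "is_DT A \<Longrightarrow> B \<in> set (subs A) \<Longrightarrow> is_DT B"
  by (induction A) auto

text \<open>
  \<open>J\<close> is a list of succedents. \<open>goals J\<close> adds to them the succedents extended by a literal,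
  \<open>splits_on J\<close> the antecedents of a case distinction on a literal.
\<close>

definition subforms :: "form list list \<Rightarrow> form list" where
  "subforms J = concat (map subs (concat J))"

definition lits :: "form list list \<Rightarrow> lit list" where
  "lits J = concat (map (\<lambda>Z. [form_lit Z, compl (form_lit Z)]) (subforms J))"

definition goals :: "form list list \<Rightarrow> form list list" where
  "goals J = J @ concat (map (\<lambda>p. map (\<lambda>T. Lit p # T) J) (lits J))"

definition splits_on :: "form list list \<Rightarrow> form list list" where
  "splits_on J = [] # map (\<lambda>p. [Lit p]) (lits J)"

text \<open>Apart from the identity, these introduce and eliminate \<open>Z\<close>, that is
  \<open>ApB\<close>, in either case of \<open>p\<close>. The last one is the elimination when
  \<open>B\<close> is the complement of \<open>p\<close>, a kind of branch that \<open>star\<close>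
  creates.\<close>

definition dec_axioms :: "form \<Rightarrow> lit \<Rightarrow> form \<Rightarrow> form \<Rightarrow> lseq list" where
  "dec_axioms A p B Z = [([Z], [Z]), ([A], [Lit p, Z]), ([Lit p, B], [Z]), ([Z], [A, Lit p]),
     ([Z, Lit p], [B]), ([Z, Lit p], [])]"

definition local_axioms :: "form list list \<Rightarrow> lseq list" where
  "local_axioms J = concat (map (\<lambda>Z. dec_axioms (form_left Z) (form_lit Z) (form_right Z) Z) (subforms J)) @
     concat (map (\<lambda>p. [([Lit p], [Lit p]), ([Lit p, Lit (compl p)], []), ([], [Lit p, Lit (compl p)])]) (lits J))"

text \<open>The guard keeps every generated instance valid: the contractions in \<open>wk\<close>
  presuppose the inclusions.\<close>

definition gw :: "lseq \<Rightarrow> lseq \<Rightarrow> inst list" where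
  "gw S T = (if set (fst S) \<subseteq> set (fst T) \<and> set (snd S) \<subseteq> set (snd T) then wk S T else [])"

definition lit_insts :: "lit \<Rightarrow> inst list" where
  "lit_insts p = [(([Lit p], [Lit p]), []), (([Lit p, Lit (compl p)], []), []),
     (([], [Lit p, Lit (compl p)]), [])]"

definition dec_sources :: "form \<Rightarrow> lit \<Rightarrow> form \<Rightarrow> lseq list" where
  "dec_sources A p B = [([A], [A]), ([B], [B]), ([Lit p], [Lit p]), ([Lit p, Lit (compl p)], [])]"

text \<open>The premises of the first five inferences in \<open>dec_insts\<close>, in the order of
  formulas used there. They are to be obtained by weakening from \<open>dec_sources\<close>; all
  pairs are tried, and \<open>gw\<close> selects the suitable ones.\<close>

definition dec_prems :: "form \<Rightarrow> lit \<Rightarrow> form \<Rightarrow> lseq list" where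
  "dec_prems A p B = [([A], [A, Lit p, Lit p]), ([Lit p, A], [B, Lit p]), ([Lit p, B], [A, Lit p]),
     ([Lit p, Lit p, B], [B]), ([A], [Lit p, A, Lit p]), ([A, Lit p], [Lit p, B]),
     ([Lit p, B, Lit p], [B]), ([A, Lit p], [Lit p]), ([Lit p, B, Lit p], [])]"

text \<open>
  The instance for \<open>Z, p \<rightarrow>\<close> is always valid, but its second premise is only derivable from the
  sources if \<open>B\<close> is the complement of \<open>p\<close>.
\<close>

definition dec_insts :: "form \<Rightarrow> lit \<Rightarrow> form \<Rightarrow> form \<Rightarrow> inst list" where
  "dec_insts A p B Z =
     concat (map (\<lambda>S. concat (map (\<lambda>T. gw S T) (dec_prems A p B))) (dec_sources A p B)) @
     [(([A], [Lit p, Z]), [([A], [A, Lit p, Lit p]), ([Lit p, A], [B, Lit p])]),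
      (([Lit p, B], [Z]), [([Lit p, B], [A, Lit p]), ([Lit p, Lit p, B], [B])]),
      (([Z], [A, Lit p]), [([A], [Lit p, A, Lit p]), ([Lit p, B], [A, Lit p])]),
      (([Z, Lit p], [B]), [([A, Lit p], [Lit p, B]), ([Lit p, B, Lit p], [B])]),
      (([Z, Lit p], []), [([A, Lit p], [Lit p]), ([Lit p, B, Lit p], [])]),
      (([Z], [Z]), [([A], [Lit p, Z]), ([Lit p, B], [Z])])]"

text \<open>Replaces in \<open>\<Pi> \<rightarrow> T1\<close> each formula \<open>u\<close> by \<open>T\<close>, using the sequent \<open>u, E, \<Pi> \<rightarrow> T\<close>.\<close>

definition replace_insts :: "form list \<Rightarrow> form list \<Rightarrow> form list \<Rightarrow> form list \<Rightarrow> inst list" where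
  "replace_insts \<Pi> T1 E T = wk (\<Pi>, T1) (E @ \<Pi>, T1 @ T) @
     concat (map (\<lambda>s. wk (hd s # E @ \<Pi>, T) (hd s # E @ \<Pi>, tl s @ T) @
       [((E @ \<Pi>, tl s @ T), [(E @ \<Pi>, s @ T), (hd s # E @ \<Pi>, tl s @ T)])]) (sufs T1))"

text \<open>Every group ranges over a fixed number of nested lists, each polynomial in the input, so
  the total is polynomial. The first two groups yield the local axioms; the others provide the
  derived rules \<open>D_ax\<close>, \<open>D_replace\<close> and \<open>D_cut\<close>.\<close>

definition insts :: "form list \<Rightarrow> form list list \<Rightarrow> inst list" where
  "insts \<Pi> J =
     concat (map lit_insts (lits J)) @
     concat (map (\<lambda>Z. if form_is_Dec Z then dec_insts (form_left Z) (form_lit Z) (form_right Z) Z else [])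
       (subforms J)) @
     concat (map (\<lambda>a. concat (map (\<lambda>T. gw a (\<Pi>, T) @
       concat (map (\<lambda>u. concat (map (\<lambda>E. gw a (u # E @ \<Pi>, T)) (splits_on J))) (concat (goals J))))
       (goals J))) (local_axioms J)) @
     concat (map (\<lambda>T1. concat (map (\<lambda>E. concat (map (\<lambda>T. replace_insts \<Pi> T1 E T) (goals J)))
       (splits_on J))) (goals J)) @
     concat (map (\<lambda>p. map (\<lambda>T. ((\<Pi>, T), [(\<Pi>, Lit p # T), (Lit p # \<Pi>, T)])) (goals J)) (lits J))"

lemma pt_subforms [pt_intros]: "pt f \<Longrightarrow> pt (\<lambda>x. subforms (f x))"
  unfolding subforms_def by (intro pt_intros)

lemma pt_lits [pt_intros]: "pt f \<Longrightarrow> pt (\<lambda>x. lits (f x))"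
  unfolding lits_def by (intro pt_intros)

lemma pt_goals [pt_intros]: "pt f \<Longrightarrow> pt (\<lambda>x. goals (f x))"
  by (rule pt_comp[of goals]) (unfold goals_def, intro pt_intros)

lemma pt_splits_on [pt_intros]: "pt f \<Longrightarrow> pt (\<lambda>x. splits_on (f x))"
  unfolding splits_on_def by (intro pt_intros)

lemma pt_local_axioms [pt_intros]: "pt f \<Longrightarrow> pt (\<lambda>x. local_axioms (f x))"
  unfolding local_axioms_def dec_axioms_def by (intro pt_intros)

lemma pt_gw [pt_intros]: "pt f \<Longrightarrow> pt g \<Longrightarrow> pt (\<lambda>x. gw (f x) (g x))"
  unfolding gw_def by (intro pt_intros)

lemma pt_lit_insts [pt_intros]: "pt f \<Longrightarrow> pt (\<lambda>x. lit_insts (f x))"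
  unfolding lit_insts_def by (intro pt_intros)

lemma pt_dec_insts [pt_intros]:
  "pt a \<Longrightarrow> pt b \<Longrightarrow> pt c \<Longrightarrow> pt d \<Longrightarrow> pt (\<lambda>x. dec_insts (a x) (b x) (c x) (d x))"
  by (rule pt_app4[of dec_insts]) (unfold dec_insts_def dec_sources_def dec_prems_def, intro pt_intros)

lemma pt_replace_insts [pt_intros]:
  "pt a \<Longrightarrow> pt b \<Longrightarrow> pt c \<Longrightarrow> pt d \<Longrightarrow> pt (\<lambda>x. replace_insts (a x) (b x) (c x) (d x))"
  by (rule pt_app4[of replace_insts]) (unfold replace_insts_def, intro pt_intros)

lemma pt_insts [pt_intros]: "pt f \<Longrightarrow> pt g \<Longrightarrow> pt (\<lambda>x. insts (f x) (g x))"
  by (rule pt_app2[of insts]) (unfold insts_def, intro pt_intros)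

section \<open>Validity of the generated instances\<close>

lemma sufs_subset: "s \<in> set (sufs xs) \<Longrightarrow> set s \<subseteq> set xs \<and> set (tl s) \<subseteq> set xs"
  by (cases "s = []") (auto simp: sufs_iff dest: list.set_sel(2))

lemma chain_valid: "chain S is T \<Longrightarrow> i \<in> set is \<Longrightarrow> valid_inst i"
  by (induction "is" arbitrary: S) auto

lemma wk_forms:
  assumes "i \<in> set (wk S T)"
  shows "set (fst (fst i)) \<subseteq> set (fst S) \<union> set (fst T)" "set (snd (fst i)) \<subseteq> set (snd S) \<union> set (snd T)"
  using assms sufs_subset by (fastforce simp: wk_def)+

lemma inst_ok_wk:
  assumes "subseq S T" "DT_lseq S" "DT_lseq T" "i \<in> set (wk S T)"
  shows "inst_ok i"
  using chain_valid[OF chain_wk[OF assms(1)] assms(4)] wk_forms[OF assms(4)] assms(2,3)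
  unfolding inst_ok_def DT_lseq_def by blast

lemma inst_ok_gw: "DT_lseq S \<Longrightarrow> DT_lseq T \<Longrightarrow> i \<in> set (gw S T) \<Longrightarrow> inst_ok i"
  by (auto simp: gw_def subseq_def split: if_splits intro: inst_ok_wk)

lemma DT_lseq_simp [simp]: "DT_lseq (G, D) \<longleftrightarrow> (\<forall>A \<in> set G \<union> set D. is_DT A)"
  by (simp add: DT_lseq_def)

lemma inst_ok_lit_insts: "i \<in> set (lit_insts p) \<Longrightarrow> inst_ok i"
  using init_id[of p] init_l[of p] init_r[of p]
  by (auto simp: lit_insts_def inst_ok_def valid_inst_def ms_def)

lemma inst_ok_dec_insts:
  assumes Z: "Z = Dec A p B" "is_DT Z" and i: "i \<in> set (dec_insts A p B Z)"
  shows "inst_ok i"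
proof -
  have DT: "is_DT A" "is_DT B" using Z by auto
  have 1: "valid_inst (([A], [Lit p, Z]), [([A], [A, Lit p, Lit p]), ([Lit p, A], [B, Lit p])])"
    unfolding valid_inst_def Z fst_conv snd_conv list.map
    by (rule ms_dec_r[where G = "[A]" and D = "[Lit p]"]) auto
  have 2: "valid_inst (([Lit p, B], [Z]), [([Lit p, B], [A, Lit p]), ([Lit p, Lit p, B], [B])])"
    unfolding valid_inst_def Z fst_conv snd_conv list.map
    by (rule ms_dec_r[where G = "[Lit p, B]" and D = "[]"]) auto
  have 3: "valid_inst (([Z], [A, Lit p]), [([A], [Lit p, A, Lit p]), ([Lit p, B], [A, Lit p])])"
    unfolding valid_inst_def Z fst_conv snd_conv list.map
    by (rule ms_dec_l[where G = "[]" and D = "[A, Lit p]"]) auto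
  have 4: "valid_inst (([Z, Lit p], [B]), [([A, Lit p], [Lit p, B]), ([Lit p, B, Lit p], [B])])"
    unfolding valid_inst_def Z fst_conv snd_conv list.map
    by (rule ms_dec_l[where G = "[Lit p]" and D = "[B]"]) auto
  have 5: "valid_inst (([Z, Lit p], []), [([A, Lit p], [Lit p]), ([Lit p, B, Lit p], [])])"
    unfolding valid_inst_def Z fst_conv snd_conv list.map
    by (rule ms_dec_l[where G = "[Lit p]" and D = "[]"]) auto
  have 6: "valid_inst (([Z], [Z]), [([A], [Lit p, Z]), ([Lit p, B], [Z])])"
    unfolding valid_inst_def Z fst_conv snd_conv list.map
    by (rule ms_dec_l[where G = "[]" and D = "[Dec A p B]"]) auto
  have g: "inst_ok i" if "S \<in> set (dec_sources A p B)" "T \<in> set (dec_prems A p B)" "i \<in> set (gw S T)" for S T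
  proof (rule inst_ok_gw[OF _ _ that(3)])
    show "DT_lseq S" using that(1) DT by (auto simp: dec_sources_def)
    show "DT_lseq T" using that(2) DT by (auto simp: dec_prems_def)
  qed
  then show ?thesis
    using i 1 2 3 4 5 6 DT Z(2) unfolding dec_insts_def inst_ok_def
    by (simp only: set_append set_concat set_map Un_iff) auto
qed

lemma der_chain: "chain S is T \<Longrightarrow> set is \<subseteq> I \<Longrightarrow> der I S \<Longrightarrow> der I T"
proof (induction "is" arbitrary: S)
  case (Cons i "is")
  then have "snd i = [S]" "i \<in> I" by auto
  then have "(fst i, [S]) \<in> I" by (metis prod.collapse)
  then have "der I (fst i)" using Cons.prems(3) by (intro derI[of "fst i" "[S]"]) simp_all
  then show ?case using Cons.IH[of "fst i"] Cons.prems by simp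
qed simp

lemma der_gw:
  assumes "der I S" "subseq S T" "set (gw S T) \<subseteq> I"
  shows "der I T"
  using der_chain[OF chain_wk[OF assms(2)] _ assms(1)] assms(2,3) by (auto simp: gw_def subseq_def)

locale succedents =
  fixes \<Pi> :: "form list" and J :: "form list list"
  assumes DT_\<Pi>: "\<And>A. A \<in> set \<Pi> \<Longrightarrow> is_DT A"
    and DT_J: "\<And>T A. T \<in> set J \<Longrightarrow> A \<in> set T \<Longrightarrow> is_DT A"
begin

abbreviation "D \<equiv> der (set (insts \<Pi> J))"

lemma subforms_DT: "Z \<in> set (subforms J) \<Longrightarrow> is_DT Z"
  using DT_J subs_DT by (fastforce simp: subforms_def)

lemma subforms_closed:
  assumes "Dec A p B \<in> set (subforms J)"
  shows "A \<in> set (subforms J)" "B \<in> set (subforms J)" "p \<in> set (lits J)"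
proof -
  obtain T C where T: "T \<in> set J" "C \<in> set T" "Dec A p B \<in> set (subs C)"
    using assms by (auto simp: subforms_def)
  have "A \<in> set (subs (Dec A p B))" "B \<in> set (subs (Dec A p B))" by simp_all
  then have "A \<in> set (subs C)" "B \<in> set (subs C)" using T(3) subs_trans by blast+
  then show "A \<in> set (subforms J)" "B \<in> set (subforms J)" using T unfolding subforms_def by auto
  show "p \<in> set (lits J)" using assms unfolding lits_def by (auto intro!: bexI[of _ "Dec A p B"])
qed

lemma in_subforms: "T \<in> set J \<Longrightarrow> A \<in> set T \<Longrightarrow> A \<in> set (subforms J)"
  unfolding subforms_def by (auto intro: subs_refl)

lemma Lit_subforms: "Lit p \<in> set (subforms J) \<Longrightarrow> p \<in> set (lits J)"
  unfolding lits_def by (auto intro!: bexI[of _ "Lit p"])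

lemma goals_forms:
  assumes "T \<in> set (goals J)" "u \<in> set T"
  shows "u \<in> set (subforms J) \<or> (\<exists>p \<in> set (lits J). u = Lit p)"
  using assms in_subforms by (auto simp: goals_def)

lemma goals_DT: "T \<in> set (goals J) \<Longrightarrow> u \<in> set T \<Longrightarrow> is_DT u"
  using goals_forms subforms_DT by fastforce

lemma splits_on_DT: "E \<in> set (splits_on J) \<Longrightarrow> u \<in> set E \<Longrightarrow> is_DT u"
  by (auto simp: splits_on_def)

lemma local_axioms_DT:
  assumes "a \<in> set (local_axioms J)" shows "DT_lseq a"
proof -
  have "DT_lseq a" if "Z \<in> set (subforms J)" "a \<in> set (dec_axioms (form_left Z) (form_lit Z) (form_right Z) Z)" for Z
    using that subforms_DT[OF that(1)] DT_parts[of Z] by (auto simp: dec_axioms_def)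
  then show ?thesis using assms by (auto simp: local_axioms_def)
qed

lemma inst_ok_replace_insts:
  assumes "\<And>A. A \<in> set (T1 @ E @ T) \<Longrightarrow> is_DT A" "i \<in> set (replace_insts \<Pi> T1 E T)"
  shows "inst_ok i"
proof -
  consider "i \<in> set (wk (\<Pi>, T1) (E @ \<Pi>, T1 @ T))"
    | s where "s \<in> set (sufs T1)" "i \<in> set (wk (hd s # E @ \<Pi>, T) (hd s # E @ \<Pi>, tl s @ T))"
    | s where "s \<in> set (sufs T1)" "i = ((E @ \<Pi>, tl s @ T), [(E @ \<Pi>, s @ T), (hd s # E @ \<Pi>, tl s @ T)])"
    using assms(2) unfolding replace_insts_def by auto
  then show ?thesis
  proof cases
    case 1
    then show ?thesis using assms(1) DT_\<Pi> by (intro inst_ok_wk[OF _ _ _ 1]) auto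
  next
    case (2 s)
    then have "set (tl s) \<subseteq> set T1" "hd s \<in> set T1"
      using sufs_subset[OF 2(1)] hd_in_set[of s] by (auto simp: sufs_iff)
    then show ?thesis using assms(1) DT_\<Pi> by (intro inst_ok_wk[OF _ _ _ 2(2)]) auto
  next
    case (3 s)
    then obtain v r where s: "s = v # r" by (auto simp: sufs_iff neq_Nil_conv)
    have "ldt_inf [ms (E @ \<Pi>, s @ T), ms (hd s # E @ \<Pi>, tl s @ T)] (ms (E @ \<Pi>, tl s @ T))"
      by (rule ms_cut[where A = v]) (auto simp: s)
    then show ?thesis using sufs_subset[OF 3(1)] assms(1) DT_\<Pi> 3(2)
      by (auto simp: inst_ok_def valid_inst_def)
  qed
qed

lemma insts_ok:
  assumes "i \<in> set (insts \<Pi> J)" shows "inst_ok i"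
proof -
  consider p where "i \<in> set (lit_insts p)"
    | Z where "Z \<in> set (subforms J)" "form_is_Dec Z" "i \<in> set (dec_insts (form_left Z) (form_lit Z) (form_right Z) Z)"
    | a T where "a \<in> set (local_axioms J)" "T \<in> set (goals J)" "i \<in> set (gw a (\<Pi>, T))"
    | a T T1 u E where "a \<in> set (local_axioms J)" "T \<in> set (goals J)" "T1 \<in> set (goals J)" "u \<in> set T1"
        "E \<in> set (splits_on J)" "i \<in> set (gw a (u # E @ \<Pi>, T))"
    | T1 E T where "T1 \<in> set (goals J)" "T \<in> set (goals J)" "E \<in> set (splits_on J)"
        "i \<in> set (replace_insts \<Pi> T1 E T)"
    | p T where "T \<in> set (goals J)" "i = ((\<Pi>, T), [(\<Pi>, Lit p # T), (Lit p # \<Pi>, T)])"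
    using assms unfolding insts_def
    by (simp only: set_append set_concat set_map Un_iff Union_iff image_iff Bex_def) (auto split: if_splits)
  then show ?thesis
  proof cases
    case (1 p)
    then show ?thesis by (rule inst_ok_lit_insts)
  next
    case (2 Z)
    have "Z = Dec (form_left Z) (form_lit Z) (form_right Z)" using 2(2) by (cases Z) auto
    then show ?thesis using inst_ok_dec_insts 2 subforms_DT by blast
  next
    case (3 a T)
    show ?thesis
      by (rule inst_ok_gw[OF _ _ 3(3)]) (use local_axioms_DT 3 goals_DT DT_\<Pi> in auto)
  next
    case (4 a T T1 u E)
    show ?thesis
      by (rule inst_ok_gw[OF _ _ 4(6)]) (use local_axioms_DT 4 goals_DT splits_on_DT DT_\<Pi> in auto)
  next
    case (5 T1 E T)
    show ?thesis
      by (rule inst_ok_replace_insts[OF _ 5(4)]) (use 5 goals_DT splits_on_DT in auto)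
  next
    case (6 p T)
    have "ldt_inf [ms (\<Pi>, Lit p # T), ms (Lit p # \<Pi>, T)] (ms (\<Pi>, T))"
      by (rule ms_cut[where A = "Lit p"]) auto
    then show ?thesis using 6 DT_\<Pi> goals_DT by (auto simp: inst_ok_def valid_inst_def)
  qed
qed

section \<open>Derived rules available through the generated instances\<close>

definition ax :: "lseq \<Rightarrow> bool" where
  "ax a \<longleftrightarrow> a \<in> set (local_axioms J) \<and> D a"

lemma ax_lits:
  assumes "p \<in> set (lits J)"
  shows "ax ([Lit p], [Lit p])" "ax ([Lit p, Lit (compl p)], [])" "ax ([], [Lit p, Lit (compl p)])"
proof -
  have "set (lit_insts p) \<subseteq> set (insts \<Pi> J)" using assms unfolding insts_def by auto
  then have "D ([Lit p], [Lit p])" "D ([Lit p, Lit (compl p)], [])" "D ([], [Lit p, Lit (compl p)])"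
    by (auto simp: lit_insts_def intro: derI[where Ps = "[]"])
  then show "ax ([Lit p], [Lit p])" "ax ([Lit p, Lit (compl p)], [])" "ax ([], [Lit p, Lit (compl p)])"
    using assms unfolding ax_def local_axioms_def by auto
qed

lemma D_dec:
  assumes Z: "Z = Dec A p B" "Z \<in> set (subforms J)" and A: "D ([A], [A])" and B: "D ([B], [B])"
  shows "D ([Z], [Z])" "D ([A], [Lit p, Z])" "D ([Lit p, B], [Z])" "D ([Z], [A, Lit p])"
    "D ([Z, Lit p], [B])" "B = Lit (compl p) \<Longrightarrow> D ([Z, Lit p], [])"
proof -
  have sub: "set (dec_insts A p B Z) \<subseteq> set (insts \<Pi> J)"
    using Z unfolding insts_def by (auto intro!: bexI[of _ Z])
  have p: "D ([Lit p], [Lit p])" "D ([Lit p, Lit (compl p)], [])"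
    using ax_lits subforms_closed(3) Z unfolding ax_def by auto
  have prem: "D T" if "S \<in> set (dec_sources A p B)" "T \<in> set (dec_prems A p B)" "subseq S T" "D S" for S T
  proof (rule der_gw[OF that(4,3)])
    show "set (gw S T) \<subseteq> set (insts \<Pi> J)"
      using that sub unfolding dec_insts_def by fastforce
  qed
  have fire: "D S" if "(S, [P, Q]) \<in> set (dec_insts A p B Z)" "D P" "D Q" for S P Q
    using that sub by (intro derI[of S "[P, Q]"]) auto
  note defs = dec_sources_def dec_prems_def
  have a: "D ([A], [A, Lit p, Lit p])" "D ([A], [Lit p, A, Lit p])"
    by (rule prem[OF _ _ _ A]; simp add: defs)+
  have b: "D ([Lit p, Lit p, B], [B])" "D ([Lit p, B, Lit p], [B])"
    by (rule prem[OF _ _ _ B]; simp add: defs)+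
  have c: "D ([Lit p, A], [B, Lit p])" "D ([Lit p, B], [A, Lit p])" "D ([A, Lit p], [Lit p, B])"
      "D ([A, Lit p], [Lit p])"
    by (rule prem[OF _ _ _ p(1)]; simp add: defs)+
  show 2: "D ([A], [Lit p, Z])"
    by (rule fire[OF _ a(1) c(1)]) (simp add: dec_insts_def)
  show 3: "D ([Lit p, B], [Z])"
    by (rule fire[OF _ c(2) b(1)]) (simp add: dec_insts_def)
  show "D ([Z], [Z])"
    by (rule fire[OF _ 2 3]) (simp add: dec_insts_def)
  show "D ([Z], [A, Lit p])"
    by (rule fire[OF _ a(2) c(2)]) (simp add: dec_insts_def)
  show "D ([Z, Lit p], [B])"
    by (rule fire[OF _ c(3) b(2)]) (simp add: dec_insts_def)
  show "D ([Z, Lit p], [])" if "B = Lit (compl p)"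
  proof (rule fire[OF _ c(4)])
    show "D ([Lit p, B, Lit p], [])"
      by (rule prem[OF _ _ _ p(2)]) (simp_all add: defs that)
  qed (simp add: dec_insts_def)
qed

text \<open>Identities of decision formulas are not initial sequents; they are built up from the
  leaves, and \<open>subforms J\<close> contains every formula met on the way.\<close>

lemma D_id: "Z \<in> set (subforms J) \<Longrightarrow> D ([Z], [Z])"
proof (induction Z)
  case (Lit p)
  then show ?case using ax_lits(1) Lit_subforms unfolding ax_def by blast
next
  case (Dec A p B)
  then show ?case using D_dec(1)[OF refl Dec.prems] subforms_closed[OF Dec.prems] by blast
next
  case (Or A B)
  then show ?case using subforms_DT[OF Or.prems] by simp
qed

lemma dec_axioms_subset:
  "Z = Dec A p B \<Longrightarrow> Z \<in> set (subforms J) \<Longrightarrow> set (dec_axioms A p B Z) \<subseteq> set (local_axioms J)"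
  unfolding local_axioms_def by (auto intro!: bexI[of _ Z])

lemma ax_dec:
  assumes Z: "Dec A p B \<in> set (subforms J)"
  shows "ax ([A], [Lit p, Dec A p B])" "ax ([Lit p, B], [Dec A p B])" "ax ([Dec A p B], [A, Lit p])"
    "ax ([Dec A p B, Lit p], [B])" "B = Lit (compl p) \<Longrightarrow> ax ([Dec A p B, Lit p], [])"
  using D_dec[OF refl Z D_id D_id] subforms_closed[OF Z] dec_axioms_subset[OF refl Z]
  unfolding ax_def dec_axioms_def by auto

lemma ax_id: "T \<in> set (goals J) \<Longrightarrow> u \<in> set T \<Longrightarrow> ax ([u], [u])"
proof -
  assume "T \<in> set (goals J)" "u \<in> set T"
  then consider "u \<in> set (subforms J)" | p where "p \<in> set (lits J)" "u = Lit p" using goals_forms by blast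
  then show ?thesis
  proof cases
    case 1
    then have "([u], [u]) \<in> set (local_axioms J)"
      unfolding local_axioms_def dec_axioms_def by auto
    then show ?thesis using D_id[OF 1] by (simp add: ax_def)
  next
    case 2
    then show ?thesis using ax_lits by simp
  qed
qed

lemma D_ax:
  assumes "ax a" "subseq a (\<Pi>, T)" "T \<in> set (goals J)"
  shows "D (\<Pi>, T)"
proof (rule der_gw[OF _ assms(2)])
  show "D a" using assms(1) by (simp add: ax_def)
  show "set (gw a (\<Pi>, T)) \<subseteq> set (insts \<Pi> J)"
    using assms unfolding insts_def ax_def by fastforce
qed

lemma D_cut:
  assumes "p \<in> set (lits J)" "T \<in> set (goals J)" "D (\<Pi>, Lit p # T)" "D (Lit p # \<Pi>, T)"
  shows "D (\<Pi>, T)"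
  by (rule derI[where Ps = "[(\<Pi>, Lit p # T), (Lit p # \<Pi>, T)]"])
    (use assms in \<open>auto simp: insts_def\<close>)

lemma in_concat_map: "x \<in> set xs \<Longrightarrow> i \<in> set (f x) \<Longrightarrow> i \<in> set (concat (map f xs))"
  by auto

lemma gw_insts:
  assumes "a \<in> set (local_axioms J)" "T \<in> set (goals J)" "u \<in> set (concat (goals J))"
    "E \<in> set (splits_on J)"
  shows "set (gw a (u # E @ \<Pi>, T)) \<subseteq> set (insts \<Pi> J)"
proof
  fix i assume "i \<in> set (gw a (u # E @ \<Pi>, T))"
  then have "i \<in> set (concat (map (\<lambda>E. gw a (u # E @ \<Pi>, T)) (splits_on J)))"
    by (rule in_concat_map[OF assms(4)])
  then have "i \<in> set (concat (map (\<lambda>u. concat (map (\<lambda>E. gw a (u # E @ \<Pi>, T)) (splits_on J)))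
      (concat (goals J))))"
    by (rule in_concat_map[OF assms(3)])
  then have "i \<in> set (gw a (\<Pi>, T) @ concat (map (\<lambda>u. concat (map (\<lambda>E. gw a (u # E @ \<Pi>, T))
      (splits_on J))) (concat (goals J))))"
    unfolding set_append by (rule UnI2)
  then have "i \<in> set (concat (map (\<lambda>T. gw a (\<Pi>, T) @ concat (map (\<lambda>u. concat (map
      (\<lambda>E. gw a (u # E @ \<Pi>, T)) (splits_on J))) (concat (goals J)))) (goals J)))"
    by (rule in_concat_map[OF assms(2)])
  then have mem: "i \<in> set (concat (map (\<lambda>a. concat (map (\<lambda>T. gw a (\<Pi>, T) @ concat (map (\<lambda>u. concat (map
      (\<lambda>E. gw a (u # E @ \<Pi>, T)) (splits_on J))) (concat (goals J)))) (goals J))) (local_axioms J)))"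
    by (rule in_concat_map[OF assms(1)])
  show "i \<in> set (insts \<Pi> J)"
    unfolding insts_def set_append by (rule UnI2, rule UnI2, rule UnI1, rule mem)
qed

text \<open>A succedent acts as a disjunction, so \<open>T1\<close> entails \<open>T\<close> as soon
  as each member does. One cut removes each member, and a local axiom about that single member
  suffices for it.\<close>

lemma D_replace:
  assumes T: "T1 \<in> set (goals J)" "T \<in> set (goals J)" "E \<in> set (splits_on J)" and D1: "D (\<Pi>, T1)"
    and u: "\<And>u. u \<in> set T1 \<Longrightarrow> \<exists>a. ax a \<and> subseq a (u # E @ \<Pi>, T)"
  shows "D (E @ \<Pi>, T)"
proof -
  have sub: "set (replace_insts \<Pi> T1 E T) \<subseteq> set (insts \<Pi> J)"
    using T unfolding insts_def by auto
  have "D (E @ \<Pi>, T1 @ T)"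
    by (rule der_chain[OF chain_wk _ D1]) (use sub in \<open>auto simp: replace_insts_def\<close>)
  moreover have "D (u # E @ \<Pi>, T)" if "u \<in> set T1" for u
  proof -
    obtain a where a: "ax a" "subseq a (u # E @ \<Pi>, T)" using u \<open>u \<in> set T1\<close> by blast
    have "u \<in> set (concat (goals J))" using that T(1) by (simp only: set_concat) blast
    then show ?thesis using der_gw[OF _ a(2) gw_insts[OF _ T(2) _ T(3)]] a(1) by (simp add: ax_def)
  qed
  \<comment> \<open>Here \<open>s\<close> is the part of \<open>T1\<close> not yet cut away. It is
    always a suffix of \<open>T1\<close>, for which instances were generated.\<close>
  moreover have "D (E @ \<Pi>, s @ T) \<Longrightarrow> (\<And>u. u \<in> set s \<Longrightarrow> D (u # E @ \<Pi>, T)) \<Longrightarrow>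
      set (sufs s) \<subseteq> set (sufs T1) \<Longrightarrow> D (E @ \<Pi>, T)" for s
  proof (induction s)
    case (Cons v s)
    have "v # s \<in> set (sufs T1)" using Cons.prems(3) by simp
    then have "set (wk (hd (v # s) # E @ \<Pi>, T) (hd (v # s) # E @ \<Pi>, tl (v # s) @ T) @
        [((E @ \<Pi>, tl (v # s) @ T), [(E @ \<Pi>, (v # s) @ T), (hd (v # s) # E @ \<Pi>, tl (v # s) @ T)])])
        \<subseteq> set (replace_insts \<Pi> T1 E T)"
      unfolding replace_insts_def by (auto simp del: list.sel)
    then have mem: "set (wk (v # E @ \<Pi>, T) (v # E @ \<Pi>, s @ T)) \<subseteq> set (insts \<Pi> J)"
      "((E @ \<Pi>, s @ T), [(E @ \<Pi>, (v # s) @ T), (v # E @ \<Pi>, s @ T)]) \<in> set (insts \<Pi> J)"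
      using sub by auto
    have "D (v # E @ \<Pi>, s @ T)"
      by (rule der_chain[OF chain_wk mem(1)]) (use Cons.prems(2) in auto)
    then have "D (E @ \<Pi>, s @ T)" using Cons.prems(1) by (intro derI[OF mem(2)]) auto
    then show ?case using Cons by simp
  qed simp
  ultimately show ?thesis by blast
qed

lemma D_replace_plain:
  assumes "T1 \<in> set (goals J)" "T \<in> set (goals J)" "D (\<Pi>, T1)"
    and u: "\<And>u. u \<in> set T1 \<Longrightarrow> u \<in> set T \<or> (\<exists>a. ax a \<and> subseq a ([u], T))"
  shows "D (\<Pi>, T)"
proof -
  have "D ([] @ \<Pi>, T)"
  proof (rule D_replace[OF assms(1,2) _ assms(3)])
    fix u assume *: "u \<in> set T1"
    then consider "u \<in> set T" | a where "ax a" "subseq a ([u], T)" using u by blast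
    then show "\<exists>a. ax a \<and> subseq a (u # [] @ \<Pi>, T)"
    proof cases
      case 1
      then show ?thesis using ax_id[OF assms(1) *] by (intro exI[of _ "([u], [u])"]) auto
    next
      case (2 a)
      then show ?thesis unfolding subseq_def by (intro exI[of _ a]) auto
    qed
  qed (simp add: splits_on_def)
  then show ?thesis by simp
qed

lemma D_weak:
  "D (\<Pi>, T1) \<Longrightarrow> set T1 \<subseteq> set T \<Longrightarrow> T1 \<in> set (goals J) \<Longrightarrow> T \<in> set (goals J) \<Longrightarrow> D (\<Pi>, T)"
  by (rule D_replace_plain) auto

text \<open>A case distinction by a cut on \<open>p\<close>. The given sequent with
  \<open>Lit p # T\<close> settles the case of \<open>p\<close> false; in the other case the local
  axioms may use \<open>p\<close> in the antecedent.\<close>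

lemma D_replace_lit:
  assumes "T1 \<in> set (goals J)" "T \<in> set (goals J)" "D (\<Pi>, T1)"
    and p: "p \<in> set (lits J)" "D (\<Pi>, Lit p # T)"
    and u: "\<And>u. u \<in> set T1 \<Longrightarrow> u \<in> set T \<or> (\<exists>a. ax a \<and> subseq a ([u, Lit p], T))"
  shows "D (\<Pi>, T)"
proof (rule D_cut[OF p(1) assms(2) p(2)])
  have "D ([Lit p] @ \<Pi>, T)"
  proof (rule D_replace[OF assms(1,2) _ assms(3)])
    fix u assume *: "u \<in> set T1"
    then consider "u \<in> set T" | a where "ax a" "subseq a ([u, Lit p], T)" using u by blast
    then show "\<exists>a. ax a \<and> subseq a (u # [Lit p] @ \<Pi>, T)"
    proof cases
      case 1
      then show ?thesis using ax_id[OF assms(1) *] by (intro exI[of _ "([u], [u])"]) auto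
    next
      case (2 a)
      then show ?thesis unfolding subseq_def by (intro exI[of _ a]) auto
    qed
  qed (use p(1) in \<open>simp add: splits_on_def\<close>)
  then show "D (Lit p # \<Pi>, T)" by simp
qed

end

subsection \<open>Splitting NDT formulas into DT formulas\<close>

text \<open>
  \<open>star A\<close> lists DT formulas whose disjunction is equivalent to \<open>A\<close>. A decision formula over
  nontrivial disjunctions is split by means of \<open>X p p'\<close> (that is, \<open>X\<close> and not \<open>p\<close>, where \<open>p'\<close> is the
  complement of \<open>p\<close>) and \<open>p p Y\<close> (that is, \<open>p\<close> and \<open>Y\<close>).
\<close>

definition split_Dec :: "lit \<Rightarrow> form list \<Rightarrow> form list \<Rightarrow> form list" where
  "split_Dec p xs ys = (if length xs = Suc 0 \<and> length ys = Suc 0 then [Dec (hd xs) p (hd ys)]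
     else map (\<lambda>X. Dec X p (Lit (compl p))) xs @ map (\<lambda>Y. Dec (Lit p) p Y) ys)"

fun star :: "form \<Rightarrow> form list" where
  "star (Lit p) = [Lit p]"
| "star (Dec A p B) = split_Dec p (star A) (star B)"
| "star (Or A B) = star A @ star B"

lemma star_nonempty: "star A \<noteq> []"
  by (induction A) (auto simp: split_Dec_def)

text \<open>This is the purpose of the singleton case in \<open>split_Dec\<close>: the final sequent
  is translated into itself.\<close>

lemma star_DT: "is_DT A \<Longrightarrow> star A = [A]"
  by (induction A) (auto simp: split_Dec_def)

lemma length_1_iff: "length xs = Suc 0 \<longleftrightarrow> (\<exists>x. xs = [x])"
  by (cases xs) auto

lemma star_is_DT: "Z \<in> set (star A) \<Longrightarrow> is_DT Z"
  by (induction A arbitrary: Z) (auto simp: split_Dec_def length_1_iff split: if_splits)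

text \<open>Both cases of \<open>split_Dec\<close> get a common form. The dummy branches
  \<open>p\<close> on the left and its complement on the right are false whenever they are
  selected.\<close>

lemma star_Dec_cases:
  assumes "Z \<in> set (star (Dec A p B))"
  obtains X Y where "Z = Dec X p Y" "X \<in> set (star A) \<or> X = Lit p"
    "Y \<in> set (star B) \<or> Y = Lit (compl p)"
  using assms by (auto simp: split_Dec_def length_1_iff split: if_splits)

lemma star_Dec_left: "X \<in> set (star A) \<Longrightarrow> \<exists>Y. Dec X p Y \<in> set (star (Dec A p B))"
  by (auto simp: split_Dec_def length_1_iff)

lemma star_Dec_right: "Y \<in> set (star B) \<Longrightarrow> \<exists>X. Dec X p Y \<in> set (star (Dec A p B))"
  by (auto simp: split_Dec_def length_1_iff)

text \<open>The lists of the two branches are added and never combined pairwise. This is what the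
  dummy branches achieve; combining every \<open>X\<close> with every \<open>Y\<close> would
  multiply the lengths.\<close>

lemma length_star: "length (star A) \<le> esize A"
  by (induction A) (auto simp: split_Dec_def)

lemma esize_map_le: "(\<And>x. x \<in> set xs \<Longrightarrow> esize (f x) \<le> esize x + k) \<Longrightarrow>
    esize (map f xs) \<le> esize xs + length xs * k"
proof (induction xs)
  case (Cons x xs)
  then show ?case using Cons.prems[of x] by fastforce
qed simp

lemma pt_star [pt_intros]:
  assumes "pt f" shows "pt (\<lambda>x. star (f x))"
\<comment> \<open>In a proper split at most \<open>esize Z\<close> members are wrapped, and each
  grows by at most \<open>2 * esize Z + 10\<close>; hence the overhead \<open>K\<close>.\<close>
proof (rule pt_rec_form[where h = star and l = "\<lambda>p. [Lit p]"
      and K = "\<lambda>Z. esize Z * (2 * esize Z + 10) + 10"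
      and c = "\<lambda>Z v w. if form_is_Dec Z then split_Dec (form_lit Z) v w else v @ w"])
  show "pt (\<lambda>z :: form \<times> form list \<times> form list. if form_is_Dec (fst z)
      then split_Dec (form_lit (fst z)) (fst (snd z)) (snd (snd z)) else fst (snd z) @ snd (snd z))"
    unfolding split_Dec_def by (intro pt_intros)
  show "pbd (\<lambda>Z :: form. esize Z * (2 * esize Z + 10) + 10)" by (intro pbd_intros)
  fix A p B
  let ?Z = "Dec A p B"
  show "esize (star ?Z) \<le> esize (star A) + esize (star B) + (esize ?Z * (2 * esize ?Z + 10) + 10)"
  proof (cases "length (star A) = Suc 0 \<and> length (star B) = Suc 0")
    case True
    then obtain X Y where XY: "star A = [X]" "star B = [Y]" unfolding length_1_iff by blast
    have "esize p \<le> esize ?Z * 1" by simp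
    also have "\<dots> \<le> esize ?Z * (2 * esize ?Z + 10)" by (rule mult_le_mono2) simp
    finally show ?thesis
      unfolding star.simps XY split_Dec_def by (simp add: true_bt_def del: mult_Suc mult_Suc_right)
  next
    case False
    have c: "esize (compl p) \<le> Suc (esize p)" by (cases p) (auto simp: true_bt_def)
    have "esize (map (\<lambda>X. Dec X p (Lit (compl p))) (star A)) \<le>
        esize (star A) + length (star A) * (2 * esize ?Z + 10)"
      using c by (intro esize_map_le) (simp add: true_bt_def)
    moreover have "esize (map (\<lambda>Y. Dec (Lit p) p Y) (star B)) \<le>
        esize (star B) + length (star B) * (2 * esize ?Z + 10)"
      by (intro esize_map_le) (simp add: true_bt_def)
    moreover have "(length (star A) + length (star B)) * (2 * esize ?Z + 10) \<le> esize ?Z * (2 * esize ?Z + 10)"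
      using length_star[of A] length_star[of B] by (intro mult_le_mono) auto
    ultimately show ?thesis using False
      unfolding star.simps split_Dec_def if_not_P[OF False] esize_append add_mult_distrib by linarith
  qed
next
  show "pt (\<lambda>p. [Lit p])" by (intro pt_intros)
qed (simp_all add: assms esize_append)

definition stars :: "form list \<Rightarrow> form list" where
  "stars As = concat (map star As)"

lemma pt_stars [pt_intros]: "pt f \<Longrightarrow> pt (\<lambda>x. stars (f x))"
  unfolding stars_def by (intro pt_intros)

lemma set_stars: "set (stars As) = (\<Union>A \<in> set As. set (star A))"
  by (auto simp: stars_def)

lemma stars_DT: "\<forall>A \<in> set As. is_DT A \<Longrightarrow> stars As = As"
  by (induction As) (auto simp: stars_def star_DT)

subsection \<open>Side formulas\<close>

text \<open>
  The line \<open>i\<close> is translated with the succedent \<open>side_forms \<pi> i\<close>: the formulas in the succedents of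
  all lines from \<open>i\<close> down to the end of the proof. For a left disjunction rule, the first premise also
  receives the second disjunct. This rule is the only one with two premises whose antecedents
  have the same length.
\<close>

definition extra :: "deriv \<Rightarrow> nat list \<Rightarrow> nat \<Rightarrow> form list" where
  "extra \<pi> js c = (if length js = 2 \<and> c = hd js \<and>
       length (fst (look \<pi> (hd js))) = length (fst (look \<pi> (hd (tl js))))
     then stars (filter (\<lambda>A. A \<notin> set (fst (look \<pi> (hd js)))) (fst (look \<pi> (hd (tl js))))) else [])"

lemma pt_extra [pt_intros]: "pt f \<Longrightarrow> pt g \<Longrightarrow> pt h \<Longrightarrow> pt (\<lambda>x. extra (f x) (g x) (h x))"
  by (rule pt_app3[of extra]) (unfold extra_def, intro pt_intros)

text \<open>Premises precede their conclusions, so one pass over the lines in order meets the path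
  from a line down to the root. In a tree the next line of the path is unique.\<close>

definition climb :: "deriv \<Rightarrow> nat \<times> form list \<Rightarrow> nat \<times> line \<Rightarrow> nat \<times> form list" where
  "climb \<pi> s e = (if fst s \<in> set (snd (snd e))
     then (fst e, stars (snd (fst (snd e))) @ extra \<pi> (snd (snd e)) (fst s) @ snd s) else s)"

definition side_forms :: "deriv \<Rightarrow> nat \<Rightarrow> form list" where
  "side_forms \<pi> i = snd (foldl (climb \<pi>) (i, stars (snd (look \<pi> i))) (List.enumerate 0 \<pi>))"

lemma pt_side_forms [pt_intros]: "pt f \<Longrightarrow> pt g \<Longrightarrow> pt (\<lambda>x. side_forms (f x) (g x))"
proof (rule pt_app2[of side_forms])
  define f where "f = (\<lambda>(\<pi> :: deriv) (e :: nat \<times> line).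
    stars (snd (fst (snd e))) @ extra \<pi> (snd (snd e)) (hd (snd (snd e))))"
  have "pt (\<lambda>z. f (fst z) (snd z))" unfolding f_def by (intro pt_intros)
  then obtain P where P: "\<And>m n. m \<le> n \<Longrightarrow> P m \<le> P n"
    "\<And>h :: deriv \<times> nat \<Rightarrow> nat. pbd h \<Longrightarrow> pbd (\<lambda>x. P (h x))"
    "\<And>\<pi> e. esize (f \<pi> e) \<le> P (esize \<pi> + esize e)"
    by (rule pt_pbd2) blast
  \<comment> \<open>\<open>extra\<close> is empty unless \<open>c = hd js\<close>, so its value
    there bounds all others. The growth per step then depends only on the proof and the line
    visited, not on the state of the climb.\<close>
  have ex: "esize (extra \<pi> js c) \<le> esize (extra \<pi> js (hd js))" for \<pi> js c
    by (simp add: extra_def)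
  define B where "B = (\<lambda>x :: deriv \<times> nat. P (esize (fst x) + esize (List.enumerate 0 (fst x))) + esize (List.enumerate 0 (fst x)))"
  have en: "pt (\<lambda>x :: deriv \<times> nat. List.enumerate 0 (fst x))" by (intro pt_intros)
  have "pt (\<lambda>x. foldl (climb (fst x)) (snd x, stars (snd (look (fst x) (snd x)))) (List.enumerate 0 (fst x)))"
  proof (rule pt_foldl[where step = "\<lambda>x. climb (fst x)" and B = B])
    show "pt (\<lambda>z :: (deriv \<times> nat) \<times> (nat \<times> form list) \<times> nat \<times> line. climb (fst (fst z)) (fst (snd z)) (snd (snd z)))"
      unfolding climb_def by (intro pt_intros)
    show "pbd B" unfolding B_def by (intro pbd_intros P(2) pbd_pt[OF en])
    fix x :: "deriv \<times> nat" and ys e zs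
    assume "List.enumerate 0 (fst x) = ys @ e # zs"
    then have e: "esize e < esize (List.enumerate 0 (fst x))" by (intro esize_in_list) simp
    let ?s = "foldl (climb (fst x)) (snd x, stars (snd (look (fst x) (snd x)))) ys"
    have "esize (stars (snd (fst (snd e)))) + esize (extra (fst x) (snd (snd e)) (fst ?s)) \<le>
        P (esize (fst x) + esize e)"
      using P(3)[of "fst x" e] ex[of "fst x" "snd (snd e)" "fst ?s"] by (simp add: f_def esize_append)
    also have "\<dots> \<le> P (esize (fst x) + esize (List.enumerate 0 (fst x)))" using e by (intro P(1)) simp
    finally show "esize (foldl (climb (fst x)) (snd x, stars (snd (look (fst x) (snd x)))) (ys @ [e])) \<le> esize ?s + B x"
      using e by (simp add: climb_def[of _ ?s] B_def esize_append)
  qed (intro pt_intros)+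
  then show "pt (\<lambda>z :: deriv \<times> nat. side_forms (fst z) (snd z))"
    unfolding side_forms_def by (rule pt_snd)
qed

lemma climb_skip:
  "(\<And>e. e \<in> set es \<Longrightarrow> c \<notin> set (snd (snd e))) \<Longrightarrow> foldl (climb \<pi>) (c, L) es = (c, L)"
  by (induction es) (auto simp: climb_def)

lemma climb_append:
  "foldl (climb \<pi>) (c, L @ M) es =
     (fst (foldl (climb \<pi>) (c, L) es), snd (foldl (climb \<pi>) (c, L) es) @ M)"
proof (induction es arbitrary: c L)
  case (Cons e es)
  show ?case
    using Cons[of "fst e" "stars (snd (fst (snd e))) @ extra \<pi> (snd (snd e)) c @ L"] Cons[of c L]
    by (simp add: climb_def)
qed simp

lemma distinct_concat_unique:
  assumes "distinct (concat (map f xs))" "i < length xs" "k < length xs"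
    "j \<in> set (f (xs ! i))" "j \<in> set (f (xs ! k))"
  shows "i = k"
  using assms
proof (induction xs arbitrary: i k)
  case (Cons x xs)
  have d: "distinct (concat (map f xs))" "set (f x) \<inter> set (concat (map f xs)) = {}"
    using Cons.prems(1) by auto
  have sub: "j \<in> set (concat (map f xs))" if "m < length xs" "j \<in> set (f (xs ! m))" for m
    using that nth_mem[of m xs] by (simp only: set_concat set_map) blast
  show ?case
  proof (cases i)
    case 0
    then show ?thesis using Cons.prems(3-5) d(2) sub by (cases k) auto
  next
    case (Suc i')
    show ?thesis
    proof (cases k)
      case 0
      then show ?thesis using Suc Cons.prems(2,4,5) d(2) sub[of i'] by auto
    next
      case k: (Suc k')
      then show ?thesis using Suc Cons.IH[OF d(1), of i' k'] Cons.prems(2-5) by simp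
    qed
  qed
qed simp

section \<open>Side formulas along the paths of a tree-like proof\<close>

locale tree_proof =
  fixes \<pi> :: deriv and S :: sequent
  assumes tree: "tree_LNDT_proof \<pi> S" and DT_S: "DT_sequent S"
begin

abbreviation "ant i \<equiv> fst (fst (\<pi> ! i))"
abbreviation "suc i \<equiv> snd (fst (\<pi> ! i))"
abbreviation "prems i \<equiv> snd (\<pi> ! i)"
abbreviation "L \<equiv> side_forms \<pi>"

lemma prems_less: "i < length \<pi> \<Longrightarrow> j \<in> set (prems i) \<Longrightarrow> j < i"
  using tree unfolding tree_LNDT_proof_def derives_def line_prems_def by blast

lemma inf: "i < length \<pi> \<Longrightarrow> lndt_inf (map (\<lambda>j. ms (fst (\<pi> ! j))) (prems i)) (ms (fst (\<pi> ! i)))"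
  using tree unfolding tree_LNDT_proof_def derives_def line_prems_def line_seq_eq by blast

lemma prems_unique: "i < length \<pi> \<Longrightarrow> k < length \<pi> \<Longrightarrow> j \<in> set (prems i) \<Longrightarrow> j \<in> set (prems k) \<Longrightarrow> i = k"
  using tree distinct_concat_unique[of line_prems \<pi> i k j]
  unfolding tree_LNDT_proof_def tree_like_def line_prems_def by blast

lemma prems_distinct: "i < length \<pi> \<Longrightarrow> distinct (prems i)"
  using tree unfolding tree_LNDT_proof_def tree_like_def line_prems_def
  by (auto simp: distinct_concat_iff)

lemma enumerate_split: "i < length \<pi> \<Longrightarrow> List.enumerate 0 \<pi> =
    List.enumerate 0 (take i \<pi>) @ (i, \<pi> ! i) # List.enumerate (Suc i) (drop (Suc i) \<pi>)"
proof -
  assume i: "i < length \<pi>"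
  then have "\<pi> = take i \<pi> @ \<pi> ! i # drop (Suc i) \<pi>" by (rule id_take_nth_drop)
  then have "List.enumerate 0 \<pi> = List.enumerate 0 (take i \<pi> @ \<pi> ! i # drop (Suc i) \<pi>)" by simp
  then show ?thesis using i by (simp add: enumerate_append_eq)
qed

lemma climb_prefix:
  assumes "i \<le> length \<pi>" "\<And>k. k < i \<Longrightarrow> c \<notin> set (prems k)"
  shows "foldl (climb \<pi>) (c, M) (List.enumerate 0 (take i \<pi>)) = (c, M)"
proof (rule climb_skip)
  fix e assume "e \<in> set (List.enumerate 0 (take i \<pi>))"
  then have "fst e < i" "\<pi> ! fst e = snd e" by (auto simp: in_set_enumerate_eq)
  then show "c \<notin> set (snd (snd e))" using assms(2) by metis
qed

lemma L_eq:
  assumes i: "i < length \<pi>"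
  shows "L i = snd (foldl (climb \<pi>) (i, stars (suc i)) (List.enumerate (Suc i) (drop (Suc i) \<pi>)))"
proof -
  have "i \<notin> set (prems k)" if "k \<le> i" for k using prems_less[of k i] that i by auto
  then have "foldl (climb \<pi>) (i, stars (suc i)) (List.enumerate 0 (take i \<pi>)) = (i, stars (suc i))"
    "climb \<pi> (i, stars (suc i)) (i, \<pi> ! i) = (i, stars (suc i))"
    using i by (auto intro!: climb_prefix simp: climb_def)
  then show ?thesis unfolding side_forms_def enumerate_split[OF i] using i by (simp add: look_eq)
qed

text \<open>The tree shape enters here: no line before \<open>i\<close> has \<open>j\<close> as a
  premise, so the climb from \<open>j\<close> first moves to \<open>i\<close> and then continues as
  the climb from \<open>i\<close> does.\<close>

lemma L_prem:
  assumes i: "i < length \<pi>" and j: "j \<in> set (prems i)"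
  shows "L j = L i @ extra \<pi> (prems i) j @ stars (suc j)"
proof -
  have jl: "j < length \<pi>" using prems_less[OF i j] i by simp
  have "j \<notin> set (prems k)" if "k < i" for k using prems_unique[of k i j] that i j by auto
  then have "foldl (climb \<pi>) (j, stars (suc j)) (List.enumerate 0 (take i \<pi>)) = (j, stars (suc j))"
    using i by (intro climb_prefix) auto
  then have "L j = snd (foldl (climb \<pi>) (i, stars (suc i) @ extra \<pi> (prems i) j @ stars (suc j))
      (List.enumerate (Suc i) (drop (Suc i) \<pi>)))"
    unfolding side_forms_def enumerate_split[OF i] using j jl by (simp add: look_eq climb_def)
  then show ?thesis unfolding climb_append L_eq[OF i] by simp
qed

lemma L_suc: "i < length \<pi> \<Longrightarrow> set (stars (suc i)) \<subseteq> set (L i)"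
  using climb_append[of \<pi> i "[]" "stars (suc i)"] by (simp add: L_eq)

lemma nonempty: "\<pi> \<noteq> []"
  using tree by (simp add: tree_LNDT_proof_def derives_def)

lemma DT_last: "DT_lseq (fst (last \<pi>))"
  using tree DT_S unfolding tree_LNDT_proof_def derives_def line_seq_eq
  by (auto simp: DT_sequent_def DT_lseq_def ms_def)

lemma L_last: "L (length \<pi> - 1) = snd (fst (last \<pi>))"
proof -
  have "L (length \<pi> - 1) = stars (suc (length \<pi> - 1))"
    using nonempty by (subst L_eq) auto
  then show ?thesis using DT_last nonempty by (simp add: stars_DT DT_lseq_def last_conv_nth)
qed

end

text \<open>Collects the succedents in the readings of all lines: one for the conclusion of a line
  and one for each of its hypotheses.\<close>

definition succs :: "deriv \<Rightarrow> form list list" where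
  "succs \<pi> = concat (map (\<lambda>e. side_forms \<pi> (fst e) #
     map (\<lambda>A. star A @ side_forms \<pi> (fst e)) (fst (fst (snd e)))) (List.enumerate 0 \<pi>))"

lemma pt_succs [pt_intros]: "pt f \<Longrightarrow> pt (\<lambda>x. succs (f x))"
  by (rule pt_comp[of succs]) (unfold succs_def, intro pt_intros)

definition dag_proof :: "deriv \<Rightarrow> deriv" where
  "dag_proof \<pi> = dag_of (insts (fst (fst (hd (rev \<pi>)))) (succs \<pi>)) (fst (hd (rev \<pi>)))"

lemma pt_dag_proof: "pt dag_proof"
  unfolding dag_proof_def by (intro pt_intros)

subsection \<open>Correctness of the translation\<close>

lemma climb_DT:
  assumes "\<forall>A \<in> set M. is_DT A"
  shows "\<forall>A \<in> set (snd (foldl (climb \<pi>) (c, M) es)). is_DT A"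
  using assms
proof (induction es arbitrary: c M)
  case (Cons e es)
  have "\<forall>A \<in> set (snd (climb \<pi> (c, M) e)). is_DT A"
    using Cons.prems by (auto simp: climb_def extra_def set_stars dest: star_is_DT)
  then show ?case using Cons.IH[of "snd (climb \<pi> (c, M) e)" "fst (climb \<pi> (c, M) e)"] by simp
qed simp

lemma side_forms_DT: "A \<in> set (side_forms \<pi> i) \<Longrightarrow> is_DT A"
  using climb_DT[of "stars (snd (look \<pi> i))" \<pi> i "List.enumerate 0 \<pi>"]
  by (auto simp: side_forms_def set_stars dest: star_is_DT)

lemma succs_DT: "T \<in> set (succs \<pi>) \<Longrightarrow> A \<in> set T \<Longrightarrow> is_DT A"
  by (auto simp: succs_def dest: side_forms_DT star_is_DT)

lemma ms_eqD:
  assumes "ms S = (G, D)"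
  shows "set (fst S) = set_mset G" "set (snd S) = set_mset D" "length (fst S) = size G"
  using assms by (auto simp: ms_def)

context succedents
begin

lemma dec_elim_false:
  assumes "u \<in> set (star (Dec A p B))" "u \<in> set (subforms J)" "Lit p \<in> set T" "set (star A) \<subseteq> set T"
  shows "\<exists>a. ax a \<and> subseq a ([u], T)"
proof -
  obtain X Y where u: "u = Dec X p Y" "X \<in> set (star A) \<or> X = Lit p" using assms(1) by (rule star_Dec_cases)
  then show ?thesis using ax_dec(3)[of X p Y] assms(2-) by (intro exI[of _ "([u], [X, Lit p])"]) auto
qed

text \<open>A proper right branch lies in \<open>star B\<close>. The dummy one is the complement of
  \<open>p\<close> and contradicts the \<open>p\<close> in the antecedent, which calls for the axiom
  with empty succedent.\<close>

lemma dec_elim_true: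
  assumes "u \<in> set (star (Dec A p B))" "u \<in> set (subforms J)" "set (star B) \<subseteq> set T"
  shows "\<exists>a. ax a \<and> subseq a ([u, Lit p], T)"
proof -
  obtain X Y where u: "u = Dec X p Y" "Y \<in> set (star B) \<or> Y = Lit (compl p)" using assms(1) by (rule star_Dec_cases)
  from u(2) show ?thesis
  proof
    assume "Y \<in> set (star B)"
    then show ?thesis using ax_dec(4)[of X p Y] assms(2-) u(1) by (intro exI[of _ "([u, Lit p], [Y])"]) auto
  next
    assume "Y = Lit (compl p)"
    then show ?thesis using ax_dec(5)[of X p Y] assms(2-) u(1) by (intro exI[of _ "([u, Lit p], [])"]) auto
  qed
qed

lemma dec_intro_false:
  assumes "X \<in> set (star A)" "set (star (Dec A p B)) \<subseteq> set (subforms J)"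
    "Lit p \<in> set T" "set (star (Dec A p B)) \<subseteq> set T"
  shows "\<exists>a. ax a \<and> subseq a ([X], T)"
proof -
  obtain Y where "Dec X p Y \<in> set (star (Dec A p B))" using star_Dec_left[OF assms(1)] by blast
  then show ?thesis using ax_dec(1)[of X p Y] assms(2-)
    by (intro exI[of _ "([X], [Lit p, Dec X p Y])"]) auto
qed

lemma dec_intro_true:
  assumes "Y \<in> set (star B)" "set (star (Dec A p B)) \<subseteq> set (subforms J)"
    "set (star (Dec A p B)) \<subseteq> set T"
  shows "\<exists>a. ax a \<and> subseq a ([Y, Lit p], T)"
proof -
  obtain X where "Dec X p Y \<in> set (star (Dec A p B))" using star_Dec_right[OF assms(1)] by blast
  then show ?thesis using ax_dec(2)[of X p Y] assms(2-)
    by (intro exI[of _ "([Lit p, Y], [Dec X p Y])"]) auto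
qed

lemma star_lits: "set (star (Dec A p B)) \<subseteq> set (subforms J) \<Longrightarrow> p \<in> set (lits J)"
proof -
  assume sub: "set (star (Dec A p B)) \<subseteq> set (subforms J)"
  obtain Z where "Z \<in> set (star (Dec A p B))" using star_nonempty[of "Dec A p B"] by (meson last_in_set)
  then obtain X Y where "Z = Dec X p Y" "Z \<in> set (subforms J)" using sub star_Dec_cases by (metis subsetD)
  then show ?thesis using subforms_closed(3) by simp
qed

end

section \<open>Deriving the readings of all lines\<close>

context tree_proof
begin

abbreviation "\<Pi> \<equiv> ant (length \<pi> - 1)"
abbreviation "J \<equiv> succs \<pi>"

sublocale succedents \<Pi> J
proof
  show "is_DT A" if "A \<in> set \<Pi>" for A
    using that DT_last nonempty by (simp add: DT_lseq_def last_conv_nth)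
qed (rule succs_DT)

definition hyp :: "nat \<Rightarrow> form \<Rightarrow> bool" where
  "hyp i A \<longleftrightarrow> D (\<Pi>, star A @ L i)"

lemma in_succs:
  assumes "i < length \<pi>"
  shows "L i \<in> set J" "A \<in> set (ant i) \<Longrightarrow> star A @ L i \<in> set J"
proof -
  have "(i, \<pi> ! i) \<in> set (List.enumerate 0 \<pi>)" using assms by (simp add: in_set_enumerate_eq)
  then show "L i \<in> set J" "A \<in> set (ant i) \<Longrightarrow> star A @ L i \<in> set J"
    unfolding succs_def by force+
qed

lemma goalsI: "T \<in> set J \<Longrightarrow> T \<in> set (goals J)"
  "T \<in> set J \<Longrightarrow> p \<in> set (lits J) \<Longrightarrow> Lit p # T \<in> set (goals J)"
  by (auto simp: goals_def)

lemma star_subforms: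
  assumes "i < length \<pi>" "A \<in> set (ant i) \<union> set (suc i)"
  shows "set (star A) \<subseteq> set (subforms J)"
proof -
  have "\<exists>T \<in> set J. set (star A) \<subseteq> set T"
    using assms(2)
  proof
    assume "A \<in> set (suc i)"
    then have "set (star A) \<subseteq> set (L i)" using L_suc[OF assms(1)] by (auto simp: set_stars)
    then show ?thesis using in_succs(1)[OF assms(1)] by blast
  next
    assume "A \<in> set (ant i)"
    from in_succs(2)[OF assms(1) this] show ?thesis by (intro bexI[of _ "star A @ L i"]) auto
  qed
  then show ?thesis using in_subforms by blast
qed

lemma L_mono: "i < length \<pi> \<Longrightarrow> j \<in> set (prems i) \<Longrightarrow> set (L i) \<subseteq> set (L j)"
  by (simp add: L_prem)

text \<open>Side formulas only increase from a line to its premises, so a hypothesis of the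
  conclusion weakens to one of the premise.\<close>

lemma hyp_prem:
  assumes "i < length \<pi>" "j \<in> set (prems i)" "A \<in> set (ant i)" "A \<in> set (ant j)" "hyp i A"
  shows "hyp j A"
  unfolding hyp_def
proof (rule D_weak)
  show "D (\<Pi>, star A @ L i)" using assms(5) by (simp add: hyp_def)
  show "set (star A @ L i) \<subseteq> set (star A @ L j)" using L_mono[OF assms(1,2)] by auto
  have "j < length \<pi>" using prems_less[OF assms(1,2)] assms(1) by simp
  then show "star A @ L i \<in> set (goals J)" "star A @ L j \<in> set (goals J)"
    using assms in_succs goalsI by blast+
qed

lemma unary:
  assumes i: "i < length \<pi>" "prems i = [j]" and IH: "(\<And>A. A \<in> set (ant j) \<Longrightarrow> hyp j A) \<Longrightarrow> D (\<Pi>, L j)"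
    and hyps: "\<And>A. A \<in> set (ant i) \<Longrightarrow> hyp i A"
    and ant: "set (ant j) \<subseteq> set (ant i)" and suc: "set (stars (suc j)) \<subseteq> set (stars (suc i))"
  shows "D (\<Pi>, L i)"
proof (rule D_weak)
  have j: "j \<in> set (prems i)" "j < length \<pi>" using prems_less[of i j] i by auto
  show "D (\<Pi>, L j)" using hyp_prem[OF i(1) j(1)] hyps ant by (intro IH) blast
  show "set (L j) \<subseteq> set (L i)"
    using suc L_suc[OF i(1)] i unfolding L_prem[OF i(1) j(1)] by (auto simp: extra_def)
  show "L j \<in> set (goals J)" "L i \<in> set (goals J)"
    using i(1) j(2) in_succs goalsI by blast+
qed

text \<open>Hypotheses about context formulas are inherited from the conclusion. In a binary rule
  the new formulas of the first premise come from the hypothesis on the principal formula, if they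
  need one; what the first premise yields then helps to supply the hypotheses on the new formulas of
  the second. Thus a cut formula on the right becomes a hypothesis for its occurrence on the
  left.\<close>

lemma D_line:
  "i < length \<pi> \<Longrightarrow> (\<And>A. A \<in> set (ant i) \<Longrightarrow> hyp i A) \<Longrightarrow> D (\<Pi>, L i)"
proof (induction i rule: less_induct)
  case (less i)
  note i = less.prems(1) and hyps = less.prems(2)
  have IH: "D (\<Pi>, L j)" if "j \<in> set (prems i)" "\<And>A. A \<in> set (ant j) \<Longrightarrow> hyp j A" for j
    using less.IH[of j] prems_less[OF i that(1)] i that(2) by simp
  have gi: "L i \<in> set (goals J)" "\<And>A. A \<in> set (ant i) \<Longrightarrow> star A @ L i \<in> set (goals J)"
    by (intro goalsI in_succs i; assumption?)+
  have gj: "j < length \<pi>" "L j \<in> set (goals J)"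
      "\<And>A. A \<in> set (ant j) \<Longrightarrow> star A @ L j \<in> set (goals J)" if "j \<in> set (prems i)" for j
  proof -
    show j: "j < length \<pi>" using i prems_less[OF i that] by simp
    show "L j \<in> set (goals J)" by (rule goalsI(1)[OF in_succs(1)[OF j]])
    show "star A @ L j \<in> set (goals J)" if "A \<in> set (ant j)" for A
      by (rule goalsI(1)[OF in_succs(2)[OF j that]])
  qed
  note sfi = star_subforms[OF i]
  have Li: "set (star A) \<subseteq> set (L i)" if "A \<in> set (suc i)" for A
    using that L_suc[OF i] by (auto simp: set_stars)
  have un: "D (\<Pi>, L i)" if "prems i = [j]" "set (ant j) \<subseteq> set (ant i)"
      "set (stars (suc j)) \<subseteq> set (stars (suc i))" for j
  proof (rule unary[OF i that(1) _ hyps that(2,3)])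
    show "D (\<Pi>, L j)" if "\<And>A. A \<in> set (ant j) \<Longrightarrow> hyp j A" using IH[of j] that \<open>prems i = [j]\<close> by simp
  qed
  have bi: "j \<in> set (prems i)" "k \<in> set (prems i)" "set (L k) = set (L i) \<union> set (stars (suc k))"
      "set (L j) = set (L i) \<union> set (stars (suc j)) \<union> (if length (ant j) = length (ant k)
        then set (stars (filter (\<lambda>C. C \<notin> set (ant j)) (ant k))) else {})" if "prems i = [j, k]" for j k
  proof -
    show jk: "j \<in> set (prems i)" "k \<in> set (prems i)" using that by auto
    have "j \<noteq> k" using prems_distinct[OF i] that by simp
    then show "set (L k) = set (L i) \<union> set (stars (suc k))"
      "set (L j) = set (L i) \<union> set (stars (suc j)) \<union> (if length (ant j) = length (ant k)
        then set (stars (filter (\<lambda>C. C \<notin> set (ant j)) (ant k))) else {})"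
      using that gj(1)[OF jk(1)] gj(1)[OF jk(2)] L_prem[OF i jk(1)] L_prem[OF i jk(2)]
      by (auto simp: extra_def look_eq)
  qed
  show ?case
    using inf[OF i]
  proof (cases rule: lndt_inf.cases)
    case ldt
    then show ?thesis
    proof (cases rule: ldt_inf.cases)
      case (init_id p)
      have "set (ant i) = {Lit p}" "set (suc i) = {Lit p}" using ms_eqD[OF init_id(2)] by simp_all
      then have h: "hyp i (Lit p)" "set (star (Lit p)) \<subseteq> set (L i)" "Lit p \<in> set (ant i)"
        using hyps[of "Lit p"] Li[of "Lit p"] by simp_all
      show ?thesis
      proof (rule D_weak[OF _ _ gi(2)[OF h(3)] gi(1)])
        show "D (\<Pi>, star (Lit p) @ L i)" using h(1) by (simp add: hyp_def)
        show "set (star (Lit p) @ L i) \<subseteq> set (L i)" using h(2) by simp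
      qed
    next
      case (init_l p)
      have a: "set (ant i) = {Lit p, Lit (compl p)}" using ms_eqD[OF init_l(2)] by simp
      then have h: "hyp i (Lit p)" "hyp i (Lit (compl p))" using hyps by auto
      have p: "p \<in> set (lits J)" using sfi[of "Lit p"] a by (intro Lit_subforms) auto
      show ?thesis
      proof (rule D_replace_lit[OF _ gi(1) _ p])
        show "D (\<Pi>, star (Lit (compl p)) @ L i)" "D (\<Pi>, Lit p # L i)" using h by (auto simp: hyp_def)
        show "star (Lit (compl p)) @ L i \<in> set (goals J)" using a by (intro gi(2)) auto
        fix u assume "u \<in> set (star (Lit (compl p)) @ L i)"
        then have "u \<in> set (L i) \<or> subseq ([Lit p, Lit (compl p)], []) ([u, Lit p], L i)" by auto
        then show "u \<in> set (L i) \<or> (\<exists>a. ax a \<and> subseq a ([u, Lit p], L i))"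
          using ax_lits(2)[OF p] by blast
      qed
    next
      case (init_r p)
      have a: "set (suc i) = {Lit p, Lit (compl p)}" using ms_eqD[OF init_r(2)] by simp
      have p: "p \<in> set (lits J)" using sfi[of "Lit p"] a by (intro Lit_subforms) auto
      show ?thesis
        by (rule D_ax[OF ax_lits(3)[OF p] _ gi(1)]) (use Li[of "Lit p"] Li[of "Lit (compl p)"] a in auto)
    next
      case (weak_l G Q A)
      then obtain j where j: "prems i = [j]" "ms (fst (\<pi> ! j)) = (G, Q)" by auto
      from ms_eqD[OF j(2)] ms_eqD[OF weak_l(2)] show ?thesis
        by (intro un[OF j(1)]) (auto simp: set_stars)
    next
      case (weak_r G Q A)
      then obtain j where j: "prems i = [j]" "ms (fst (\<pi> ! j)) = (G, Q)" by auto
      from ms_eqD[OF j(2)] ms_eqD[OF weak_r(2)] show ?thesis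
        by (intro un[OF j(1)]) (auto simp: set_stars)
    next
      case (contr_l A G Q)
      then obtain j where j: "prems i = [j]" "ms (fst (\<pi> ! j)) = (add_mset A (add_mset A G), Q)" by auto
      from ms_eqD[OF j(2)] ms_eqD[OF contr_l(2)] show ?thesis
        by (intro un[OF j(1)]) (auto simp: set_stars)
    next
      case (contr_r G A Q)
      then obtain j where j: "prems i = [j]" "ms (fst (\<pi> ! j)) = (G, add_mset A (add_mset A Q))" by auto
      from ms_eqD[OF j(2)] ms_eqD[OF contr_r(2)] show ?thesis
        by (intro un[OF j(1)]) (auto simp: set_stars)
    next
      case (cut G A Q)
      then obtain j k where jk: "prems i = [j, k]" "ms (fst (\<pi> ! j)) = (G, add_mset A Q)"
        "ms (fst (\<pi> ! k)) = (add_mset A G, Q)" by auto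
      note mj = ms_eqD[OF jk(2)] and mk = ms_eqD[OF jk(3)] and mi = ms_eqD[OF cut(2)]
      note j = bi(1)[OF jk(1)] and k = bi(2)[OF jk(1)]
      have Lj: "set (L j) = set (L i) \<union> set (star A)" and Lk: "set (L k) = set (L i)"
        using bi(3,4)[OF jk(1)] L_suc[OF i] mi(2) mj(2,3) mk(2,3) by (auto simp: set_stars)
      have "hyp j C" if "C \<in> set (ant j)" for C using hyp_prem[OF i j] hyps that mi(1) mj(1) by auto
      then have 1: "D (\<Pi>, L j)" by (rule IH[OF j])
      have A: "hyp k A" unfolding hyp_def
        by (rule D_weak[OF 1]) (use gj[OF k] gj[OF j] mk(1) Lj Lk in auto)
      have "hyp k C" if "C \<in> set (ant k)" for C
        using hyp_prem[OF i k] hyps that mi(1) mk(1) A by auto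
      then have "D (\<Pi>, L k)" by (rule IH[OF k])
      then show ?thesis by (rule D_weak) (use Lk gi gj[OF k] in auto)
    next
      case (dec_l A G p Q B)
      then obtain j k where jk: "prems i = [j, k]" "ms (fst (\<pi> ! j)) = (add_mset A G, add_mset (Lit p) Q)"
        "ms (fst (\<pi> ! k)) = (add_mset (Lit p) (add_mset B G), Q)" by auto
      note mj = ms_eqD[OF jk(2)] and mk = ms_eqD[OF jk(3)] and mi = ms_eqD[OF dec_l(2)]
      note j = bi(1)[OF jk(1)] and k = bi(2)[OF jk(1)]
      have Lj: "set (L j) = set (L i) \<union> {Lit p}" and Lk: "set (L k) = set (L i)"
        using bi(3,4)[OF jk(1)] L_suc[OF i] mi(2) mj(2,3) mk(2,3) by (auto simp: set_stars)
      let ?Z = "Dec A p B"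
      have Z: "D (\<Pi>, star ?Z @ L i)" "?Z \<in> set (ant i)" using hyps[of ?Z] mi(1) by (auto simp: hyp_def)
      have sub: "set (star ?Z) \<subseteq> set (subforms J)" using sfi Z(2) by blast
      have p: "p \<in> set (lits J)" by (rule star_lits[OF sub])
      have A: "hyp j A" unfolding hyp_def
      proof (rule D_replace_plain[OF gi(2)[OF Z(2)] _ Z(1)])
        show "star A @ L j \<in> set (goals J)" using gj(3)[OF j] mj(1) by simp
        show "u \<in> set (star A @ L j) \<or> (\<exists>a. ax a \<and> subseq a ([u], star A @ L j))"
          if "u \<in> set (star ?Z @ L i)" for u
          using that dec_elim_false[of u A p B "star A @ L j"] sub Lj by auto
      qed
      have "hyp j C" if "C \<in> set (ant j)" for C
        using hyp_prem[OF i j] hyps that mi(1) mj(1) A by auto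
      then have 1: "D (\<Pi>, L j)" by (rule IH[OF j])
      have Bk: "B \<in> set (ant k)" "Lit p \<in> set (ant k)" using mk(1) by auto
      have P: "hyp k (Lit p)" unfolding hyp_def
        by (rule D_weak[OF 1 _ gj(2)[OF j] gj(3)[OF k Bk(2)]]) (use Lj Lk in auto)
      have B: "hyp k B" unfolding hyp_def
      proof (rule D_replace_lit[OF gi(2)[OF Z(2)] gj(3)[OF k Bk(1)] Z(1) p])
        show "D (\<Pi>, Lit p # star B @ L k)"
        proof (rule D_weak[OF 1 _ gj(2)[OF j]])
          show "Lit p # star B @ L k \<in> set (goals J)"
            using in_succs(2)[OF gj(1)[OF k] Bk(1)] p by (rule goalsI)
        qed (use Lj Lk in auto)
        show "u \<in> set (star B @ L k) \<or> (\<exists>a. ax a \<and> subseq a ([u, Lit p], star B @ L k))"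
          if "u \<in> set (star ?Z @ L i)" for u
          using that dec_elim_true[of u A p B "star B @ L k"] sub Lk by auto
      qed
      have "hyp k C" if "C \<in> set (ant k)" for C
        using hyp_prem[OF i k] hyps that mi(1) mk(1) P B by auto
      then have "D (\<Pi>, L k)" by (rule IH[OF k])
      then show ?thesis by (rule D_weak) (use Lk gi gj[OF k] in auto)
    next
      case (dec_r G A p Q B)
      then obtain j k where jk: "prems i = [j, k]" "ms (fst (\<pi> ! j)) = (G, add_mset A (add_mset (Lit p) Q))"
        "ms (fst (\<pi> ! k)) = (add_mset (Lit p) G, add_mset B Q)" by auto
      note mj = ms_eqD[OF jk(2)] and mk = ms_eqD[OF jk(3)] and mi = ms_eqD[OF dec_r(2)]
      note j = bi(1)[OF jk(1)] and k = bi(2)[OF jk(1)]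
      have Lj: "set (L j) = set (L i) \<union> set (star A) \<union> {Lit p}"
        and Lk: "set (L k) = set (L i) \<union> set (star B)"
        using bi(3,4)[OF jk(1)] L_suc[OF i] mi(2) mj(2,3) mk(2,3) by (auto simp: set_stars)
      let ?Z = "Dec A p B"
      have Z: "?Z \<in> set (suc i)" "set (star ?Z) \<subseteq> set (L i)" using mi(2) Li[of ?Z] by auto
      have sub: "set (star ?Z) \<subseteq> set (subforms J)" using sfi Z(1) by blast
      have p: "p \<in> set (lits J)" by (rule star_lits[OF sub])
      have "hyp j C" if "C \<in> set (ant j)" for C using hyp_prem[OF i j] hyps that mi(1) mj(1) by auto
      then have 1: "D (\<Pi>, L j)" by (rule IH[OF j])
      \<comment> \<open>Stated for a general \<open>M\<close> because it is needed twice: with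
        \<open>L k\<close> it is the hypothesis on \<open>p\<close> for the second premise, and with
        \<open>L i\<close> it is the case of \<open>p\<close> false for the conclusion.\<close>
      have P': "D (\<Pi>, Lit p # M)" if "M \<in> set J" "set (L i) \<subseteq> set M" for M
      proof (rule D_replace_plain[OF gj(2)[OF j] goalsI(2)[OF that(1) p] 1])
        show "u \<in> set (Lit p # M) \<or> (\<exists>a. ax a \<and> subseq a ([u], Lit p # M))" if "u \<in> set (L j)" for u
          using that dec_intro_false[OF _ sub, of u "Lit p # M"] Lj Z(2) \<open>set (L i) \<subseteq> set M\<close> by auto
      qed
      have P: "hyp k (Lit p)" unfolding hyp_def
        using P'[OF in_succs(1)[OF gj(1)[OF k]]] Lk by simp
      have "hyp k C" if "C \<in> set (ant k)" for C
        using hyp_prem[OF i k] hyps that mi(1) mk(1) P by auto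
      then have 2: "D (\<Pi>, L k)" by (rule IH[OF k])
      show ?thesis
      proof (rule D_replace_lit[OF gj(2)[OF k] gi(1) 2 p P'[OF in_succs(1)[OF i] order_refl]])
        show "u \<in> set (L i) \<or> (\<exists>a. ax a \<and> subseq a ([u, Lit p], L i))" if "u \<in> set (L k)" for u
          using that dec_intro_true[OF _ sub Z(2), of u] Lk by auto
      qed
    qed
  next
    case (or_l A G Q B)
    then obtain j k where jk: "prems i = [j, k]" "ms (fst (\<pi> ! j)) = (add_mset A G, Q)"
      "ms (fst (\<pi> ! k)) = (add_mset B G, Q)" by auto
    note mj = ms_eqD[OF jk(2)] and mk = ms_eqD[OF jk(3)] and mi = ms_eqD[OF or_l(2)]
    note j = bi(1)[OF jk(1)] and k = bi(2)[OF jk(1)]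
    have Lj: "set (L j) = set (L i) \<union> (if B \<in> set (ant j) then {} else set (star B))"
      and Lk: "set (L k) = set (L i)"
      using bi(3,4)[OF jk(1)] L_suc[OF i] mi(2) mj mk by (auto simp: set_stars)
    have AB: "D (\<Pi>, star (Or A B) @ L i)" "Or A B \<in> set (ant i)"
      using hyps[of "Or A B"] mi(1) by (auto simp: hyp_def)
    have Bk: "B \<in> set (ant k)" using mk(1) by simp
    \<comment> \<open>\<open>extra\<close> finds \<open>B\<close> as the difference of the two
      antecedents, so it misses a \<open>B\<close> that also occurs in the first one. Such a
      \<open>B\<close> is either a context formula, whose hypothesis is inherited, or equal to
      \<open>A\<close>, and then the hypothesis on the disjunction suffices.\<close>
    have B: "hyp k B"
    proof (cases "B \<in> set (ant j)")
      case True
      then consider "B \<in> set_mset G" | "B = A" using mj(1) by auto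
      then show ?thesis
      proof cases
        case 1
        then show ?thesis using hyp_prem[OF i k] hyps mi(1) Bk by auto
      next
        case 2
        show ?thesis unfolding hyp_def
          by (rule D_weak[OF AB(1)]) (use 2 Lk gi(2)[OF AB(2)] gj(3)[OF k Bk] in auto)
      qed
    next
      case False
      have Aj: "A \<in> set (ant j)" using mj(1) by simp
      have A: "hyp j A" unfolding hyp_def
        by (rule D_weak[OF AB(1)]) (use False Lj gi(2)[OF AB(2)] gj(3)[OF j Aj] in auto)
      have "hyp j C" if "C \<in> set (ant j)" for C
        using hyp_prem[OF i j] hyps that mi(1) mj(1) A by auto
      then have 1: "D (\<Pi>, L j)" by (rule IH[OF j])
      show ?thesis unfolding hyp_def
        by (rule D_weak[OF 1]) (use False Lj Lk gj(2)[OF j] gj(3)[OF k Bk] in auto)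
    qed
    have "hyp k C" if "C \<in> set (ant k)" for C
      using hyp_prem[OF i k] hyps that mi(1) mk(1) B by auto
    then have "D (\<Pi>, L k)" by (rule IH[OF k])
    then show ?thesis by (rule D_weak) (use Lk gi gj[OF k] in auto)
  next
    case (or_r G A B Q)
    then obtain j where j: "prems i = [j]" "ms (fst (\<pi> ! j)) = (G, add_mset A (add_mset B Q))" by auto
    from ms_eqD[OF j(2)] ms_eqD[OF or_r(2)] show ?thesis
      by (intro un[OF j(1)]) (auto simp: set_stars)
  qed
qed

lemma dag_proof_correct: "LDT_proof (dag_proof \<pi>) S"
proof -
  let ?n = "length \<pi> - 1"
  have n: "?n < length \<pi>" using nonempty by simp
  have last: "fst (hd (rev \<pi>)) = (\<Pi>, L ?n)"
    using nonempty L_last by (simp add: hd_rev last_conv_nth)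
  have "D (\<Pi>, L ?n)"
  \<comment> \<open>At the root each hypothesis is a weakening of an identity \<open>A\<close>
    \<rightarrow> \<open>A\<close>, as \<open>A\<close> is a DT formula of the final
    antecedent.\<close>
  proof (rule D_line[OF n])
    fix A assume A: "A \<in> set \<Pi>"
    then have DT: "star A = [A]" using DT_\<Pi> star_DT by blast
    have g: "star A @ L ?n \<in> set (goals J)" using in_succs(2)[OF n A] by (rule goalsI)
    show "hyp ?n A" unfolding hyp_def
      by (rule D_ax[OF ax_id[OF g, of A] _ g]) (use A DT in auto)
  qed
  moreover have "DT_lseq (\<Pi>, L ?n)" using DT_last L_last nonempty by (simp add: last_conv_nth DT_lseq_def)
  ultimately have "LDT_proof (dag_proof \<pi>) (ms (\<Pi>, L ?n))"
    unfolding dag_proof_def last fst_conv by (intro dag_of_proof) (auto intro: insts_ok)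
  moreover have "ms (\<Pi>, L ?n) = S"
    using tree nonempty last unfolding tree_LNDT_proof_def derives_def line_seq_eq
    by (simp add: hd_rev)
  ultimately show ?thesis by simp
qed

end

theorem theorem4p7:
  shows "(\<exists>f :: deriv \<Rightarrow> deriv. polytime enc_deriv enc_deriv f \<and>
            (\<forall>\<pi> S. DT_sequent S \<longrightarrow> LDT_proof \<pi> S \<longrightarrow> tree_LNDT_proof (f \<pi>) S)) \<and>
         (\<exists>g :: deriv \<Rightarrow> deriv. polytime enc_deriv enc_deriv g \<and>
            (\<forall>\<pi> S. DT_sequent S \<longrightarrow> tree_LNDT_proof \<pi> S \<longrightarrow> LDT_proof (g \<pi>) S))"
proof (intro conjI exI allI impI)
  show "polytime enc_deriv enc_deriv (\<lambda>\<pi>. assemble (tree_code \<pi>))" by (rule polytime_tree_code)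
  show "polytime enc_deriv enc_deriv dag_proof" unfolding enc_deriv_eq by (rule pt_polytime[OF pt_dag_proof])
  show "tree_LNDT_proof (assemble (tree_code \<pi>)) S" if "LDT_proof \<pi> S" for \<pi> S
    using that by (rule tree_code_proof)
  show "LDT_proof (dag_proof \<pi>) S" if "DT_sequent S" "tree_LNDT_proof \<pi> S" for \<pi> S
    using that by (intro tree_proof.dag_proof_correct tree_proof.intro)
qed

end
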